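(* Let $k\ge2$, $m\ge 2$ be integers and let $\mathcal R=\mathcal R_{(H,\Phi)}$ be a non-degenerate and expanding graph recursion operator on $\mathcal G_k$ (associated with a gluing data $(H,\Phi)$ with parameters $k,m$). Let $G_0\in\mathcal G_k$ be maximally independent and let $G_{n+1}=\mathcal R(G_n)$ for $n\ge0$. Then the zeros of the independence polynomials $Z_{G_n}$ are uniformly bounded and avoid a uniform cone around $\mathbb R_{\ge0}$; that is, there exist $R>0$ and $\theta>0$ such that for every $n\ge0$ every zero $\lambda\in\mathbb C$ of $Z_{G_n}$ satisfies $|\lambda|\le R$ and does not lie in $\{0\}\cup\{re^{it}: r>0,\ |t|<\theta\}$.
   Context: Graphs are finite and undirected; multiple edges allowed, no loops. The independence polynomial of $G$ is $Z_G(\lambda)=\sum_I\lambda^{\#I}$, the sum over independent sets $I\subset V(G)$. $\mathcal G_k$ is the set of graphs with $k$ distinct marked vertices labeled $1,\dots,k$; $P(G)$ is the set of marked vertices of $G$. A gluing data with parameters $k\ge1,m\ge2$ is a pair $(H,\Phi)$: $H$ is a hypergraph with $V(H)=\{1,\dots,m\}$ and a finite multiset $E(H)$ of edges (nonempty subsets of $V(H)$), each edge $e$ carrying a label $\ell(e)\in\{1,\dots,k\}$ such that for each $j$ the edges labeled $j$ form a partition of $V(H)$; $\Phi:\{1,\dots,k\}\to E(H)$ is injective. For $G\in\mathcal G_k$, the graph $\mathcal R_{(H,\Phi)}(G)\in\mathcal G_k$ is obtained by taking $m$ disjoint copies $G(1),\dots,G(m)$ of $G$, identifying, for each $e\in E(H)$,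 the vertices labeled $\ell(e)$ in the copies $G(i)$, $i\in e$, and then giving the new label $j$ to the vertex corresponding to the edge $\Phi(j)$, $j=1,\dots,k$ (old labels are forgotten). Let $\Lambda:\{1,\dots,k\}\to\{1,\dots,k\}$, $\Lambda(j)=\ell(\Phi(j))$. A label $j$ is periodic if $\Lambda^p(j)=j$ for some $p\ge1$, and critical if $\#\Phi(j)\ge2$. $\mathcal R$ is non-degenerate if no periodic label is critical. The $n$-th iterate $\mathcal R^n$ is the recursion of a gluing data $(H_n,\Phi_n)$ with parameters $k,m^n$: $\mathcal R^n(G)$ is glued from $m^n$ copies of $G$ indexed by $V(H_n)=\{1,\dots,m\}^n$, and $\Phi_n(j)=\Phi(j)\times\Phi(\Lambda(j))\times\cdots\times\Phi(\Lambda^{n-1}(j))\subset V(H_n)$ is the set of copies containing the vertex labeled $j$ of $\mathcal R^n(G)$. $\mathcal R$ is expanding if for some $n\ge1$ the sets $\Phi_n(1),\dots,\Phi_n(k)$ are pairwise disjoint. A subset $I\subset V(G)$ agrees with $\mathbf x\in\{0,1\}^k$ if, for each $j$, the vertex labeled $j$ lies in $I$ iff $x_j=1$. A graph $G\in\mathcal G_k$, $k\ge2$, is maximally independent if (i) for each $\mathbf x\in\{0,1\}^k$ there exists a unique largest (maximum cardinality) independent subset $I_{\mathbf x}$ of $G$ that agrees with $\mathbf x$ on $P(G)$; and (ii) $\#I_{(1,\dots,1)}-\#I_{(0,\dots,0)}=k$. *)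

theory Defs
  imports
    Complex_Main
    "HOL-Library.Multiset"
    "HOL-Library.FuncSet"
    "HOL-Library.Disjoint_Sets"
    "HOL-Computational_Algebra.Polynomial"
begin

section \<open>Marked multigraphs\<close>

text \<open>An edge is the two-element set of its endpoints, so loops are excluded; parallel edges
  are repeated members of the multiset. Only the values of \<open>mark\<close> on \<open>{1..k}\<close> are meaningful.\<close>

record 'v marked_graph =
  verts :: "'v set"
  edges :: "'v set multiset"
  mark :: "nat \<Rightarrow> 'v"

definition marked_graphs :: "nat \<Rightarrow> 'v marked_graph set" where
  "marked_graphs k = {G. finite (verts G)
     \<and> (\<forall>e\<in>#edges G. e \<subseteq> verts G \<and> card e = 2)
     \<and> mark G ` {1..k} \<subseteq> verts G \<and> inj_on (mark G) {1..k}}"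

definition marked_graph_iso :: "nat \<Rightarrow> 'v marked_graph \<Rightarrow> 'w marked_graph \<Rightarrow> bool" where
  "marked_graph_iso k G G' \<longleftrightarrow> (\<exists>f. bij_betw f (verts G) (verts G')
     \<and> edges G' = image_mset (image f) (edges G)
     \<and> (\<forall>j\<in>{1..k}. mark G' j = f (mark G j)))"

definition indep_sets :: "'v marked_graph \<Rightarrow> 'v set set" where
  "indep_sets G = {I. I \<subseteq> verts G \<and> (\<forall>e\<in>#edges G. \<not> e \<subseteq> I)}"

definition indep_poly :: "'v marked_graph \<Rightarrow> complex poly" where
  "indep_poly G = (\<Sum>I\<in>indep_sets G. monom 1 (card I))"


section \<open>Maximally independent graphs\<close>

definition agrees :: "nat \<Rightarrow> 'v marked_graph \<Rightarrow> 'v set \<Rightarrow> (nat \<Rightarrow> nat) \<Rightarrow> bool" where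
  "agrees k G I x \<longleftrightarrow> (\<forall>j\<in>{1..k}. mark G j \<in> I \<longleftrightarrow> x j = 1)"

definition largest_indep :: "nat \<Rightarrow> 'v marked_graph \<Rightarrow> (nat \<Rightarrow> nat) \<Rightarrow> 'v set \<Rightarrow> bool" where
  "largest_indep k G x I \<longleftrightarrow> I \<in> indep_sets G \<and> agrees k G I x
     \<and> (\<forall>J\<in>indep_sets G. agrees k G J x \<longrightarrow> card J \<le> card I)"

definition maximally_independent :: "nat \<Rightarrow> 'v marked_graph \<Rightarrow> bool" where
  "maximally_independent k G \<longleftrightarrow> k \<ge> 2 \<and> G \<in> marked_graphs k
     \<and> (\<forall>x \<in> {1..k} \<rightarrow> {0, 1}. \<exists>!I. largest_indep k G x I)
     \<and> int (card (THE I. largest_indep k G (\<lambda>_. 1) I))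
         - int (card (THE I. largest_indep k G (\<lambda>_. 0) I)) = int k"


section \<open>Gluing data and graph recursion operators\<close>

text \<open>The multiset of hyperedges is a family indexed by the set \<open>hedges\<close> of edge names;
  \<open>members\<close> assigns to a name its set of vertices. \<open>Phi\<close> selects an edge name, so its
  injectivity distinguishes hyperedges with the same vertex set.\<close>

record 'e gluing =
  hedges :: "'e set"
  members :: "'e \<Rightarrow> nat set"
  lab :: "'e \<Rightarrow> nat"
  Phi :: "nat \<Rightarrow> 'e"

definition gluing_data :: "nat \<Rightarrow> nat \<Rightarrow> 'e gluing \<Rightarrow> bool" where
  "gluing_data k m D \<longleftrightarrow> k \<ge> 1 \<and> m \<ge> 2 \<and> finite (hedges D)
     \<and> (\<forall>e\<in>hedges D. members D e \<noteq> {} \<and> members D e \<subseteq> {1..m})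
     \<and> lab D ` hedges D \<subseteq> {1..k}
     \<and> (\<forall>j\<in>{1..k}. inj_on (members D) {e\<in>hedges D. lab D e = j}
                   \<and> partition_on {1..m} (members D ` {e\<in>hedges D. lab D e = j}))
     \<and> Phi D ` {1..k} \<subseteq> hedges D \<and> inj_on (Phi D) {1..k}"

text \<open>For gluing data this is already an equivalence relation: each copy \<open>i\<close> lies in exactly
  one hyperedge of each label.\<close>

definition glue_rel ::
  "nat \<Rightarrow> 'e gluing \<Rightarrow> 'v marked_graph \<Rightarrow> ((nat \<times> 'v) \<times> (nat \<times> 'v)) set" where
  "glue_rel m D G = Id_on ({1..m} \<times> verts G)
     \<union> {((i, mark G (lab D e)), (i', mark G (lab D e))) | e i i'.
          e \<in> hedges D \<and> i \<in> members D e \<and> i' \<in> members D e}"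

text \<open>The vertex \<open>v\<close> of the \<open>i\<close>-th copy of \<open>G\<close> becomes the class of \<open>(i, v)\<close>.\<close>

definition graph_recursion ::
  "nat \<Rightarrow> 'e gluing \<Rightarrow> 'v marked_graph \<Rightarrow> (nat \<times> 'v) set marked_graph" where
  "graph_recursion m D G =
    \<lparr> verts = ({1..m} \<times> verts G) // glue_rel m D G,
      edges = (\<Sum>i\<in>{1..m}. image_mset (image (\<lambda>v. glue_rel m D G `` {(i, v)})) (edges G)),
      mark = (\<lambda>j. members D (Phi D j) \<times> {mark G (lab D (Phi D j))}) \<rparr>"

definition Lam :: "'e gluing \<Rightarrow> nat \<Rightarrow> nat" where
  "Lam D j = lab D (Phi D j)"

definition periodic :: "'e gluing \<Rightarrow> nat \<Rightarrow> bool" where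
  "periodic D j \<longleftrightarrow> (\<exists>p\<ge>1. (Lam D ^^ p) j = j)"

definition critical :: "'e gluing \<Rightarrow> nat \<Rightarrow> bool" where
  "critical D j \<longleftrightarrow> card (members D (Phi D j)) \<ge> 2"

definition nondegenerate :: "nat \<Rightarrow> 'e gluing \<Rightarrow> bool" where
  "nondegenerate k D \<longleftrightarrow> (\<forall>j\<in>{1..k}. periodic D j \<longrightarrow> \<not> critical D j)"

text \<open>The copies of \<open>G\<close> in the \<open>n\<close>-th iterate are indexed by the lists of length \<open>n\<close> over
  \<open>{1..m}\<close>; \<open>listset\<close> is the Cartesian product of a list of sets.\<close>

definition Phi_iter :: "'e gluing \<Rightarrow> nat \<Rightarrow> nat \<Rightarrow> nat list set" where
  "Phi_iter D n j = listset (map (\<lambda>t. members D (Phi D ((Lam D ^^ t) j))) [0..<n])"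

definition expanding :: "nat \<Rightarrow> 'e gluing \<Rightarrow> bool" where
  "expanding k D \<longleftrightarrow> (\<exists>n\<ge>1. disjoint_family_on (Phi_iter D n) {1..k})"


section \<open>Well-definedness of the recursion\<close>

lemma gluing_edge_unique:
  assumes D: "gluing_data k m D" and G: "G \<in> marked_graphs k"
    and "e \<in> hedges D" "e' \<in> hedges D" "i \<in> members D e" "i \<in> members D e'"
    and "mark G (lab D e) = mark G (lab D e')"
  shows "e = e'"
proof -
  have l: "lab D e \<in> {1..k}" "lab D e' \<in> {1..k}"
    using D assms(3,4) unfolding gluing_data_def by auto
  have eq: "lab D e = lab D e'"
    using G l assms(7) unfolding marked_graphs_def inj_on_def by blast
  let ?E = "{f\<in>hedges D. lab D f = lab D e}"
  have inj: "inj_on (members D) ?E" and p: "partition_on {1..m} (members D ` ?E)"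
    using D l unfolding gluing_data_def by auto
  have "members D e = members D e'"
  proof (rule ccontr)
    assume "members D e \<noteq> members D e'"
    moreover have "members D e \<in> members D ` ?E" "members D e' \<in> members D ` ?E"
      using assms(3,4) eq by auto
    ultimately have "members D e \<inter> members D e' = {}"
      by (intro disjointD[OF partition_onD2[OF p]])
    then show False using assms(5,6) by blast
  qed
  then show "e = e'" by (rule inj_onD[OF inj]) (use assms(3,4) eq in simp_all)
qed

lemma equiv_glue_rel:
  assumes D: "gluing_data k m D" and G: "G \<in> marked_graphs k"
  shows "equiv ({1..m} \<times> verts G) (glue_rel m D G)"
proof -
  have sub: "glue_rel m D G \<subseteq> ({1..m} \<times> verts G) \<times> ({1..m} \<times> verts G)"
  proof -
    have "(i, mark G (lab D e)) \<in> {1..m} \<times> verts G"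
      if e: "e \<in> hedges D" and i: "i \<in> members D e" for e i
    proof -
      have "lab D e \<in> {1..k}" and "members D e \<subseteq> {1..m}"
        using D e unfolding gluing_data_def by auto
      moreover have "mark G ` {1..k} \<subseteq> verts G"
        using G unfolding marked_graphs_def by simp
      ultimately show ?thesis using i by blast
    qed
    then show ?thesis unfolding glue_rel_def by blast
  qed
  have "sym (glue_rel m D G)"
    unfolding glue_rel_def sym_def by blast
  moreover have "trans (glue_rel m D G)"
  proof (rule transI)
    fix a b c assume ab: "(a, b) \<in> glue_rel m D G" and bc: "(b, c) \<in> glue_rel m D G"
    have dest: "x = y \<or> (\<exists>e i i'. e \<in> hedges D \<and> i \<in> members D e \<and> i' \<in> members D e
        \<and> x = (i, mark G (lab D e)) \<and> y = (i', mark G (lab D e)))"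
      if "(x, y) \<in> glue_rel m D G" for x y
      using that unfolding glue_rel_def by blast
    show "(a, c) \<in> glue_rel m D G"
    proof (cases "a = b \<or> b = c")
      case True
      then show ?thesis using ab bc by auto
    next
      case False
      obtain e i i' where 1: "e \<in> hedges D" "i \<in> members D e" "i' \<in> members D e"
          "a = (i, mark G (lab D e))" "b = (i', mark G (lab D e))"
        using dest[OF ab] False by blast
      obtain e' j j' where 2: "e' \<in> hedges D" "j \<in> members D e'" "j' \<in> members D e'"
          "b = (j, mark G (lab D e'))" "c = (j', mark G (lab D e'))"
        using dest[OF bc] False by blast
      have b: "i' = j" "mark G (lab D e) = mark G (lab D e')"
        using 1(5) 2(4) by (metis prod.inject)+
      have "i' \<in> members D e'" using b(1) 2(2) by (rule ssubst)
      then have "e' = e" using gluing_edge_unique[OF D G 1(1) 2(1) 1(3)] b(2) by metis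
      then show ?thesis unfolding glue_rel_def using 1(1,2,4) 2(3,5) by blast
    qed
  qed
  moreover have "refl_on ({1..m} \<times> verts G) (glue_rel m D G)"
    unfolding refl_on_def glue_rel_def by blast
  ultimately show ?thesis using sub by (simp add: equiv_def)
qed

lemma graph_recursion_marked_graph:
  assumes D: "gluing_data k m D" and G: "G \<in> marked_graphs k"
  shows "graph_recursion m D G \<in> marked_graphs k"
proof -
  let ?r = "glue_rel m D G" and ?A = "{1..m} \<times> verts G"
  have eq: "equiv ?A ?r" by (rule equiv_glue_rel[OF D G])
  have fin: "finite (verts G)" using G unfolding marked_graphs_def by blast
  have r_iff: "((i, v), (j, w)) \<in> ?r \<longleftrightarrow> (i = j \<and> v = w \<and> i \<in> {1..m} \<and> v \<in> verts G) \<or>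
     (\<exists>e\<in>hedges D. i \<in> members D e \<and> j \<in> members D e \<and> v = mark G (lab D e) \<and> w = v)" for i j v w
    unfolding glue_rel_def by blast
  have inj: "inj_on (\<lambda>v. ?r `` {(i, v)}) (verts G)" if "i \<in> {1..m}" for i
  proof (rule inj_onI)
    fix v w assume "v \<in> verts G" "w \<in> verts G" "?r `` {(i, v)} = ?r `` {(i, w)}"
    then have "((i, v), (i, w)) \<in> ?r" using eq_equiv_class_iff[OF eq] that by auto
    then show "v = w" unfolding r_iff by blast
  qed
  have edges: "f \<subseteq> ?A // ?r \<and> card f = 2"
    if f: "f \<in># edges (graph_recursion m D G)" for f
  proof -
    have "f \<in> (\<Union>i\<in>{1..m}. set_mset
        (image_mset (image (\<lambda>v. ?r `` {(i, v)})) (edges G)))"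
      using f unfolding graph_recursion_def by (simp add: set_mset_sum)
    then obtain i e where i: "i \<in> {1..m}" and e: "e \<in># edges G"
      and fe: "f = (\<lambda>v. ?r `` {(i, v)}) ` e" by auto
    have e': "e \<subseteq> verts G" "card e = 2" using G e unfolding marked_graphs_def by blast+
    have "card f = 2" unfolding fe using card_image[OF inj_on_subset[OF inj[OF i] e'(1)]] e'(2)
      by simp
    moreover have "f \<subseteq> ?A // ?r" unfolding fe using i e'(1) by (auto intro!: quotientI)
    ultimately show ?thesis by blast
  qed
  have Phi: "Phi D j \<in> hedges D" "members D (Phi D j) \<noteq> {}" "members D (Phi D j) \<subseteq> {1..m}"
      "lab D (Phi D j) \<in> {1..k}" if "j \<in> {1..k}" for j
    using D that unfolding gluing_data_def by blast+
  have same: "e = e'" if "e \<in> hedges D" "e' \<in> hedges D" "i \<in> members D e" "i \<in> members D e'"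
    "mark G (lab D e) = mark G (lab D e')" for e e' i
    by (rule gluing_edge_unique[OF D G that])
  have mark_class: "mark (graph_recursion m D G) j = ?r `` {(i, mark G (lab D (Phi D j)))}"
    if j: "j \<in> {1..k}" and i: "i \<in> members D (Phi D j)" for i j
  proof -
    have "?r `` {(i, mark G (lab D (Phi D j)))}
        = members D (Phi D j) \<times> {mark G (lab D (Phi D j))}" (is "?L = ?R")
    proof (intro equalityI subsetI)
      fix y assume y: "y \<in> ?L"
      obtain i' v where [simp]: "y = (i', v)" by (cases y)
      from y consider "i' = i" "v = mark G (lab D (Phi D j))"
        | e where "e \<in> hedges D" "i \<in> members D e" "i' \<in> members D e"
          "mark G (lab D (Phi D j)) = mark G (lab D e)" "v = mark G (lab D (Phi D j))"
        using r_iff by auto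
      then show "y \<in> ?R"
      proof cases
        case 1 then show ?thesis using i by simp
      next
        case 2
        then have "Phi D j = e" using same[of "Phi D j" e i] Phi(1)[OF j] i by simp
        then show ?thesis using 2 by simp
      qed
    next
      fix y assume "y \<in> ?R"
      then show "y \<in> ?L" using r_iff Phi(1)[OF j] i by auto
    qed
    then show ?thesis unfolding graph_recursion_def by simp
  qed
  have "mark (graph_recursion m D G) j \<in> ?A // ?r" if j: "j \<in> {1..k}" for j
  proof -
    obtain i where i: "i \<in> members D (Phi D j)" using Phi(2)[OF j] by blast
    moreover have "mark G (lab D (Phi D j)) \<in> verts G"
      using G Phi(4)[OF j] unfolding marked_graphs_def by blast
    ultimately show ?thesis unfolding mark_class[OF j i] using Phi(3)[OF j]
      by (auto intro!: quotientI)
  qed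
  moreover have "inj_on (mark (graph_recursion m D G)) {1..k}"
  proof (rule inj_onI)
    fix j j' assume j: "j \<in> {1..k}" "j' \<in> {1..k}"
      and "mark (graph_recursion m D G) j = mark (graph_recursion m D G) j'"
    then have *: "members D (Phi D j) \<times> {mark G (lab D (Phi D j))}
        = members D (Phi D j') \<times> {mark G (lab D (Phi D j'))}"
      unfolding graph_recursion_def by simp
    obtain i where i: "i \<in> members D (Phi D j)" using Phi(2)[OF j(1)] by blast
    have "(i, mark G (lab D (Phi D j))) \<in> members D (Phi D j') \<times> {mark G (lab D (Phi D j'))}"
      using i unfolding *[symmetric] by simp
    then have "Phi D j = Phi D j'"
      using same[of "Phi D j" "Phi D j'" i] Phi(1) j i by simp
    then show "j = j'" using D j unfolding gluing_data_def inj_on_def by blast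
  qed
  moreover have "finite (?A // ?r)"
    using fin unfolding quotient_def by (intro finite_UN_I finite_cartesian_product) simp_all
  ultimately have "finite (?A // ?r)
     \<and> (\<forall>f\<in>#edges (graph_recursion m D G). f \<subseteq> ?A // ?r \<and> card f = 2)
     \<and> mark (graph_recursion m D G) ` {1..k} \<subseteq> ?A // ?r
     \<and> inj_on (mark (graph_recursion m D G)) {1..k}"
    using edges by blast
  moreover have V: "verts (graph_recursion m D G) = ?A // ?r"
    unfolding graph_recursion_def by simp
  ultimately show ?thesis unfolding marked_graphs_def mem_Collect_eq V by blast
qed

text \<open>Graphs are considered up to isomorphism; every graph in \<open>marked_graphs k\<close> has a copy
  on any infinite type.\<close>

lemma marked_graph_copy:
  assumes "G \<in> marked_graphs k" and "infinite (UNIV :: 'w set)"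
  shows "\<exists>G' :: 'w marked_graph. marked_graph_iso k G G' \<and> G' \<in> marked_graphs k"
proof -
  have fin: "finite (verts G)" using assms unfolding marked_graphs_def by blast
  obtain W :: "'w set" where W: "finite W" "card W = card (verts G)"
    using infinite_arbitrarily_large[OF assms(2)] by blast
  then obtain f where f: "bij_betw f (verts G) W"
    using finite_same_card_bij[OF fin W(1)] by auto
  define G' where "G' = \<lparr>verts = W, edges = image_mset (image f) (edges G), mark = f \<circ> mark G\<rparr>"
  have inj: "inj_on f (verts G)" and im: "f ` verts G = W"
    using f unfolding bij_betw_def by auto
  have "marked_graph_iso k G G'"
    unfolding marked_graph_iso_def G'_def using f by auto
  moreover have "G' \<in> marked_graphs k"
  proof -
    have "f ` e \<subseteq> W \<and> card (f ` e) = 2" if "e \<in># edges G" for e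
    proof -
      have "e \<subseteq> verts G" "card e = 2" using assms(1) that unfolding marked_graphs_def by blast+
      then show ?thesis using card_image[OF inj_on_subset[OF inj]] im by auto
    qed
    moreover have "mark G ` {1..k} \<subseteq> verts G" "inj_on (mark G) {1..k}"
      using assms(1) unfolding marked_graphs_def by blast+
    then have "inj_on (f \<circ> mark G) {1..k}" "(f \<circ> mark G) ` {1..k} \<subseteq> W"
      using inj im by (auto intro!: comp_inj_on intro: inj_on_subset)
    ultimately show ?thesis unfolding marked_graphs_def G'_def using W by auto
  qed
  ultimately show ?thesis by blast
qed

end

theory Submission
  imports Defs "HOL-Analysis.Analysis"
begin

text \<open>For a set \<open>X\<close> of labels let \<open>W X\<close> be the sum of \<open>\<lambda>^card I\<close> over the independent sets
  whose marked vertices are those with label in \<open>X\<close>, where marked vertices are not counted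
  in the exponent. Gluing turns into an explicit operator on these vectors (\<open>transfer\<close>,
  \<open>marked_weight_recursion\<close>): the new weight of \<open>Y\<close> is a sum, over the possible states of the
  hyperedges that receive no new label, of products of old weights over the \<open>m\<close> copies.

  If the old weights had product form \<open>W X = c * \<Prod>j\<in>X. t j\<close>, the sum would factorise and
  the new weights would have product form too, with \<open>t' j = t (\<Lambda> j) ^ #\<Phi>(j)\<close>. The proof
  measures the deviation from product form by the dependence of the ratio
  \<open>W (X \<union> {j}) / W X\<close> on \<open>X\<close>. The new ratio at \<open>j\<close> is an average of products of old
  ratios at \<open>\<Lambda> j\<close> over the copies containing the new marked vertex \<open>j\<close>
  (\<open>transfer_average\<close>). It depends on another label \<open>j'\<close> in two ways: directly, through copies
  that contain both marked vertices, and through the averaging measure. Expansion says that the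
  direct dependence disappears after finitely many steps; the induced dependence is of second
  order in the deviation. Non-degeneracy bounds the exponents \<open>#\<Phi>(j) * #\<Phi>(\<Lambda> j) * ...\<close>
  accumulated along the way (\<open>total_share_Lam\<close>), hence the \<open>t j\<close> cannot drift away.

  This yields two facts. At a positive activity all averages are over positive measures, and the
  deviation tends to zero from any start (\<open>real_interaction_vanishes\<close>). At a complex activity the
  averages are over complex measures, but as long as no factor \<open>1 + \<lambda> t^c\<close> is small compared
  with \<open>1 + \<bar>\<lambda> t^c\<bar>\<close> their total variation is bounded, and a sufficiently small deviation
  decays geometrically and forbids zeros from then on (\<open>complex_stability\<close>).

  It remains to start the second mechanism near every point of \<open>[0, \<infinity>]\<close>. Near a positive
  activity the first fact brings the deviation below the threshold after finitely many steps, and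
  continuity preserves this in a neighbourhood. Near \<open>0\<close> and near \<open>\<infinity>\<close> maximal independence does
  it at time zero: all \<open>W X\<close> have constant term \<open>1\<close>, and they are monic of the same degree
  (\<open>maximally_independent_structure\<close>), so that all ratios tend to \<open>1\<close>. Zeros are therefore absent near
  infinity and, by compactness, in a neighbourhood of \<open>[0, R]\<close> of fixed width.\<close>

section \<open>Closeness on a multiplicative scale\<close>

text \<open>Distance on a multiplicative scale. An exponential witness in place of a logarithm makes
  the bounds additive under products without any choice of branch, and serves real and complex
  scalars alike.\<close>

definition near :: "'a::{real_normed_field,banach} \<Rightarrow> 'a \<Rightarrow> real \<Rightarrow> bool" where
  "near a b r \<longleftrightarrow> (\<exists>u. norm u \<le> r \<and> b = a * exp u)"

lemma near_refl: "r \<ge> 0 \<Longrightarrow> near a a r"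
  unfolding near_def by (rule exI[of _ 0]) simp

lemma near_mono: "near a b r \<Longrightarrow> r \<le> s \<Longrightarrow> near a b s"
  unfolding near_def by (auto intro: order_trans)

lemma near_sym: "near a b r \<Longrightarrow> near b a r"
  unfolding near_def
proof (elim exE conjE)
  fix u assume "norm u \<le> r" "b = a * exp u"
  then show "\<exists>u. norm u \<le> r \<and> a = b * exp u"
    by (intro exI[of _ "-u"]) (simp add: exp_minus)
qed

lemma near_trans: "near a b r \<Longrightarrow> near b c s \<Longrightarrow> near a c (r + s)"
  unfolding near_def
proof (elim exE conjE)
  fix u v assume "norm u \<le> r" "b = a * exp u" "norm v \<le> s" "c = b * exp v"
  then show "\<exists>u. norm u \<le> r + s \<and> c = a * exp u"
    by (intro exI[of _ "u + v"]) (auto simp: exp_add mult.assoc intro: norm_triangle_mono)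
qed

lemma near_mult: "near a b r \<Longrightarrow> near c d s \<Longrightarrow> near (a * c) (b * d) (r + s)"
  unfolding near_def
proof (elim exE conjE)
  fix u v assume "norm u \<le> r" "b = a * exp u" "norm v \<le> s" "d = c * exp v"
  then show "\<exists>u. norm u \<le> r + s \<and> b * d = a * c * exp u"
    by (intro exI[of _ "u + v"]) (auto simp: exp_add intro: norm_triangle_mono)
qed

lemma near_prod:
  assumes "\<And>i. i \<in> I \<Longrightarrow> near (f i) (g i) (r i)"
  shows "near (prod f I) (prod g I) (sum r I)"
  using assms by (induction I rule: infinite_finite_induct) (auto intro!: near_mult near_refl)

lemma near_power: "near a b r \<Longrightarrow> near (a ^ n) (b ^ n) (real n * r)"
  using near_prod[of "{..<n}" "\<lambda>_. a" "\<lambda>_. b" "\<lambda>_. r"] by simp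

lemma near_nonneg: "near a b r \<Longrightarrow> r \<ge> 0"
  unfolding near_def using norm_ge_zero order_trans by blast

lemma near_nonzero: "near a b r \<Longrightarrow> a \<noteq> 0 \<longleftrightarrow> b \<noteq> 0"
  unfolding near_def by auto

lemma near_real_le: "near (a::real) b r \<Longrightarrow> a > 0 \<Longrightarrow> b \<le> exp r * a"
  unfolding near_def by (auto simp: mult.commute)

lemma near_realI:
  assumes "0 < a" "0 < (b::real)" "b \<le> exp r * a" "a \<le> exp r * b"
  shows "near a b r"
  unfolding near_def
proof (intro exI conjI)
  have "ln b \<le> r + ln a" "ln a \<le> r + ln b"
    using assms by (smt (verit) ln_mult_pos exp_gt_zero ln_exp ln_le_cancel_iff mult_pos_pos)+
  then show "norm (ln b - ln a) \<le> r" by auto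
  show "b = a * exp (ln b - ln a)" using assms by (simp add: exp_diff)
qed

lemma near_of_real:
  assumes "near (a::real) b r" shows "near (complex_of_real a) (complex_of_real b) r"
proof -
  obtain u where "norm u \<le> r" "b = a * exp u" using assms unfolding near_def by blast
  then show ?thesis unfolding near_def
    by (intro exI[of _ "complex_of_real u"]) (simp add: exp_of_real)
qed

text \<open>A small relative error is a small multiplicative error, by \<open>\<bar>Ln (1 + z)\<bar> \<le> 2 \<bar>z\<bar>\<close>.\<close>

lemma near_complexI:
  assumes "a \<noteq> 0" "cmod (b - a) \<le> q * cmod a" "q \<le> 1 / 3"
  shows "near a b (2 * q)"
proof -
  define z where "z = (b - a) / a"
  have "cmod z \<le> q" using assms unfolding z_def by (simp add: norm_divide divide_le_eq)
  moreover have "b = a * (1 + z)" using assms unfolding z_def by (simp add: field_simps)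
  moreover have "1 + z \<noteq> 0"
    using norm_diff_ineq[of 1 z] \<open>cmod z \<le> q\<close> assms(3) by auto
  moreover have "cmod (Ln (1 + z)) \<le> 2 * cmod z"
    using \<open>cmod z \<le> q\<close> assms(3) by (intro norm_Ln_le) auto
  ultimately show ?thesis unfolding near_def by (intro exI[of _ "Ln (1 + z)"]) auto
qed

lemma exp_minus_one_bound:
  assumes "cmod u \<le> r" "r \<le> 1 / 2"
  shows "cmod (exp u - 1) \<le> 2 * r" "cmod (exp u) \<le> 2"
proof -
  have u: "cmod u \<le> 1 / 2" using assms by simp
  show "cmod (exp u) \<le> 2" using u by (rule exp_bound_half)
  have "cmod (exp u - 1) \<le> exp (cmod u) * cmod u"
    using Taylor_exp_field[of u 0] by simp
  also have "\<dots> \<le> 2 * r"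
    using assms exp_bound_half[of "cmod u"] u by (intro mult_mono) auto
  finally show "cmod (exp u - 1) \<le> 2 * r" .
qed

lemma near_one_norm:
  assumes "near 1 z (1 / 2)" shows "cmod z \<le> 2" "1 / 2 \<le> cmod z"
proof -
  obtain u where u: "cmod u \<le> 1 / 2" "z = exp u" using assms unfolding near_def by auto
  show "cmod z \<le> 2" unfolding u using u(1) by (rule exp_bound_half)
  have "cmod (exp (- u)) \<le> 2" using u(1) by (intro exp_bound_half) simp
  then have "inverse (cmod z) \<le> 2" unfolding u exp_minus norm_inverse .
  moreover have "cmod z > 0" unfolding u by simp
  ultimately show "1 / 2 \<le> cmod z" by (simp add: field_simps)
qed

lemma tendsto_imp_eventually_near:
  assumes "(f \<longlongrightarrow> L) F" "L \<noteq> (0::complex)" "r > 0"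
  shows "\<forall>\<^sub>F x in F. near L (f x) r"
proof -
  define q where "q = min (r / 2) (1 / 3)"
  have "q * cmod L > 0" using assms unfolding q_def by auto
  then have "\<forall>\<^sub>F x in F. dist (f x) L < q * cmod L" using assms(1) unfolding tendsto_iff by blast
  then show ?thesis
  proof eventually_elim
    case (elim x)
    have "near L (f x) (2 * q)"
      using elim assms(2) by (intro near_complexI) (auto simp: dist_norm q_def)
    then show ?case by (rule near_mono) (auto simp: q_def)
  qed
qed

section \<open>Ratios of averages\<close>

text \<open>Two averages with respect to the complex measures \<open>g exp e1\<close> and \<open>g exp e2\<close>, whose total
  variation is at most \<open>M\<close> times their mass up to a constant. The values averaged are within
  \<open>r\<close> of \<open>F\<close> and the measures within \<open>r\<close> of \<open>g\<close>, so that exchanging one measure for the other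
  costs only \<open>r\<^sup>2\<close>: the constant \<open>F\<close> averages to itself. A first-order term arises only from
  the difference \<open>q\<close> of the two integrands.\<close>

lemma complex_average_ratio:
  fixes g :: "'i \<Rightarrow> complex"
  assumes I: "finite I" and P: "sum g I \<noteq> 0" and M: "(\<Sum>T\<in>I. cmod (g T)) \<le> M * cmod (sum g I)"
    and M1: "M \<ge> 1"
    and e1: "\<And>T. T \<in> I \<Longrightarrow> cmod (e1 T) \<le> r" and e2: "\<And>T. T \<in> I \<Longrightarrow> cmod (e2 T) \<le> r"
    and F: "F \<noteq> 0"
    and f1: "\<And>T. T \<in> I \<Longrightarrow> near F (f1 T) r" and f2: "\<And>T. T \<in> I \<Longrightarrow> near F (f2 T) r"
    and f12: "\<And>T. T \<in> I \<Longrightarrow> near (f1 T) (f2 T) q"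
    and q: "0 \<le> q" "q \<le> r" and r0: "1000 * M\<^sup>2 * r \<le> 1"
  defines "a1 \<equiv> \<Sum>T\<in>I. g T * exp (e1 T)" and "a2 \<equiv> \<Sum>T\<in>I. g T * exp (e2 T)"
  defines "d1 \<equiv> (\<Sum>T\<in>I. g T * exp (e1 T) * f1 T) / a1" and "d2 \<equiv> (\<Sum>T\<in>I. g T * exp (e2 T) * f2 T) / a2"
  shows "a1 \<noteq> 0" "near F d1 (16 * M * r)" "near d1 d2 (320 * M\<^sup>2 * (q + r\<^sup>2))"
proof -
  define p where "p = cmod (sum g I)"
  have p: "p > 0" using P unfolding p_def by simp
  have MM: "M \<le> M\<^sup>2" using M1 by (simp add: power2_eq_square)
  have "r \<ge> 0" using q by simp
  then have r: "128 * M * r \<le> 1"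
    using r0 mult_right_mono[OF MM, of r] M1 by (simp add: algebra_simps)
  have r12: "r \<le> 1/128" "0 \<le> r" using r M1 q mult_right_mono[of 1 M r] by auto
  define phi where "phi = (\<lambda>f (T::'i). f T / F - 1)"
  have key: "cmod (\<Sum>T\<in>I. g T * c T) \<le> M * p * B" if "\<And>T. T \<in> I \<Longrightarrow> cmod (c T) \<le> B" "B \<ge> 0" for c B
  proof -
    have "cmod (\<Sum>T\<in>I. g T * c T) \<le> (\<Sum>T\<in>I. cmod (g T) * B)"
      by (rule sum_norm_le) (auto simp: norm_mult intro!: mult_left_mono that)
    also have "\<dots> = (\<Sum>T\<in>I. cmod (g T)) * B" by (simp add: sum_distrib_right)
    also have "\<dots> \<le> M * p * B" using M that(2) unfolding p_def by (intro mult_right_mono) auto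
    finally show ?thesis .
  qed
  have small: "cmod (exp (x T) - 1) \<le> 2 * r" "cmod (exp (x T)) \<le> 2"
    if "\<And>T. T \<in> I \<Longrightarrow> cmod (x T) \<le> r" "T \<in> I" for x :: "'i \<Rightarrow> complex" and T
    using exp_minus_one_bound[OF that(1)[OF that(2)]] r12 by auto
  have a_bd: "cmod ((\<Sum>T\<in>I. g T * exp (x T)) - sum g I) \<le> 2 * M * r * p"
    "cmod (\<Sum>T\<in>I. g T * exp (x T)) \<ge> p / 2"
    if "\<And>T. T \<in> I \<Longrightarrow> cmod (x T) \<le> r" for x
  proof -
    have "(\<Sum>T\<in>I. g T * exp (x T)) - sum g I = (\<Sum>T\<in>I. g T * (exp (x T) - 1))"
      by (simp add: sum_subtractf[symmetric] algebra_simps)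
    also have "cmod \<dots> \<le> M * p * (2 * r)" using small(1)[OF that] r12 by (intro key) auto
    finally show 1: "cmod ((\<Sum>T\<in>I. g T * exp (x T)) - sum g I) \<le> 2 * M * r * p" by (simp add: algebra_simps)
    have "2 * M * r * p \<le> p / 2" using p r mult_right_mono[of "2 * M * r" "1/2" p] by simp
    then show "cmod (\<Sum>T\<in>I. g T * exp (x T)) \<ge> p / 2"
      using 1 norm_triangle_ineq3[of "\<Sum>T\<in>I. g T * exp (x T)" "sum g I"] unfolding p_def by linarith
  qed
  have a1: "cmod a1 \<ge> p / 2" "cmod (a1 - sum g I) \<le> 2 * M * r * p"
    and a2: "cmod a2 \<ge> p / 2" "cmod (a2 - sum g I) \<le> 2 * M * r * p"
    using a_bd e1 e2 unfolding a1_def a2_def by blast+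
  show a10: "a1 \<noteq> 0" using a1(1) p by auto
  have a20: "a2 \<noteq> 0" using a2(1) p by auto
  have a12: "cmod (a1 - a2) \<le> 4 * M * r * p"
    using norm_triangle_ineq4[of "a1 - sum g I" "a2 - sum g I"] a1(2) a2(2) by (simp add: algebra_simps)
  have phi: "cmod (phi f T) \<le> 2 * r" if "near F (f T) r" for f T
  proof -
    obtain u where u: "cmod u \<le> r" "f T = F * exp u" using \<open>near F (f T) r\<close> unfolding near_def by blast
    then show ?thesis unfolding phi_def using exp_minus_one_bound(1)[OF u(1)] r12 F by simp
  qed
  have phi12: "cmod (phi f2 T - phi f1 T) \<le> 4 * q" if T: "T \<in> I" for T
  proof -
    obtain u where u: "cmod u \<le> r" "f1 T = F * exp u" using f1[OF T] unfolding near_def by blast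
    obtain v where v: "cmod v \<le> q" "f2 T = f1 T * exp v" using f12[OF T] unfolding near_def by blast
    have "phi f2 T - phi f1 T = exp u * (exp v - 1)" unfolding phi_def v(2) u(2) using F by (simp add: algebra_simps)
    then have "cmod (phi f2 T - phi f1 T) \<le> 2 * (2 * q)"
      using exp_minus_one_bound(2)[OF u(1)] exp_minus_one_bound(1)[OF v(1)] r12 q
      by (simp only: norm_mult) (intro mult_mono, auto)
    then show ?thesis by simp
  qed
  \<comment> \<open>With integrands normalised as F (1 + phi), the averages are F (1 + N / a).\<close>
  define N1 N2 where "N1 = (\<Sum>T\<in>I. g T * (exp (e1 T) * phi f1 T))"
    and "N2 = (\<Sum>T\<in>I. g T * (exp (e2 T) * phi f2 T))"
  have d: "d1 = F * (1 + N1 / a1)" "d2 = F * (1 + N2 / a2)"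
  proof -
    have *: "(\<Sum>T\<in>I. g T * exp (x T) * f T) = F * ((\<Sum>T\<in>I. g T * exp (x T)) + (\<Sum>T\<in>I. g T * (exp (x T) * phi f T)))" for x f
      unfolding phi_def using F by (simp add: sum.distrib[symmetric] sum_distrib_left algebra_simps)
    show "d1 = F * (1 + N1 / a1)" unfolding d1_def * using a10 unfolding a1_def N1_def by (simp add: field_simps)
    show "d2 = F * (1 + N2 / a2)" unfolding d2_def * using a20 unfolding a2_def N2_def by (simp add: field_simps)
  qed
  have N1: "cmod N1 \<le> M * p * (2 * (2 * r))"
    unfolding N1_def
  proof (rule key)
    fix T assume T: "T \<in> I"
    show "cmod (exp (e1 T) * phi f1 T) \<le> 2 * (2 * r)"
      unfolding norm_mult using small(2)[of e1 T, OF e1 T] phi[of f1 T, OF f1[OF T]] by (intro mult_mono) auto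
  qed (use r12 in auto)
  have N1a: "cmod (N1 / a1) \<le> 8 * M * r"
  proof -
    have "cmod (N1 / a1) = cmod N1 / cmod a1" by (simp add: norm_divide)
    also have "\<dots> \<le> (M * p * (2 * (2 * r))) / (p / 2)" using N1 a1(1) p M1 r12 by (intro frac_le) auto
    finally show ?thesis using p by simp
  qed
  have "cmod (d1 - F) = cmod (N1 / a1) * cmod F" unfolding d by (simp add: algebra_simps norm_mult flip: norm_mult)
  then have "cmod (d1 - F) \<le> 8 * M * r * cmod F" using N1a by (simp add: mult_right_mono)
  then have "near F d1 (2 * (8 * M * r))" using F r by (intro near_complexI) auto
  then show "near F d1 (16 * M * r)" by (simp add: mult.assoc)
  have N12: "cmod (N2 - N1) \<le> M * p * (8 * q + 8 * r\<^sup>2)"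
  proof -
    have "N2 - N1 = (\<Sum>T\<in>I. g T * (exp (e2 T) * (phi f2 T - phi f1 T) + phi f1 T * (exp (e2 T) - exp (e1 T))))"
      unfolding N1_def N2_def by (simp add: sum_subtractf[symmetric] algebra_simps)
    also have "cmod \<dots> \<le> M * p * (8 * q + 8 * r\<^sup>2)"
    proof (rule key)
      fix T assume T: "T \<in> I"
      have "cmod (exp (e2 T) - exp (e1 T)) \<le> 4 * r"
        using small(1)[of e1 T, OF e1 T] small(1)[of e2 T, OF e2 T]
          norm_triangle_ineq4[of "exp (e2 T) - 1" "exp (e1 T) - 1"] by simp
      then have "cmod (phi f1 T * (exp (e2 T) - exp (e1 T))) \<le> 2 * r * (4 * r)"
        unfolding norm_mult using phi[of f1 T, OF f1[OF T]] r12 by (intro mult_mono) auto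
      moreover have "cmod (exp (e2 T) * (phi f2 T - phi f1 T)) \<le> 2 * (4 * q)"
        unfolding norm_mult using small(2)[of e2 T, OF e2 T] phi12[OF T] by (intro mult_mono) auto
      ultimately show "cmod (exp (e2 T) * (phi f2 T - phi f1 T) + phi f1 T * (exp (e2 T) - exp (e1 T))) \<le> 8 * q + 8 * r\<^sup>2"
        by (intro norm_triangle_le) (simp add: power2_eq_square)
    qed (use q in auto)
    finally show ?thesis .
  qed
  have dd: "cmod (N2 / a2 - N1 / a1) \<le> 80 * M\<^sup>2 * (q + r\<^sup>2)"
  proof -
    \<comment> \<open>Change of numerator and change of normalisation are estimated separately; N1 is of order r.\<close>
    have "N2 / a2 - N1 / a1 = (N2 - N1) / a2 + (N1 / a1) * ((a1 - a2) / a2)"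
      using a10 a20 by (simp add: field_simps)
    also have "cmod \<dots> \<le> cmod (N2 - N1) / cmod a2 + cmod (N1 / a1) * (cmod (a1 - a2) / cmod a2)"
      by (metis norm_triangle_ineq norm_mult norm_divide)
    also have "\<dots> \<le> (M * p * (8 * q + 8 * r\<^sup>2)) / (p / 2) + (8 * M * r) * ((4 * M * r * p) / (p / 2))"
      using N12 a2(1) N1a a12 p M1 r12 q by (intro add_mono mult_mono frac_le) auto
    also have "\<dots> = 16 * M * q + 16 * M * r\<^sup>2 + 64 * M\<^sup>2 * r\<^sup>2" using p by (simp add: field_simps power2_eq_square)
    also have "\<dots> \<le> 80 * M\<^sup>2 * (q + r\<^sup>2)"
    proof -
      have "M * q \<le> M\<^sup>2 * q" "M * r\<^sup>2 \<le> M\<^sup>2 * r\<^sup>2" "0 \<le> M\<^sup>2 * q" using q MM by (auto intro: mult_right_mono)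
      then show ?thesis by (simp add: algebra_simps)
    qed
    finally show ?thesis .
  qed
  have half: "cmod d1 \<ge> cmod F / 2"
  proof -
    have "cmod (1 + N1 / a1) \<ge> 1 / 2" using N1a r norm_diff_ineq[of 1 "N1 / a1"] by auto
    then show ?thesis unfolding d norm_mult using mult_left_mono[of "1/2" _ "cmod F"] by auto
  qed
  have d10: "d1 \<noteq> 0" using half F by auto
  have b1: "cmod (d2 - d1) \<le> 2 * cmod (N2 / a2 - N1 / a1) * cmod d1"
  proof -
    have "d2 - d1 = F * (N2 / a2 - N1 / a1)" unfolding d by (simp add: algebra_simps)
    then have "cmod (d2 - d1) = cmod F * cmod (N2 / a2 - N1 / a1)" by (simp add: norm_mult)
    also have "\<dots> \<le> (2 * cmod d1) * cmod (N2 / a2 - N1 / a1)" using half by (intro mult_right_mono) auto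
    finally show ?thesis by (simp add: algebra_simps)
  qed
  have third: "2 * cmod (N2 / a2 - N1 / a1) \<le> 1 / 3"
  proof -
    have "r\<^sup>2 \<le> r" using r12 by (simp add: power2_eq_square mult_left_le)
    then have "M\<^sup>2 * (q + r\<^sup>2) \<le> M\<^sup>2 * (2 * r)" using q by (intro mult_left_mono) auto
    then show ?thesis using dd r0 by (simp add: algebra_simps)
  qed
  have "near d1 d2 (2 * (2 * cmod (N2 / a2 - N1 / a1)))" by (rule near_complexI[OF d10 b1 third])
  then show "near d1 d2 (320 * M\<^sup>2 * (q + r\<^sup>2))" by (rule near_mono) (use dd in auto)
qed

text \<open>For positive measures the normalised second measure dominates \<open>exp (- 4 r)\<close> times the first:
  weights and total masses each differ by a factor at most \<open>exp (2 r)\<close>. On the common part the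
  integrands are compared pointwise, with the good constant \<open>y\<close>; only on the remainder is the
  crude bound \<open>x\<close> on the total variation of the integrands used.\<close>

lemma real_average_ratio:
  fixes g :: "'i \<Rightarrow> real"
  assumes I: "finite I" "I \<noteq> {}" and g: "\<And>T. T \<in> I \<Longrightarrow> g T > 0"
    and e1: "\<And>T. T \<in> I \<Longrightarrow> \<bar>e1 T\<bar> \<le> r" and e2: "\<And>T. T \<in> I \<Longrightarrow> \<bar>e2 T\<bar> \<le> r"
    and f1: "\<And>T. T \<in> I \<Longrightarrow> f1 T > 0" and f2: "\<And>T. T \<in> I \<Longrightarrow> f2 T > 0"
    and x: "\<And>T T'. T \<in> I \<Longrightarrow> T' \<in> I \<Longrightarrow> f2 T' \<le> exp x * f1 T"
    and y: "\<And>T. T \<in> I \<Longrightarrow> f2 T \<le> exp y * f1 T"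
  defines "a1 \<equiv> \<Sum>T\<in>I. g T * exp (e1 T)" and "a2 \<equiv> \<Sum>T\<in>I. g T * exp (e2 T)"
  defines "d1 \<equiv> (\<Sum>T\<in>I. g T * exp (e1 T) * f1 T) / a1" and "d2 \<equiv> (\<Sum>T\<in>I. g T * exp (e2 T) * f2 T) / a2"
  shows "d1 > 0" "d2 \<le> ((1 - exp (- 4 * r)) * exp x + exp (- 4 * r) * exp y) * d1"
proof -
  define eta where "eta = exp (- 4 * r)"
  define mu1 mu2 where "mu1 T = g T * exp (e1 T) / a1" and "mu2 T = g T * exp (e2 T) / a2" for T
  have a: "a1 > 0" "a2 > 0" unfolding a1_def a2_def using I g by (auto intro!: sum_pos)
  have mu: "mu1 T > 0" "mu2 T > 0" if "T \<in> I" for T using that g a unfolding mu1_def mu2_def by auto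
  have mu_sum: "sum mu1 I = 1" "sum mu2 I = 1"
    unfolding mu1_def mu2_def using a
    by (simp_all add: sum_divide_distrib[symmetric] a1_def a2_def)
  have d: "d1 = (\<Sum>T\<in>I. mu1 T * f1 T)" "d2 = (\<Sum>T\<in>I. mu2 T * f2 T)"
    unfolding d1_def d2_def mu1_def mu2_def by (simp_all add: sum_divide_distrib)
  show d1: "d1 > 0" unfolding d using I mu f1 by (auto intro!: sum_pos)
  have e12: "exp (e2 T) \<le> exp (2 * r) * exp (e1 T)" "exp (e1 T) \<le> exp (2 * r) * exp (e2 T)" if "T \<in> I" for T
    using e1[OF that] e2[OF that] by (auto simp: exp_add[symmetric])
  have "a2 \<le> exp (2 * r) * a1"
    unfolding a1_def a2_def sum_distrib_left using e12 g
    by (intro sum_mono) (auto simp: mult.left_commute[of "exp _"] intro!: mult_left_mono less_imp_le)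
  have mu12: "eta * mu1 T \<le> mu2 T" if T: "T \<in> I" for T
  proof -
    have "eta * mu1 T = g T * (exp (- 2 * r) * exp (e1 T)) / (exp (2 * r) * a1)"
      unfolding mu1_def eta_def using a by (simp add: field_simps exp_add[symmetric])
    also have "\<dots> \<le> g T * exp (e2 T) / a2"
    proof (intro frac_le mult_left_mono)
      show "exp (- 2 * r) * exp (e1 T) \<le> exp (e2 T)"
        using e1[OF T] e2[OF T] by (simp add: exp_add[symmetric])
    qed (use g[OF T] a \<open>a2 \<le> exp (2 * r) * a1\<close> in auto)
    finally show ?thesis unfolding mu2_def .
  qed
  have up: "f2 T' \<le> exp x * d1" if T': "T' \<in> I" for T'
  proof -
    have "f2 T' = (\<Sum>T\<in>I. mu1 T * f2 T')" using mu_sum by (simp add: sum_distrib_right[symmetric])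
    also have "\<dots> \<le> (\<Sum>T\<in>I. mu1 T * (exp x * f1 T))"
      using x[OF _ T'] mu by (intro sum_mono mult_left_mono) (auto intro: less_imp_le)
    also have "\<dots> = exp x * d1" unfolding d by (simp add: sum_distrib_left mult.left_commute)
    finally show ?thesis .
  qed
  have "d2 = (\<Sum>T\<in>I. (mu2 T - eta * mu1 T) * f2 T) + (\<Sum>T\<in>I. eta * mu1 T * f2 T)"
    unfolding d by (simp add: sum.distrib[symmetric] algebra_simps)
  also have "\<dots> \<le> (\<Sum>T\<in>I. (mu2 T - eta * mu1 T) * (exp x * d1)) + (\<Sum>T\<in>I. eta * mu1 T * (exp y * f1 T))"
    using up mu12 y mu by (intro add_mono sum_mono mult_left_mono) (auto simp: eta_def intro: less_imp_le)
  also have "(\<Sum>T\<in>I. (mu2 T - eta * mu1 T) * (exp x * d1)) = (1 - eta) * (exp x * d1)"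
    unfolding sum_distrib_right[symmetric] sum_subtractf sum_distrib_left[symmetric] mu_sum by simp
  also have "(\<Sum>T\<in>I. eta * mu1 T * (exp y * f1 T)) = eta * exp y * d1"
    unfolding d by (simp add: sum_distrib_left algebra_simps)
  finally show "d2 \<le> ((1 - exp (- 4 * r)) * exp x + exp (- 4 * r) * exp y) * d1"
    unfolding eta_def by (simp add: algebra_simps)
qed

text \<open>The mixture of \<open>real_average_ratio\<close> with \<open>y = (1 - \<delta>) x\<close> is bounded by an exponential whose
  rate shows a definite fraction of the gain \<open>\<delta>\<close>. Linear dependence on \<open>x\<close> in the exponent lets the
  same fraction serve for all labels and all later times.\<close>

lemma contraction_factor:
  fixes x :: real
  assumes "0 \<le> x" "x \<le> X" "0 \<le> \<delta>" "\<delta> \<le> 1" "0 \<le> \<eta>" "\<eta> \<le> \<eta>'" "\<eta>' \<le> 1"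
  shows "(1 - \<eta>') * exp x + \<eta>' * exp ((1 - \<delta>) * x) \<le> exp ((1 - \<eta> / (1 + X) * \<delta>) * x)"
proof -
  have dx: "0 \<le> \<delta> * x" "\<delta> * x \<le> X" using assms mult_mono[of \<delta> 1 x X] by auto
  have "exp (- (\<delta> * x)) = 1 / exp (\<delta> * x)" by (simp add: exp_minus field_simps)
  also have "\<dots> \<le> 1 / (1 + \<delta> * x)" using dx by (intro frac_le) (auto simp: exp_ge_add_one_self)
  finally have "1 - exp (- (\<delta> * x)) \<ge> \<delta> * x / (1 + \<delta> * x)" using dx by (simp add: field_simps)
  moreover have "\<delta> * x / (1 + X) \<le> \<delta> * x / (1 + \<delta> * x)" using dx by (intro frac_le) auto
  ultimately have 1: "\<delta> * x / (1 + X) \<le> 1 - exp (- (\<delta> * x))" by simp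
  have "(1 - \<eta>') * exp x + \<eta>' * exp ((1 - \<delta>) * x) = exp x * (1 - \<eta>' * (1 - exp (- (\<delta> * x))))"
    by (simp add: algebra_simps exp_diff exp_minus divide_inverse)
  also have "\<dots> \<le> exp x * (1 - \<eta> * (\<delta> * x / (1 + X)))"
  proof -
    have "\<eta> * (\<delta> * x / (1 + X)) \<le> \<eta>' * (1 - exp (- (\<delta> * x)))"
      using assms dx by (intro mult_mono 1) auto
    then show ?thesis by simp
  qed
  also have "\<dots> \<le> exp x * exp (- (\<eta> * (\<delta> * x / (1 + X))))"
    using exp_ge_add_one_self[of "- (\<eta> * (\<delta> * x / (1 + X)))"] by simp
  also have "\<dots> = exp ((1 - \<eta> / (1 + X) * \<delta>) * x)"
    by (simp add: exp_add[symmetric] algebra_simps)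
  finally show ?thesis .
qed

lemma prod_one_plus:
  fixes g :: "'i \<Rightarrow> 'a::comm_ring_1"
  assumes "finite E"
  shows "(\<Prod>e\<in>E. 1 + g e) = (\<Sum>T\<in>Pow E. prod g T)"
  using prod_add[OF assms, of g "\<lambda>_. 1"] by (simp add: add.commute)

section \<open>Product measures with complex activities\<close>

text \<open>Factors \<open>1 + z\<close> without cancellation. The constant \<open>3\<close> covers the right half-plane, the disc of
  radius \<open>1/2\<close> and the exterior of the disc of radius \<open>2\<close>.\<close>

definition stable_activity :: "complex \<Rightarrow> bool" where
  "stable_activity z \<longleftrightarrow> 1 + cmod z \<le> 3 * cmod (1 + z)"

text \<open>The sum over subsets is the product of the \<open>1 + g e\<close>, hence its cancellation is controlled
  factor by factor.\<close>

lemma sum_prod_stable_activity: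
  assumes E: "finite E" and g: "\<And>e. e \<in> E \<Longrightarrow> stable_activity (g e)"
  shows "(\<Sum>T\<in>Pow E. prod g T) \<noteq> 0"
    "(\<Sum>T\<in>Pow E. cmod (prod g T)) \<le> 3 ^ card E * cmod (\<Sum>T\<in>Pow E. prod g T)"
proof -
  have "1 + g e \<noteq> 0" if "e \<in> E" for e
  proof
    assume "1 + g e = 0"
    then show False using g[OF that] norm_ge_zero[of "g e"] unfolding stable_activity_def by simp
  qed
  then show "(\<Sum>T\<in>Pow E. prod g T) \<noteq> 0"
    unfolding prod_one_plus[OF E, symmetric] using E by simp
  have "(\<Sum>T\<in>Pow E. cmod (prod g T)) = (\<Sum>T\<in>Pow E. prod (\<lambda>e. cmod (g e)) T)"
    by (simp add: prod_norm)
  also have "\<dots> = (\<Prod>e\<in>E. 1 + cmod (g e))"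
    by (rule prod_one_plus[OF E, symmetric])
  also have "\<dots> \<le> (\<Prod>e\<in>E. 3 * cmod (1 + g e))"
    using g unfolding stable_activity_def by (intro prod_mono) auto
  also have "\<dots> = 3 ^ card E * cmod (\<Sum>T\<in>Pow E. prod g T)"
    unfolding prod_one_plus[OF E, symmetric] by (simp add: prod.distrib prod_norm)
  finally show "(\<Sum>T\<in>Pow E. cmod (prod g T)) \<le> 3 ^ card E * cmod (\<Sum>T\<in>Pow E. prod g T)" .
qed

lemma stable_activity_near_pos:
  assumes "p > 0" "near (complex_of_real p) z r" "r \<le> 1"
  shows "stable_activity z"
proof -
  obtain u where u: "cmod u \<le> r" "z = of_real p * exp u" using assms unfolding near_def by blast
  have "\<bar>Im u\<bar> \<le> 1" using abs_Im_le_cmod[of u] u assms by linarith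
  then have "cos (Im u) \<ge> 0" using pi_gt3 by (intro cos_ge_zero) (auto simp: abs_le_iff)
  then have "Re z \<ge> 0" unfolding u(2) using assms(1) by (simp add: Re_exp)
  then have 1: "1 + (cmod z)\<^sup>2 \<le> (cmod (1 + z))\<^sup>2"
    unfolding cmod_power2 by (simp add: power2_eq_square algebra_simps)
  have "(1 + cmod z)\<^sup>2 \<le> 2 * (1 + (cmod z)\<^sup>2)"
    using zero_le_power2[of "1 - cmod z"] by (simp add: power2_eq_square algebra_simps)
  also have "\<dots> \<le> 2 * (cmod (1 + z))\<^sup>2"
    using 1 by (rule mult_left_mono) simp
  also have "\<dots> \<le> 9 * (cmod (1 + z))\<^sup>2"
    by (rule mult_right_mono) simp_all
  also have "\<dots> = (3 * cmod (1 + z))\<^sup>2" by (simp add: power_mult_distrib)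
  finally show ?thesis unfolding stable_activity_def by (rule power2_le_imp_le) simp
qed

lemma stable_activity_small: "cmod z \<le> 1 / 2 \<Longrightarrow> stable_activity z"
  unfolding stable_activity_def using norm_diff_ineq[of 1 z] by simp

lemma stable_activity_large: "cmod z \<ge> 2 \<Longrightarrow> stable_activity z"
  unfolding stable_activity_def using norm_diff_ineq[of z 1] by (simp add: add.commute)

section \<open>Deviation from product form\<close>

text \<open>Vectors of weights are indexed by sets of labels. The ratio at a label measures the effective
  activity of its marked vertex, given the state \<open>X\<close> of the others.\<close>

definition ratio :: "(nat set \<Rightarrow> 'a::field) \<Rightarrow> nat \<Rightarrow> nat set \<Rightarrow> 'a" where
  "ratio w j X = w (insert j X) / w X"

text \<open>The ratio at \<open>j\<close> varies by at most \<open>b j\<close> when labels in \<open>S j\<close> change their state. Restricting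
  the labels that may change is what allows the direct dependence to be removed in stages.\<close>

definition osc :: "nat \<Rightarrow> (nat set \<Rightarrow> 'a::{real_normed_field,banach}) \<Rightarrow> (nat \<Rightarrow> nat set) \<Rightarrow> (nat \<Rightarrow> real) \<Rightarrow> bool" where
  "osc k w S b \<longleftrightarrow> (\<forall>j\<in>{1..k}. \<forall>X\<subseteq>{1..k} - {j}. \<forall>X'\<subseteq>{1..k} - {j}.
     (X - X') \<union> (X' - X) \<subseteq> S j \<longrightarrow> near (ratio w j X) (ratio w j X') (b j))"

abbreviation others :: "nat \<Rightarrow> nat \<Rightarrow> nat set" where
  "others k j \<equiv> {1..k} - {j}"

lemma oscD:
  assumes "osc k w S b" "j \<in> {1..k}" "X \<subseteq> others k j" "X' \<subseteq> others k j" "(X - X') \<union> (X' - X) \<subseteq> S j"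
  shows "near (ratio w j X) (ratio w j X') (b j)"
  using assms unfolding osc_def by blast

lemma osc_mono:
  assumes "osc k w S b" "\<And>j. j \<in> {1..k} \<Longrightarrow> b j \<le> b' j"
  shows "osc k w S b'"
  using assms unfolding osc_def by (blast intro: near_mono)

text \<open>Inserting the elements of \<open>X\<close> one at a time, each step multiplies by a ratio at \<open>j\<close> that is
  within \<open>b j\<close> of the reference ratio at the empty set.\<close>

lemma near_prod_ratio:
  assumes nz: "\<And>X. X \<subseteq> {1..k} \<Longrightarrow> w X \<noteq> 0" and osc: "osc k w (others k) b" and X: "X \<subseteq> {1..k}"
  shows "near (w {} * (\<Prod>j\<in>X. ratio w j {})) (w X) (\<Sum>j\<in>{1..k}. b j)"
proof -
  have "finite X" using X finite_subset by blast
  then have "near (w {} * (\<Prod>j\<in>X. ratio w j {})) (w X) (\<Sum>j\<in>X. b j)" using X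
  proof induction
    case empty
    then show ?case by (simp add: near_refl)
  next
    case (insert j X)
    have "near (ratio w j {}) (ratio w j X) (b j)"
      using oscD[OF osc, of j "{}" X] insert by auto
    moreover have "near (w {} * (\<Prod>j\<in>X. ratio w j {})) (w X) (\<Sum>j\<in>X. b j)" using insert by auto
    moreover have "w (insert j X) = w X * ratio w j X" using nz[of X] insert unfolding ratio_def by auto
    ultimately have "near ((w {} * (\<Prod>j\<in>X. ratio w j {})) * ratio w j {}) (w (insert j X)) (sum b X + b j)"
      using near_mult by metis
    then show ?case using insert by (simp add: mult_ac add.commute)
  qed
  then show ?thesis
  proof (rule near_mono)
    have "b j \<ge> 0" if "j \<in> {1..k}" for j
      using oscD[OF osc that, of "{}" "{}"] near_nonneg by auto
    then show "sum b X \<le> sum b {1..k}" using X by (intro sum_mono2) auto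
  qed
qed

section \<open>The operator of a gluing datum\<close>

definition partition_sum :: "nat \<Rightarrow> 'a::field \<Rightarrow> (nat set \<Rightarrow> 'a) \<Rightarrow> 'a" where
  "partition_sum k x w = (\<Sum>X\<in>Pow {1..k}. x ^ card X * w X)"

locale hypergraph_gluing =
  fixes k m :: nat and D :: "'e gluing"
  assumes data: "gluing_data k m D"
begin

text \<open>The hyperedges whose glued vertex receives no new label; their states are summed over.\<close>

definition inner_edges :: "'e set" where
  "inner_edges = hedges D - Phi D ` {1..k}"

text \<open>The labels occupied in copy \<open>i\<close> when \<open>S\<close> is the set of hyperedges in state one.\<close>

definition attached :: "nat \<Rightarrow> 'e set \<Rightarrow> nat set" where
  "attached i S = lab D ` {e \<in> S. i \<in> members D e}"

definition share :: "nat \<Rightarrow> nat" where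
  "share j = card (members D (Phi D j))"

text \<open>Since weights do not count marked vertices, a hyperedge contributes one factor \<open>x\<close> if it is
  in state one and receives no new label, whatever the number of copies that it joins.\<close>

definition transfer :: "'a::field \<Rightarrow> (nat set \<Rightarrow> 'a) \<Rightarrow> nat set \<Rightarrow> 'a" where
  "transfer x w Y = (\<Sum>T\<in>Pow inner_edges. x ^ card T * (\<Prod>i\<in>{1..m}. w (attached i (T \<union> Phi D ` Y))))"

text \<open>For weights of product form, the factor that an inner hyperedge in state one contributes: it
  meets each of its copies in the marked vertex labelled \<open>lab D e\<close>.\<close>

definition activity :: "'a::field \<Rightarrow> (nat \<Rightarrow> 'a) \<Rightarrow> 'e \<Rightarrow> 'a" where
  "activity x t e = x * t (lab D e) ^ card (members D e)"

text \<open>The factor gained by switching on the new label \<open>j\<close>, given the state of all other hyperedges.\<close>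

definition link :: "(nat set \<Rightarrow> 'a::field) \<Rightarrow> nat \<Rightarrow> nat set \<Rightarrow> 'e set \<Rightarrow> 'a" where
  "link w j Y T = (\<Prod>i\<in>members D (Phi D j). ratio w (Lam D j) (attached i (T \<union> Phi D ` Y)))"

lemma finite_hedges: "finite (hedges D)" and m2: "m \<ge> 2" and k1: "k \<ge> 1"
  and members_sub: "e \<in> hedges D \<Longrightarrow> members D e \<subseteq> {1..m}"
  and members_ne: "e \<in> hedges D \<Longrightarrow> members D e \<noteq> {}"
  and lab_in: "e \<in> hedges D \<Longrightarrow> lab D e \<in> {1..k}"
  and Phi_in: "j \<in> {1..k} \<Longrightarrow> Phi D j \<in> hedges D"
  and Phi_inj: "inj_on (Phi D) {1..k}"
  using data unfolding gluing_data_def by blast+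

lemma finite_members: "e \<in> hedges D \<Longrightarrow> finite (members D e)"
  using members_sub finite_subset by blast

lemma card_members: assumes "e \<in> hedges D" shows "card (members D e) \<le> m"
  using card_mono[OF _ members_sub[OF assms]] by simp

lemma Lam_in: "j \<in> {1..k} \<Longrightarrow> Lam D j \<in> {1..k}"
  unfolding Lam_def using lab_in Phi_in by blast

lemma finite_inner_edges: "finite inner_edges" and inner_edges_sub: "inner_edges \<subseteq> hedges D"
  unfolding inner_edges_def using finite_hedges by auto

lemma edge_through_unique:
  assumes "e \<in> hedges D" "e' \<in> hedges D" "i \<in> members D e" "i \<in> members D e'" "lab D e = lab D e'"
  shows "e = e'"
proof -
  let ?E = "{f \<in> hedges D. lab D f = lab D e}"
  have inj: "inj_on (members D) ?E" and p: "partition_on {1..m} (members D ` ?E)"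
    using data lab_in[OF assms(1)] unfolding gluing_data_def by auto
  have "members D e = members D e'"
  proof (rule ccontr)
    assume "members D e \<noteq> members D e'"
    moreover have "members D e \<in> members D ` ?E" "members D e' \<in> members D ` ?E"
      using assms by auto
    ultimately have "members D e \<inter> members D e' = {}"
      by (intro disjointD[OF partition_onD2[OF p]])
    then show False using assms by blast
  qed
  then show ?thesis by (rule inj_onD[OF inj]) (use assms in simp_all)
qed

lemma edge_through_exists:
  assumes "j \<in> {1..k}" "i \<in> {1..m}"
  shows "\<exists>e\<in>hedges D. lab D e = j \<and> i \<in> members D e"
proof -
  have "partition_on {1..m} (members D ` {f \<in> hedges D. lab D f = j})"
    using data assms(1) unfolding gluing_data_def by auto
  from partition_onD1[OF this] assms(2) show ?thesis by auto
qed

lemma attached_sub: "S \<subseteq> hedges D \<Longrightarrow> attached i S \<subseteq> {1..k}"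
  unfolding attached_def using lab_in by auto

lemma boundary_sub:
  assumes "Y \<subseteq> {1..k}" "T \<subseteq> inner_edges" shows "T \<union> Phi D ` Y \<subseteq> hedges D"
  using assms Phi_in inner_edges_sub by auto

text \<open>At most one hyperedge of each label passes through a copy, so both sides are products over the incident
  pairs of a copy and a hyperedge.\<close>

lemma prod_attached:
  fixes t :: "nat \<Rightarrow> 'a::field"
  assumes S: "S \<subseteq> hedges D"
  shows "(\<Prod>i\<in>{1..m}. \<Prod>j\<in>attached i S. t j) = (\<Prod>e\<in>S. t (lab D e) ^ card (members D e))"
proof -
  have fin: "finite S" using S finite_hedges finite_subset by blast
  have "(\<Prod>j\<in>attached i S. t j) = (\<Prod>e\<in>S. if i \<in> members D e then t (lab D e) else 1)" for i
  proof -
    have "inj_on (lab D) {e \<in> S. i \<in> members D e}"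
      using S edge_through_unique by (intro inj_onI) blast
    then show ?thesis
      unfolding attached_def using fin by (simp add: prod.reindex prod.inter_filter)
  qed
  then have "(\<Prod>i\<in>{1..m}. \<Prod>j\<in>attached i S. t j)
      = (\<Prod>e\<in>S. \<Prod>i\<in>{1..m}. if i \<in> members D e then t (lab D e) else 1)"
    by (simp add: prod.swap[of _ S])
  also have "\<dots> = (\<Prod>e\<in>S. t (lab D e) ^ card (members D e))"
  proof (rule prod.cong[OF refl])
    fix e assume e: "e \<in> S"
    have "{i \<in> {1..m}. i \<in> members D e} = members D e" using members_sub e S by blast
    then show "(\<Prod>i\<in>{1..m}. if i \<in> members D e then t (lab D e) else 1) = t (lab D e) ^ card (members D e)"
      by (simp add: prod.inter_filter[symmetric])
  qed
  finally show ?thesis .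
qed

lemma Phi_fresh:
  assumes "j \<in> {1..k}" "Y \<subseteq> others k j" "T \<subseteq> inner_edges"
  shows "Phi D j \<notin> T \<union> Phi D ` Y"
  using assms Phi_inj unfolding inner_edges_def inj_on_def by blast

lemma attached_insert:
  assumes j: "j \<in> {1..k}" and Y: "Y \<subseteq> others k j" and T: "T \<subseteq> inner_edges"
  shows "attached i (T \<union> Phi D ` insert j Y)
    = (if i \<in> members D (Phi D j) then insert (Lam D j) (attached i (T \<union> Phi D ` Y)) else attached i (T \<union> Phi D ` Y))"
  unfolding attached_def Lam_def by auto

text \<open>The old label that becomes \<open>j\<close> is occupied in copy \<open>i\<close> only by the hyperedge \<open>Phi D j\<close> itself, which is switched off.\<close>

lemma attached_others:
  assumes j: "j \<in> {1..k}" and Y: "Y \<subseteq> others k j" and T: "T \<subseteq> inner_edges" and i: "i \<in> members D (Phi D j)"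
  shows "attached i (T \<union> Phi D ` Y) \<subseteq> others k (Lam D j)"
proof -
  have sub: "T \<union> Phi D ` Y \<subseteq> hedges D" using Y T by (intro boundary_sub) auto
  have "Lam D j \<notin> attached i (T \<union> Phi D ` Y)"
  proof
    assume "Lam D j \<in> attached i (T \<union> Phi D ` Y)"
    then obtain e where "e \<in> {e \<in> T \<union> Phi D ` Y. i \<in> members D e}" "Lam D j = lab D e"
      unfolding attached_def by (rule imageE)
    then have e: "e \<in> T \<union> Phi D ` Y" and "i \<in> members D e" "lab D e = lab D (Phi D j)"
      unfolding Lam_def by auto
    then have "e = Phi D j" using sub i Phi_in[OF j] by (intro edge_through_unique) auto
    then show False using Phi_fresh[OF j Y T] e by simp
  qed
  then show ?thesis using attached_sub[OF sub] by blast
qed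

lemma near_transfer_summand:
  fixes w :: "nat set \<Rightarrow> 'a::{real_normed_field,banach}"
  assumes nz: "\<And>X. X \<subseteq> {1..k} \<Longrightarrow> w X \<noteq> 0" and osc: "osc k w (others k) b"
    and Y: "Y \<subseteq> {1..k}" and T: "T \<subseteq> inner_edges"
  defines "t \<equiv> \<lambda>j. ratio w j {}"
  shows "near (w {} ^ m * (\<Prod>j\<in>Y. t (Lam D j) ^ share j) * prod (activity x t) T)
    (x ^ card T * (\<Prod>i\<in>{1..m}. w (attached i (T \<union> Phi D ` Y)))) (real m * sum b {1..k})"
proof -
  let ?S = "T \<union> Phi D ` Y"
  have sub: "?S \<subseteq> hedges D" using Y T by (rule boundary_sub)
  have fin: "finite T" "finite (Phi D ` Y)" using T finite_inner_edges Y finite_subset by (blast, metis finite_atLeastAtMost finite_imageI finite_subset)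
  have disj: "T \<inter> Phi D ` Y = {}" using T Y unfolding inner_edges_def by blast
  have "near (\<Prod>i\<in>{1..m}. w {} * (\<Prod>j\<in>attached i ?S. t j)) (\<Prod>i\<in>{1..m}. w (attached i ?S)) (\<Sum>i\<in>{1..m}. sum b {1..k})"
    unfolding t_def by (intro near_prod near_prod_ratio nz osc attached_sub sub)
  then have 1: "near (w {} ^ m * (\<Prod>e\<in>?S. t (lab D e) ^ card (members D e))) (\<Prod>i\<in>{1..m}. w (attached i ?S)) (real m * sum b {1..k})"
    unfolding prod.distrib prod_attached[OF sub] by simp
  have 2: "(\<Prod>e\<in>?S. t (lab D e) ^ card (members D e))
      = (\<Prod>e\<in>T. t (lab D e) ^ card (members D e)) * (\<Prod>j\<in>Y. t (Lam D j) ^ share j)"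
    using Phi_inj Y fin disj unfolding Lam_def share_def
    by (simp add: prod.union_disjoint prod.reindex inj_on_subset)
  have 3: "prod (activity x t) T = x ^ card T * (\<Prod>e\<in>T. t (lab D e) ^ card (members D e))"
    unfolding activity_def prod.distrib by simp
  from near_mult[OF near_refl[of 0 "x ^ card T"] 1] show ?thesis
    unfolding 2 3 by (simp add: mult_ac)
qed

text \<open>Replacing weights by their product form, the sum over states becomes a perturbed product
  measure, and switching on \<open>j\<close> inserts the factor \<open>link\<close>: the new ratio at \<open>j\<close> is an average of
  links. The constant \<open>c\<close> and the perturbation \<open>e\<close> depend on \<open>Y\<close> but not on \<open>j\<close>.\<close>

lemma transfer_average:
  fixes w :: "nat set \<Rightarrow> 'a::{real_normed_field,banach}"
  assumes nz: "\<And>X. X \<subseteq> {1..k} \<Longrightarrow> w X \<noteq> 0" and osc: "osc k w (others k) b"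
    and Y: "Y \<subseteq> {1..k}"
  defines "t \<equiv> \<lambda>j. ratio w j {}"
  shows "\<exists>c e. c \<noteq> 0 \<and> (\<forall>T\<in>Pow inner_edges. norm (e T) \<le> real m * sum b {1..k}) \<and>
    transfer x w Y = c * (\<Sum>T\<in>Pow inner_edges. prod (activity x t) T * exp (e T)) \<and>
    (\<forall>j\<in>{1..k}. Y \<subseteq> others k j \<longrightarrow>
       transfer x w (insert j Y) = c * (\<Sum>T\<in>Pow inner_edges. prod (activity x t) T * exp (e T) * link w j Y T))"
proof -
  define c where "c = w {} ^ m * (\<Prod>j\<in>Y. t (Lam D j) ^ share j)"
  define s where "s T = x ^ card T * (\<Prod>i\<in>{1..m}. w (attached i (T \<union> Phi D ` Y)))" for T
  have tnz: "t j \<noteq> 0" if "j \<in> {1..k}" for j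
    using that nz unfolding t_def ratio_def by simp
  have "finite Y" using Y finite_subset by blast
  then have c: "c \<noteq> 0" unfolding c_def using nz[of "{}"] tnz Lam_in Y by (auto simp: subset_iff)
  have "\<forall>T\<in>Pow inner_edges. \<exists>u. norm u \<le> real m * sum b {1..k} \<and> s T = c * prod (activity x t) T * exp u"
    using near_transfer_summand[OF nz osc Y] unfolding s_def c_def t_def near_def by blast
  then obtain e where e: "\<And>T. T \<in> Pow inner_edges \<Longrightarrow> norm (e T) \<le> real m * sum b {1..k}"
    "\<And>T. T \<in> Pow inner_edges \<Longrightarrow> s T = c * prod (activity x t) T * exp (e T)" by metis
  have 1: "transfer x w Y = c * (\<Sum>T\<in>Pow inner_edges. prod (activity x t) T * exp (e T))"
    unfolding transfer_def s_def[symmetric] sum_distrib_left using e(2) by (intro sum.cong) (auto simp: mult.assoc)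
  have 2: "transfer x w (insert j Y) = c * (\<Sum>T\<in>Pow inner_edges. prod (activity x t) T * exp (e T) * link w j Y T)"
    if j: "j \<in> {1..k}" and Yj: "Y \<subseteq> others k j" for j
    unfolding transfer_def sum_distrib_left
  proof (intro sum.cong refl)
    fix T assume T: "T \<in> Pow inner_edges"
    have sub: "T \<union> Phi D ` Y \<subseteq> hedges D" using Y T by (intro boundary_sub) auto
    have "(\<Prod>i\<in>{1..m}. w (attached i (T \<union> Phi D ` insert j Y)))
       = (\<Prod>i\<in>{1..m}. w (attached i (T \<union> Phi D ` Y))) *
         (\<Prod>i\<in>{1..m}. if i \<in> members D (Phi D j) then ratio w (Lam D j) (attached i (T \<union> Phi D ` Y)) else 1)"
      unfolding prod.distrib[symmetric]
      by (intro prod.cong refl) (use nz attached_sub[OF sub] attached_insert[OF j Yj] T in \<open>auto simp: ratio_def\<close>)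
    also have "(\<Prod>i\<in>{1..m}. if i \<in> members D (Phi D j) then ratio w (Lam D j) (attached i (T \<union> Phi D ` Y)) else 1) = link w j Y T"
    proof -
      have "{i \<in> {1..m}. i \<in> members D (Phi D j)} = members D (Phi D j)" using members_sub[OF Phi_in[OF j]] by blast
      then show ?thesis unfolding link_def by (simp add: prod.inter_filter[symmetric])
    qed
    finally have "x ^ card T * (\<Prod>i\<in>{1..m}. w (attached i (T \<union> Phi D ` insert j Y))) = s T * link w j Y T"
      unfolding s_def by simp
    then show "x ^ card T * (\<Prod>i\<in>{1..m}. w (attached i (T \<union> Phi D ` insert j Y)))
        = c * (prod (activity x t) T * exp (e T) * link w j Y T)"
      using e(2)[OF T] by (simp add: mult.assoc)
  qed
  show ?thesis using c e(1) 1 2 by blast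
qed

text \<open>A direct dependence of the new ratio at \<open>j\<close> on \<open>j'\<close> exists only through a common copy, in which
  it is a dependence of the old ratio at \<open>\<Lambda> j\<close> on \<open>\<Lambda> j'\<close>. The condition says that for \<open>j' \<in> S' j\<close> every such
  dependence is already controlled by \<open>S\<close>.\<close>

definition carries :: "(nat \<Rightarrow> nat set) \<Rightarrow> (nat \<Rightarrow> nat set) \<Rightarrow> bool" where
  "carries S S' \<longleftrightarrow> (\<forall>j\<in>{1..k}. \<forall>j'\<in>S' j \<inter> {1..k}. \<forall>i\<in>members D (Phi D j) \<inter> members D (Phi D j').
     Lam D j' \<in> S (Lam D j))"

text \<open>For a fixed state of the inner hyperedges only the direct dependence remains, one contribution for each copy containing the vertex \<open>j\<close>.\<close>

lemma near_link:
  fixes w :: "nat set \<Rightarrow> 'a::{real_normed_field,banach}"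
  assumes osc: "osc k w S b" and carr: "carries S S'" and j: "j \<in> {1..k}"
    and Y: "Y \<subseteq> others k j" "Y' \<subseteq> others k j" "(Y - Y') \<union> (Y' - Y) \<subseteq> S' j" and T: "T \<subseteq> inner_edges"
  shows "near (link w j Y T) (link w j Y' T) (real (share j) * b (Lam D j))"
proof -
  have "near (link w j Y T) (link w j Y' T) (\<Sum>i\<in>members D (Phi D j). b (Lam D j))"
    unfolding link_def
  proof (intro near_prod oscD[OF osc Lam_in[OF j]] attached_others[OF j Y(1) T] attached_others[OF j Y(2) T])
    fix i assume i: "i \<in> members D (Phi D j)"
    have half: "attached i (T \<union> Phi D ` A) - attached i (T \<union> Phi D ` B) \<subseteq> S (Lam D j)"
      if "A - B \<subseteq> S' j" "A \<subseteq> others k j" for A B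
    proof
      fix l assume l: "l \<in> attached i (T \<union> Phi D ` A) - attached i (T \<union> Phi D ` B)"
      then obtain a where a: "a \<in> A - B" "i \<in> members D (Phi D a)" "l = Lam D a"
        unfolding attached_def Lam_def by auto
      then have "a \<in> S' j \<inter> {1..k}" using that by blast
      then show "l \<in> S (Lam D j)" using carr j i a unfolding carries_def by blast
    qed
    show "attached i (T \<union> Phi D ` Y) - attached i (T \<union> Phi D ` Y') \<union> (attached i (T \<union> Phi D ` Y') - attached i (T \<union> Phi D ` Y)) \<subseteq> S (Lam D j)"
      using half[of Y Y'] half[of Y' Y] Y by blast
  qed
  then show ?thesis unfolding share_def by simp
qed

lemma near_link_all:
  fixes w :: "nat set \<Rightarrow> 'a::{real_normed_field,banach}"
  assumes osc: "osc k w (others k) b" and j: "j \<in> {1..k}"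
    and Y: "Y \<subseteq> others k j" "Y' \<subseteq> others k j" and T: "T \<subseteq> inner_edges" "T' \<subseteq> inner_edges"
  shows "near (link w j Y T) (link w j Y' T') (real (share j) * b (Lam D j))"
    and "near (ratio w (Lam D j) {} ^ share j) (link w j Y T) (real (share j) * b (Lam D j))"
proof -
  have "near (link w j Y T) (link w j Y' T') (\<Sum>i\<in>members D (Phi D j). b (Lam D j))"
    unfolding link_def
    by (intro near_prod oscD[OF osc Lam_in[OF j]] attached_others[OF j Y(1) T(1)] attached_others[OF j Y(2) T(2)])
      (use attached_others[OF j Y(1) T(1)] attached_others[OF j Y(2) T(2)] in blast)+
  then show "near (link w j Y T) (link w j Y' T') (real (share j) * b (Lam D j))"
    unfolding share_def by simp
  have "near (\<Prod>i\<in>members D (Phi D j). ratio w (Lam D j) {}) (link w j Y T) (\<Sum>i\<in>members D (Phi D j). b (Lam D j))"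
    unfolding link_def
    by (intro near_prod oscD[OF osc Lam_in[OF j]] attached_others[OF j Y(1) T(1)])
      (use attached_others[OF j Y(1) T(1)] in blast)+
  then show "near (ratio w (Lam D j) {} ^ share j) (link w j Y T) (real (share j) * b (Lam D j))"
    unfolding share_def by simp
qed

text \<open>Distinct new labels meeting in a copy come from distinct old labels, because hyperedges of equal label are disjoint.\<close>

lemma carries_others: "carries (others k) (others k)"
  unfolding carries_def Lam_def
proof (intro ballI)
  fix j j' i assume *: "j \<in> {1..k}" "j' \<in> others k j \<inter> {1..k}" "i \<in> members D (Phi D j) \<inter> members D (Phi D j')"
  then have "Phi D j \<noteq> Phi D j'" using Phi_inj unfolding inj_on_def by blast
  then have "lab D (Phi D j) \<noteq> lab D (Phi D j')"
    using edge_through_unique[of "Phi D j" "Phi D j'" i] Phi_in * by blast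
  then show "lab D (Phi D j') \<in> others k (lab D (Phi D j))" using lab_in Phi_in * by auto
qed

section \<open>One step of the recursion\<close>

text \<open>With weights \<open>h\<close> adapted to the multiplicities, an average never increases the variation; and a
  smaller variation \<open>v\<close> under direct dependence strictly decreases it. The assumption on \<open>y\<close> is the bound of
  \<open>real_average_ratio\<close> for measures that deviate from product form by the total over labels and copies.\<close>

lemma transfer_real_step:
  fixes w :: "nat set \<Rightarrow> real"
  assumes x: "x > 0" and pos: "\<And>X. X \<subseteq> {1..k} \<Longrightarrow> w X > 0"
    and all: "osc k w (others k) (\<lambda>j. h j * u)" and S: "osc k w S (\<lambda>j. h j * v)"
    and carr: "carries S S'" and h: "\<And>j. j \<in> {1..k} \<Longrightarrow> h j = real (share j) * h (Lam D j)"
    and y: "\<And>j. j \<in> {1..k} \<Longrightarrow> (1 - exp (- 4 * (real m * (\<Sum>j\<in>{1..k}. h j * u)))) * exp (h j * u)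
        + exp (- 4 * (real m * (\<Sum>j\<in>{1..k}. h j * u))) * exp (h j * v) \<le> exp (h j * y)"
  shows "osc k (transfer x w) S' (\<lambda>j. h j * y)"
  unfolding osc_def
proof (intro ballI allI impI)
  fix j Y Y' assume j: "j \<in> {1..k}" and Y: "Y \<subseteq> others k j" "Y' \<subseteq> others k j" "(Y - Y') \<union> (Y' - Y) \<subseteq> S' j"
  have nz: "w X \<noteq> 0" if "X \<subseteq> {1..k}" for X using pos[OF that] by simp
  let ?r = "real m * (\<Sum>j\<in>{1..k}. h j * u)" and ?t = "\<lambda>j. ratio w j {}"
  have main: "0 < ratio (transfer x w) j Y \<and> ratio (transfer x w) j Y' \<le> exp (h j * y) * ratio (transfer x w) j Y"
    if Y: "Y \<subseteq> others k j" "Y' \<subseteq> others k j" "(Y - Y') \<union> (Y' - Y) \<subseteq> S' j" for Y Y'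
  proof -
    have Yk: "Y \<subseteq> {1..k}" "Y' \<subseteq> {1..k}" using Y by auto
    obtain c1 e1 where one': "c1 \<noteq> 0" "\<forall>T\<in>Pow inner_edges. norm (e1 T) \<le> ?r"
      "transfer x w Y = c1 * (\<Sum>T\<in>Pow inner_edges. prod (activity x ?t) T * exp (e1 T))"
      "\<forall>j\<in>{1..k}. Y \<subseteq> others k j \<longrightarrow>
         transfer x w (insert j Y) = c1 * (\<Sum>T\<in>Pow inner_edges. prod (activity x ?t) T * exp (e1 T) * link w j Y T)"
      using transfer_average[OF nz all Yk(1), of x] by blast
    note one = one'(1) bspec[OF one'(2)] one'(3) mp[OF bspec[OF one'(4)]]
    obtain c2 e2 where two': "c2 \<noteq> 0" "\<forall>T\<in>Pow inner_edges. norm (e2 T) \<le> ?r"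
      "transfer x w Y' = c2 * (\<Sum>T\<in>Pow inner_edges. prod (activity x ?t) T * exp (e2 T))"
      "\<forall>j\<in>{1..k}. Y' \<subseteq> others k j \<longrightarrow>
         transfer x w (insert j Y') = c2 * (\<Sum>T\<in>Pow inner_edges. prod (activity x ?t) T * exp (e2 T) * link w j Y' T)"
      using transfer_average[OF nz all Yk(2), of x] by blast
    note two = two'(1) bspec[OF two'(2)] two'(3) mp[OF bspec[OF two'(4)]]
    have rat: "ratio w j X > 0" if "j \<in> {1..k}" "X \<subseteq> others k j" for j X
      unfolding ratio_def using that by (intro divide_pos_pos pos) auto
    have link_pos: "link w j Y T > 0" if "Y \<subseteq> others k j" "T \<in> Pow inner_edges" for Y T
      unfolding link_def using that attached_others[OF j that(1)] by (intro prod_pos ballI rat Lam_in j) auto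
    have act: "prod (activity x ?t) T > 0" if "T \<in> Pow inner_edges" for T
    proof (intro prod_pos ballI)
      fix e assume "e \<in> T"
      then have "lab D e \<in> {1..k}" using that inner_edges_sub lab_in by blast
      then show "activity x ?t e > 0" unfolding activity_def using x rat[of "lab D e" "{}"] by auto
    qed
    have d: "ratio (transfer x w) j Y = (\<Sum>T\<in>Pow inner_edges. prod (activity x ?t) T * exp (e1 T) * link w j Y T) / (\<Sum>T\<in>Pow inner_edges. prod (activity x ?t) T * exp (e1 T))"
      "ratio (transfer x w) j Y' = (\<Sum>T\<in>Pow inner_edges. prod (activity x ?t) T * exp (e2 T) * link w j Y' T) / (\<Sum>T\<in>Pow inner_edges. prod (activity x ?t) T * exp (e2 T))"
      unfolding ratio_def one(3) two(3) one(4)[OF j Y(1)] two(4)[OF j Y(2)] using one(1) two(1) by auto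
    have A: "link w j Y' T' \<le> exp (h j * u) * link w j Y T" if "T \<in> Pow inner_edges" "T' \<in> Pow inner_edges" for T T'
      using near_real_le[OF near_link_all(1)[OF all j Y(1,2), of T T'] link_pos[OF Y(1) that(1)]] that h[OF j] by (simp add: mult.assoc)
    have B: "link w j Y' T \<le> exp (h j * v) * link w j Y T" if "T \<in> Pow inner_edges" for T
      using near_real_le[OF near_link[OF S carr j Y, of T] link_pos[OF Y(1) that(1)]] that h[OF j] by (simp add: mult.assoc)
    have e: "\<bar>e1 T\<bar> \<le> ?r" "\<bar>e2 T\<bar> \<le> ?r" if "T \<in> Pow inner_edges" for T using one(2)[OF that] two(2)[OF that] by auto
    note avg = real_average_ratio[of "Pow inner_edges" "prod (activity x ?t)" e1 ?r e2 "link w j Y" "link w j Y'" "h j * u" "h j * v",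
        OF _ _ act e(1) e(2) link_pos[OF Y(1)] link_pos[OF Y(2)] A B, folded d]
    have fin: "finite (Pow inner_edges)" "Pow inner_edges \<noteq> {}" using finite_inner_edges by auto
    from avg(1)[OF fin] have p: "0 < ratio (transfer x w) j Y" .
    from avg(2)[OF fin] have "ratio (transfer x w) j Y' \<le> ((1 - exp (- 4 * ?r)) * exp (h j * u) + exp (- 4 * ?r) * exp (h j * v)) * ratio (transfer x w) j Y" .
    also have "\<dots> \<le> exp (h j * y) * ratio (transfer x w) j Y"
      using y[OF j] p by (intro mult_right_mono) auto
    finally show ?thesis using p by simp
  qed
  show "near (ratio (transfer x w) j Y) (ratio (transfer x w) j Y') (h j * y)"
    using main[of Y Y'] main[of Y' Y] Y by (intro near_realI) auto
qed

lemma transfer_pos: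
  fixes w :: "nat set \<Rightarrow> real"
  assumes "x > 0" "\<And>X. X \<subseteq> {1..k} \<Longrightarrow> w X > 0" "Y \<subseteq> {1..k}"
  shows "transfer x w Y > 0"
  unfolding transfer_def
proof (intro sum_pos mult_pos_pos prod_pos ballI)
  fix i T assume "T \<in> Pow inner_edges"
  then show "w (attached i (T \<union> Phi D ` Y)) > 0"
    using assms(2) attached_sub[OF boundary_sub[OF assms(3)]] by auto
qed (use assms finite_inner_edges in auto)

text \<open>The perturbation of the product measure by weights deviating from product form is of size
  \<open>m k u\<close>, so \<open>complex_average_ratio\<close> applies with \<open>r = m k u\<close> and \<open>q = m v\<close>. The estimate for the ratio
  itself controls the drift of the reference values.\<close>

lemma transfer_complex_step:
  fixes w :: "nat set \<Rightarrow> complex"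
  assumes nz: "\<And>X. X \<subseteq> {1..k} \<Longrightarrow> w X \<noteq> 0"
    and all: "osc k w (others k) (\<lambda>_. u)" and S: "osc k w S (\<lambda>_. v)"
    and carr: "carries S S'" and uv: "0 \<le> v" "v \<le> u"
    and act: "\<And>e. e \<in> inner_edges \<Longrightarrow> stable_activity (activity x (\<lambda>j. ratio w j {}) e)"
    and M: "M = 3 ^ card inner_edges" and small: "1000 * M\<^sup>2 * (real m * real k * u) \<le> 1"
    and C: "C = 320 * M\<^sup>2 * (real m * real k)\<^sup>2"
  shows "\<And>Y. Y \<subseteq> {1..k} \<Longrightarrow> transfer x w Y \<noteq> 0"
    and "osc k (transfer x w) S' (\<lambda>_. C * (v + u\<^sup>2))"
    and "\<And>j. j \<in> {1..k} \<Longrightarrow> near (ratio w (Lam D j) {} ^ share j) (ratio (transfer x w) j {}) (C * u)"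
proof -
  let ?r = "real m * real k * u" and ?t = "\<lambda>j. ratio w j {}"
  let ?g = "prod (activity x ?t)"
  have r: "real m * (\<Sum>j\<in>{1..k}. u) = ?r" by simp
  have M1: "M \<ge> 1" unfolding M by simp
  have fin: "finite (Pow inner_edges)" using finite_inner_edges by simp
  note P = sum_prod_stable_activity[OF finite_inner_edges act, folded M]
  have mk: "real m \<le> real m * real k" "1 \<le> real m * real k" "1 \<le> real m"
    using k1 m2 mult_mono[of 1 "real m" 1 "real k"] by auto
  have mult_le: "real (share j) \<le> real m" if "j \<in> {1..k}" for j
    unfolding share_def using card_members[OF Phi_in[OF that]] by simp
  have mu: "real (share j) * u \<le> ?r" "real (share j) * v \<le> real m * v" if "j \<in> {1..k}" for j
    using mult_le[OF that] uv mk order_trans[OF mult_le[OF that] mk(1)] by (auto intro!: mult_right_mono)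
  have mv: "real m * v \<le> ?r" using uv mk by (intro mult_mono) auto
  have main: "transfer x w Y \<noteq> 0 \<and> (\<forall>j\<in>{1..k}. Y \<subseteq> others k j \<longrightarrow> Y' \<subseteq> others k j \<longrightarrow> (Y - Y') \<union> (Y' - Y) \<subseteq> S' j \<longrightarrow>
      near (?t (Lam D j) ^ share j) (ratio (transfer x w) j Y) (C * u) \<and>
      near (ratio (transfer x w) j Y) (ratio (transfer x w) j Y') (C * (v + u\<^sup>2)))"
    if Yk: "Y \<subseteq> {1..k}" "Y' \<subseteq> {1..k}" for Y Y'
  proof -
    obtain c1 e1 where one': "c1 \<noteq> 0" "\<forall>T\<in>Pow inner_edges. norm (e1 T) \<le> ?r"
      "transfer x w Y = c1 * (\<Sum>T\<in>Pow inner_edges. ?g T * exp (e1 T))"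
      "\<forall>j\<in>{1..k}. Y \<subseteq> others k j \<longrightarrow>
         transfer x w (insert j Y) = c1 * (\<Sum>T\<in>Pow inner_edges. ?g T * exp (e1 T) * link w j Y T)"
      using transfer_average[OF nz all Yk(1), of x, unfolded r] by blast
    note one = one'(1) bspec[OF one'(2)] one'(3) mp[OF bspec[OF one'(4)]]
    obtain c2 e2 where two': "c2 \<noteq> 0" "\<forall>T\<in>Pow inner_edges. norm (e2 T) \<le> ?r"
      "transfer x w Y' = c2 * (\<Sum>T\<in>Pow inner_edges. ?g T * exp (e2 T))"
      "\<forall>j\<in>{1..k}. Y' \<subseteq> others k j \<longrightarrow>
         transfer x w (insert j Y') = c2 * (\<Sum>T\<in>Pow inner_edges. ?g T * exp (e2 T) * link w j Y' T)"
      using transfer_average[OF nz all Yk(2), of x, unfolded r] by blast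
    note two = two'(1) bspec[OF two'(2)] two'(3) mp[OF bspec[OF two'(4)]]
    have r0: "0 \<le> ?r" using uv by simp
    have nz1: "transfer x w Y \<noteq> 0"
    proof -
      have "(\<Sum>T\<in>Pow inner_edges. ?g T * exp (e1 T)) \<noteq> 0"
        using complex_average_ratio(1)[OF fin P M1 one(2) one(2), where F = 1 and ?f1.0 = "\<lambda>_. 1" and ?f2.0 = "\<lambda>_. 1" and q = 0] r0 small
        by (auto simp: near_refl)
      then show ?thesis using one(1,3) by simp
    qed
    moreover have "near (?t (Lam D j) ^ share j) (ratio (transfer x w) j Y) (C * u) \<and>
      near (ratio (transfer x w) j Y) (ratio (transfer x w) j Y') (C * (v + u\<^sup>2))"
      if j: "j \<in> {1..k}" and Y: "Y \<subseteq> others k j" "Y' \<subseteq> others k j" "(Y - Y') \<union> (Y' - Y) \<subseteq> S' j" for j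
    proof -
      have d: "ratio (transfer x w) j Y = (\<Sum>T\<in>Pow inner_edges. ?g T * exp (e1 T) * link w j Y T) / (\<Sum>T\<in>Pow inner_edges. ?g T * exp (e1 T))"
        "ratio (transfer x w) j Y' = (\<Sum>T\<in>Pow inner_edges. ?g T * exp (e2 T) * link w j Y' T) / (\<Sum>T\<in>Pow inner_edges. ?g T * exp (e2 T))"
        unfolding ratio_def one(3) two(3) one(4)[OF j Y(1)] two(4)[OF j Y(2)] using one(1) two(1) by auto
      have F: "?t (Lam D j) ^ share j \<noteq> 0" using Lam_in[OF j] nz unfolding ratio_def by simp
      have f1: "near (?t (Lam D j) ^ share j) (link w j Y T) ?r" if "T \<in> Pow inner_edges" for T
        using near_link_all(2)[OF all j Y(1,1), of T T] that mu(1)[OF j] by (auto intro: near_mono)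
      have f2: "near (?t (Lam D j) ^ share j) (link w j Y' T) ?r" if "T \<in> Pow inner_edges" for T
        using near_link_all(2)[OF all j Y(2,2), of T T] that mu(1)[OF j] by (auto intro: near_mono)
      have f12: "near (link w j Y T) (link w j Y' T) (real m * v)" if "T \<in> Pow inner_edges" for T
        using near_link[OF S carr j Y, of T] that mu(2)[OF j] by (auto intro: near_mono)
      note avg = complex_average_ratio(2,3)[of "Pow inner_edges" ?g M e1 ?r e2 "?t (Lam D j) ^ share j" "link w j Y" "link w j Y'" "real m * v",
          OF fin P M1 one(2) two(2) F f1 f2 f12, folded d]
      have "near (?t (Lam D j) ^ share j) (ratio (transfer x w) j Y) (16 * M * ?r)"
        using avg(1) uv mv small by simp
      moreover have "16 * M * ?r \<le> C * u"
      proof -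
        have "M * (real m * real k) \<le> M\<^sup>2 * (real m * real k)\<^sup>2"
          unfolding power2_eq_square using M1 mk by (intro mult_mono) (auto simp: mult_le_cancel_left1)
        then have "(M * (real m * real k)) * u \<le> (M\<^sup>2 * (real m * real k)\<^sup>2) * u" using uv by (intro mult_right_mono) auto
        moreover have "0 \<le> (M\<^sup>2 * (real m * real k)\<^sup>2) * u" using uv by simp
        ultimately show ?thesis unfolding C by (simp add: mult_ac)
      qed
      moreover have "near (ratio (transfer x w) j Y) (ratio (transfer x w) j Y') (320 * M\<^sup>2 * (real m * v + ?r\<^sup>2))"
        using avg(2) uv mv small by simp
      moreover have "320 * M\<^sup>2 * (real m * v + ?r\<^sup>2) \<le> C * (v + u\<^sup>2)"
      proof -
        have "real m \<le> (real m * real k)\<^sup>2" unfolding power2_eq_square using mk mult_mono[of 1 "real m * real k" "real m" "real m * real k"] by simp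
        then have "real m * v + ?r\<^sup>2 \<le> (real m * real k)\<^sup>2 * (v + u\<^sup>2)"
          using mult_right_mono[of "real m" "(real m * real k)\<^sup>2" v] uv by (simp add: distrib_left power_mult_distrib)
        then show ?thesis unfolding C by (simp add: mult.assoc mult_left_mono)
      qed
      ultimately show ?thesis using near_mono by blast
    qed
    ultimately show ?thesis by blast
  qed
  show "\<And>Y. Y \<subseteq> {1..k} \<Longrightarrow> transfer x w Y \<noteq> 0" using main by blast
  show "osc k (transfer x w) S' (\<lambda>_. C * (v + u\<^sup>2))"
    unfolding osc_def using main by (meson Diff_subset order_trans)
  show "\<And>j. j \<in> {1..k} \<Longrightarrow> near (ratio w (Lam D j) {} ^ share j) (ratio (transfer x w) j {}) (C * u)"
    using main[of "{}" "{}"] by auto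
qed

end

context hypergraph_gluing
begin

section \<open>Labels under iteration\<close>

lemma Phi_iter_0: "Phi_iter D 0 j = {[]}"
  unfolding Phi_iter_def by simp

lemma Phi_iter_Suc: "Phi_iter D (Suc n) j = set_Cons (members D (Phi D j)) (Phi_iter D n (Lam D j))"
proof -
  have "[0..<Suc n] = 0 # map Suc [0..<n]" by (metis map_Suc_upt upt_conv_Cons zero_less_Suc)
  then show ?thesis unfolding Phi_iter_def by (simp add: o_def funpow_swap1)
qed

text \<open>The labels whose vertices share no copy with the vertex \<open>j\<close> in the \<open>d\<close>-th iterate. Along these
  sets the one-step estimates are chained, in place of forming the gluing data of the iterates.\<close>

definition apart :: "nat \<Rightarrow> nat \<Rightarrow> nat set" where
  "apart d j = {j' \<in> others k j. Phi_iter D d j \<inter> Phi_iter D d j' = {}}"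

lemma apart_0: "apart 0 j = {}"
  unfolding apart_def Phi_iter_0 by simp

text \<open>A common copy \<open>i\<close> of \<open>j\<close> and \<open>j'\<close> prolongs every common index of \<open>\<Lambda> j\<close> and \<open>\<Lambda> j'\<close> in \<open>d\<close> steps to a
  common index of \<open>j\<close> and \<open>j'\<close> in \<open>d + 1\<close> steps.\<close>

lemma carries_apart: "carries (apart d) (apart (Suc d))"
  unfolding carries_def
proof (intro ballI)
  fix j j' i assume j: "j \<in> {1..k}" and j': "j' \<in> apart (Suc d) j \<inter> {1..k}"
    and i: "i \<in> members D (Phi D j) \<inter> members D (Phi D j')"
  have "Lam D j' \<in> others k (Lam D j)"
    using carries_others j j' i unfolding carries_def apart_def by blast
  moreover have "Phi_iter D d (Lam D j) \<inter> Phi_iter D d (Lam D j') = {}"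
    using j' i unfolding apart_def Phi_iter_Suc set_Cons_def by blast
  ultimately show "Lam D j' \<in> apart d (Lam D j)" unfolding apart_def by blast
qed

lemma expanding_apart:
  assumes "expanding k D"
  obtains N where "\<And>j. j \<in> {1..k} \<Longrightarrow> apart N j = others k j"
proof -
  obtain N where "disjoint_family_on (Phi_iter D N) {1..k}" using assms unfolding expanding_def by blast
  then have "apart N j = others k j" if "j \<in> {1..k}" for j
    using that unfolding apart_def disjoint_family_on_def by blast
  then show thesis using that by blast
qed

text \<open>The limit of the number of copies containing the vertex \<open>j\<close> of the \<open>n\<close>-th iterate, when no
  periodic label is critical: after \<open>k\<close> steps the orbit of \<open>j\<close> is periodic and all further factors are \<open>1\<close>.\<close>

definition total_share :: "nat \<Rightarrow> real" where
  "total_share j = (\<Prod>t<k. real (share ((Lam D ^^ t) j)))"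

lemma Lam_funpow_in: "j \<in> {1..k} \<Longrightarrow> (Lam D ^^ t) j \<in> {1..k}"
  by (induction t) (use Lam_in in auto)

lemma share_ge1: assumes "j \<in> {1..k}" shows "share j \<ge> 1"
  unfolding share_def using members_ne[OF Phi_in[OF assms]] finite_members[OF Phi_in[OF assms]]
  by (simp add: Suc_le_eq card_gt_0_iff)

lemma total_share_ge1: "j \<in> {1..k} \<Longrightarrow> total_share j \<ge> 1"
  unfolding total_share_def using share_ge1[OF Lam_funpow_in] by (intro prod_ge_1) (auto simp: Suc_le_eq)

lemma total_share_nonneg: "j \<in> {1..k} \<Longrightarrow> total_share j \<ge> 0"
  using total_share_ge1 by force

lemma total_share_le_sum:
  assumes "j \<in> {1..k}" shows "total_share j \<le> (\<Sum>j\<in>{1..k}. total_share j)"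
  using assms total_share_nonneg by (intro member_le_sum) auto

text \<open>By the pigeonhole principle \<open>\<Lambda>^k j\<close> is periodic, hence not critical, so that the product may be
  extended by one factor and split off at its other end.\<close>

lemma total_share_Lam:
  assumes "nondegenerate k D" and j: "j \<in> {1..k}"
  shows "total_share j = real (share j) * total_share (Lam D j)"
proof -
  have "\<not> inj_on (\<lambda>t. (Lam D ^^ t) j) {..k}"
  proof
    assume "inj_on (\<lambda>t. (Lam D ^^ t) j) {..k}"
    then have "card {..k} \<le> card {1..k}"
      by (rule card_inj_on_le) (use Lam_funpow_in[OF j] in auto)
    then show False by simp
  qed
  then obtain a b where ab: "a < b" "b \<le> k" "(Lam D ^^ a) j = (Lam D ^^ b) j"
    unfolding inj_on_def by (metis atMost_iff linorder_neqE_nat)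
  have "(Lam D ^^ (b - a)) ((Lam D ^^ k) j) = (Lam D ^^ k) j"
  proof -
    have "(Lam D ^^ (b - a)) ((Lam D ^^ k) j) = (Lam D ^^ (k - a)) ((Lam D ^^ b) j)"
      using ab by (simp add: add.commute flip: funpow_add[THEN fun_cong, unfolded o_apply])
    also have "\<dots> = (Lam D ^^ (k - a)) ((Lam D ^^ a) j)" using ab(3) by simp
    also have "\<dots> = (Lam D ^^ k) j"
      using ab(1,2) by (simp flip: funpow_add[THEN fun_cong, unfolded o_apply])
    finally show ?thesis .
  qed
  then have "periodic D ((Lam D ^^ k) j)"
    unfolding periodic_def using ab(1) by (intro exI[of _ "b - a"]) auto
  then have "\<not> critical D ((Lam D ^^ k) j)"
    using assms Lam_funpow_in[OF j] unfolding nondegenerate_def by blast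
  then have 1: "share ((Lam D ^^ k) j) = 1"
    using share_ge1[OF Lam_funpow_in[OF j, of k]] unfolding critical_def share_def by simp
  have "total_share j = (\<Prod>t<Suc k. real (share ((Lam D ^^ t) j)))"
    unfolding total_share_def using 1 by simp
  also have "\<dots> = real (share j) * total_share (Lam D j)"
    unfolding total_share_def prod.lessThan_Suc_shift by (simp add: funpow_swap1)
  finally show ?thesis .
qed

lemma osc_cong:
  assumes "\<And>X. X \<subseteq> {1..k} \<Longrightarrow> w X = w' X"
  shows "osc k w S b \<longleftrightarrow> osc k w' S b"
proof -
  have "ratio w j X = ratio w' j X" if "j \<in> {1..k}" "X \<subseteq> others k j" for j X
    unfolding ratio_def using that assms[of X] assms[of "insert j X"] by fastforce
  then show ?thesis unfolding osc_def by (smt (verit))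
qed

lemma osc_apart_all:
  assumes "\<And>j. j \<in> {1..k} \<Longrightarrow> apart N j = others k j"
  shows "osc k w (apart N) b \<longleftrightarrow> osc k w (others k) b"
  unfolding osc_def using assms by simp

lemma osc_exists:
  fixes w :: "nat set \<Rightarrow> real"
  assumes pos: "\<And>X. X \<subseteq> {1..k} \<Longrightarrow> w X > 0"
  obtains u where "u \<ge> 0" "osc k w (others k) (\<lambda>_. u)"
proof -
  let ?I = "{1..k} \<times> Pow {1..k} \<times> Pow {1..k}"
  define f where "f = (\<lambda>(j, X, X'). \<bar>ln (ratio w j X') - ln (ratio w j X)\<bar>)"
  have "near (ratio w j X) (ratio w j X') (sum f ?I)"
    if j: "j \<in> {1..k}" and X: "X \<subseteq> others k j" "X' \<subseteq> others k j" for j X X'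
  proof -
    have p: "ratio w j X > 0" "ratio w j X' > 0"
      unfolding ratio_def using j X by (auto intro!: divide_pos_pos pos)
    then have "near (ratio w j X) (ratio w j X') (f (j, X, X'))"
      unfolding near_def f_def by (intro exI[of _ "ln (ratio w j X') - ln (ratio w j X)"]) (simp add: exp_diff)
    moreover have "f (j, X, X') \<le> sum f ?I"
      using j X by (intro member_le_sum) (auto simp: f_def)
    ultimately show ?thesis by (rule near_mono)
  qed
  then have "osc k w (others k) (\<lambda>_. sum f ?I)" unfolding osc_def by blast
  moreover have "sum f ?I \<ge> 0" unfolding f_def by (intro sum_nonneg) auto
  ultimately show thesis using that by blast
qed

section \<open>Loss of memory at positive activities\<close>

text \<open>With deviations measured relative to \<open>total_share\<close>, the global deviation \<open>u\<close> does not grow.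
  Along the sets \<open>apart d\<close> it is improved to \<open>(1 - c^d) u\<close>, starting from \<open>0\<close> for the empty set; after
  the number \<open>N\<close> of steps given by expansion all labels are apart, and the global deviation itself has
  been multiplied by \<open>1 - c^N\<close>.\<close>

lemma real_interaction_vanishes:
  fixes W :: "nat \<Rightarrow> nat set \<Rightarrow> real"
  assumes nd: "nondegenerate k D" and ex: "expanding k D" and x: "x > 0"
    and pos0: "\<And>X. X \<subseteq> {1..k} \<Longrightarrow> W 0 X > 0"
    and W: "\<And>n X. X \<subseteq> {1..k} \<Longrightarrow> W (Suc n) X = transfer x (W n) X"
    and \<sigma>: "\<sigma> > 0"
  obtains n where "osc k (W n) (others k) (\<lambda>_. \<sigma>)" "\<And>n X. X \<subseteq> {1..k} \<Longrightarrow> W n X > 0"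
proof -
  obtain N where N: "\<And>j. j \<in> {1..k} \<Longrightarrow> apart N j = others k j" using expanding_apart[OF ex] by blast
  have pos: "W n X > 0" if "X \<subseteq> {1..k}" for n X
    using that
  proof (induction n arbitrary: X)
    case (Suc n)
    then show ?case unfolding W[OF Suc.prems] by (intro transfer_pos x) auto
  qed (rule pos0)
  obtain u0 where u0: "u0 \<ge> 0" "osc k (W 0) (others k) (\<lambda>_. u0)" using osc_exists[of "W 0", OF pos0] by blast
  define H where "H = (\<Sum>j\<in>{1..k}. total_share j)"
  note w1 = total_share_ge1 total_share_nonneg total_share_le_sum[folded H_def]
  have H1: "H \<ge> 1" using w1[of 1] k1 by auto
  \<comment> \<open>A lower bound for the overlap of the averaging measures, valid as long as the deviation stays below its initial value.\<close>
  define \<eta> where "\<eta> = exp (- 4 * (real m * (H * u0)))"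
  define c where "c = \<eta> / (1 + H * u0)"
  have \<eta>: "0 < \<eta>" "\<eta> \<le> 1" unfolding \<eta>_def using H1 u0 by auto
  have "0 \<le> H * u0" using H1 u0 by simp
  then have c: "0 < c" "c \<le> 1" unfolding c_def using \<eta> by (auto simp: divide_le_eq)
  have step: "osc k (W (Suc n)) S' (\<lambda>j. total_share j * ((1 - c * \<delta>) * u))"
    if all: "osc k (W n) (others k) (\<lambda>j. total_share j * u)" and S: "osc k (W n) S (\<lambda>j. total_share j * ((1 - \<delta>) * u))"
      and carr: "carries S S'" and u: "0 \<le> u" "u \<le> u0" and \<delta>: "0 \<le> \<delta>" "\<delta> \<le> 1" for n S S' \<delta> u
  proof -
    have sum: "(\<Sum>j\<in>{1..k}. total_share j * u) = H * u" unfolding H_def by (simp add: sum_distrib_right)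
    have "osc k (transfer x (W n)) S' (\<lambda>j. total_share j * ((1 - c * \<delta>) * u))"
    proof (rule transfer_real_step[OF x pos all S carr total_share_Lam[OF nd]])
      fix j assume j: "j \<in> {1..k}"
      have Hu: "H * u \<le> H * u0" using u H1 by (intro mult_left_mono) auto
      have "total_share j * u \<le> H * u0" using w1[OF j] u H1 by (intro mult_mono) auto
      moreover have "\<eta> \<le> exp (- 4 * (real m * (H * u)))"
        unfolding \<eta>_def using mult_left_mono[OF Hu, of "real m"] by simp
      ultimately show "(1 - exp (- 4 * (real m * (\<Sum>j\<in>{1..k}. total_share j * u)))) * exp (total_share j * u)
        + exp (- 4 * (real m * (\<Sum>j\<in>{1..k}. total_share j * u))) * exp (total_share j * ((1 - \<delta>) * u))
          \<le> exp (total_share j * ((1 - c * \<delta>) * u))"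
        unfolding sum
        using contraction_factor[of "total_share j * u" "H * u0" \<delta> \<eta> "exp (- 4 * (real m * (H * u)))"] w1[OF j] u \<delta> \<eta> H1
        unfolding c_def by (simp add: mult.left_commute)
    qed
    then show ?thesis using osc_cong[of "W (Suc n)" "transfer x (W n)"] W by blast
  qed
  have block: "osc k (W (n + d)) (others k) (\<lambda>j. total_share j * u) \<and> osc k (W (n + d)) (apart d) (\<lambda>j. total_share j * ((1 - c ^ d) * u))"
    if "osc k (W n) (others k) (\<lambda>j. total_share j * u)" "0 \<le> u" "u \<le> u0" for n d u
  proof (induction d)
    case 0
    have "osc k (W n) (apart 0) (\<lambda>j. total_share j * ((1 - c ^ 0) * u))"
      unfolding osc_def apart_0 by (auto simp: near_refl)
    then show ?case using that by simp
  next
    case (Suc d)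
    have "osc k (W (n + d)) (others k) (\<lambda>j. total_share j * ((1 - 0) * u))" using Suc by simp
    from step[OF conjunct1[OF Suc] this carries_others that(2,3)]
      step[OF conjunct1[OF Suc] conjunct2[OF Suc] carries_apart that(2,3)]
    show ?case using c by (simp add: power_le_one)
  qed
  define b where "b = 1 - c ^ N"
  have b: "0 \<le> b" "b < 1" unfolding b_def using c by (auto simp: power_le_one)
  have geo: "osc k (W (q * N)) (others k) (\<lambda>j. total_share j * (b ^ q * u0))" for q
  proof (induction q)
    case 0
    show ?case using u0(2) by simp (rule osc_mono, assumption, use w1 u0(1) in \<open>auto simp: mult_le_cancel_right1\<close>)
  next
    case (Suc q)
    have "b ^ q * u0 \<le> u0" using b u0 by (simp add: mult_left_le_one_le power_le_one)
    from conjunct2[OF block[OF Suc _ this, of N]]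
    have "osc k (W (q * N + N)) (apart N) (\<lambda>j. total_share j * (b * (b ^ q * u0)))"
      unfolding b_def[symmetric] using b u0 by simp
    then have "osc k (W (q * N + N)) (others k) (\<lambda>j. total_share j * (b * (b ^ q * u0)))"
      using osc_apart_all[of N] N by blast
    then show ?case by (simp add: add.commute mult.assoc)
  qed
  obtain q where q: "b ^ q < \<sigma> / (H * u0 + 1)"
    using real_arch_pow_inv[of "\<sigma> / (H * u0 + 1)" b] b \<sigma> H1 u0
    by (metis add_nonneg_pos divide_pos_pos mult_nonneg_nonneg order_trans zero_le_one zero_less_one)
  have "osc k (W (q * N)) (others k) (\<lambda>_. \<sigma>)"
  proof (rule osc_mono[OF geo])
    fix j assume j: "j \<in> {1..k}"
    have "total_share j * (b ^ q * u0) \<le> H * (b ^ q * u0)" using w1[OF j] b u0 by (intro mult_right_mono) auto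
    also have "\<dots> = b ^ q * (H * u0)" by simp
    also have "\<dots> \<le> \<sigma> / (H * u0 + 1) * (H * u0 + 1)" using q b u0 H1 \<sigma> by (intro mult_mono) auto
    also have "\<dots> = \<sigma>" using H1 u0 by (simp add: add_nonneg_eq_0_iff)
    finally show "total_share j * (b ^ q * u0) \<le> \<sigma>" .
  qed
  then show thesis using that pos by blast
qed

section \<open>Stability at complex activities\<close>

text \<open>The sum over the states of the marked vertices is one more perturbed product measure, now with the
  activities \<open>x * ratio w j {}\<close>.\<close>

lemma partition_sum_nonzero:
  fixes w :: "nat set \<Rightarrow> complex"
  assumes nz: "\<And>X. X \<subseteq> {1..k} \<Longrightarrow> w X \<noteq> 0" and all: "osc k w (others k) (\<lambda>_. u)"
    and act: "\<And>j. j \<in> {1..k} \<Longrightarrow> stable_activity (x * ratio w j {})"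
    and small: "1000 * (3 ^ k)\<^sup>2 * (real k * u) \<le> 1" and u: "0 \<le> u"
  shows "partition_sum k x w \<noteq> 0"
proof -
  let ?g = "\<lambda>X. \<Prod>j\<in>X. x * ratio w j {}"
  have "\<forall>X\<in>Pow {1..k}. \<exists>e. norm e \<le> real k * u \<and> w X = w {} * (\<Prod>j\<in>X. ratio w j {}) * exp e"
    using near_prod_ratio[OF nz all] unfolding near_def by auto
  then obtain e where e: "\<And>X. X \<in> Pow {1..k} \<Longrightarrow> norm (e X) \<le> real k * u"
    "\<And>X. X \<in> Pow {1..k} \<Longrightarrow> w X = w {} * (\<Prod>j\<in>X. ratio w j {}) * exp (e X)" by metis
  have "partition_sum k x w = w {} * (\<Sum>X\<in>Pow {1..k}. ?g X * exp (e X))"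
    unfolding partition_sum_def sum_distrib_left
  proof (rule sum.cong[OF refl])
    fix X assume "X \<in> Pow {1..k}"
    then show "x ^ card X * w X = w {} * (?g X * exp (e X))"
      by (subst e(2)) (auto simp: prod.distrib mult_ac)
  qed
  moreover have "(\<Sum>X\<in>Pow {1..k}. ?g X * exp (e X)) \<noteq> 0"
  proof -
    have fin: "finite {1..k}" "finite (Pow {1..k})" by auto
    note P = sum_prod_stable_activity[OF fin(1), of "\<lambda>j. x * ratio w j {}", OF act]
    show ?thesis
      by (rule complex_average_ratio(1)[OF fin(2) P(1), where M = "3 ^ k" and ?e1.0 = e and ?e2.0 = e and r = "real k * u"
            and F = 1 and ?f1.0 = "\<lambda>_. 1" and ?f2.0 = "\<lambda>_. 1" and q = 0])
        (use P(2) e u small in \<open>auto simp: near_refl\<close>)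
  qed
  ultimately show ?thesis using nz[of "{}"] by simp
qed

text \<open>The set \<open>A\<close> stands for the unperturbed ratios; \<open>{1}\<close> and the positive reals are the cases used. At
  time \<open>n\<close> the deviation along \<open>apart d\<close> is at most \<open>\<sigma> 2^{-n} K^d\<close>. The factor \<open>K^d\<close> absorbs the constant
  \<open>C\<close> of the direct dependence, which is possible because it passes from \<open>d\<close> to \<open>d + 1\<close> and \<open>d \<le> N\<close>; the
  quadratic term is negligible when \<open>\<sigma> K^{2N} \<le> 1\<close>. The reference ratios move by \<open>C K^N \<sigma> 2^{-n}\<close> in
  step \<open>n\<close>, up to powers accounted for by \<open>total_share\<close>; these errors are summable, and the ratios stay within
  \<open>r\<close> of \<open>A\<close>.\<close>

lemma complex_stability:
  assumes nd: "nondegenerate k D" and ex: "expanding k D" and r: "r > 0"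
  obtains \<sigma> where "\<sigma> > 0" "\<And>A x W p n.
    \<forall>a\<in>A. \<forall>n. a ^ n \<in> A \<Longrightarrow>
    \<forall>a\<in>A. \<forall>z. near a z r \<longrightarrow> stable_activity (x * z) \<Longrightarrow>
    \<forall>n. \<forall>X\<subseteq>{1..k}. W (Suc n) X = transfer x (W n) X \<Longrightarrow>
    \<forall>X\<subseteq>{1..k}. W 0 X \<noteq> 0 \<Longrightarrow>
    \<forall>j\<in>{1..k}. p j \<in> A \<and> (\<forall>X\<subseteq>others k j. near (p j) (ratio (W 0) j X) (\<sigma> / 2)) \<Longrightarrow>
    partition_sum k x (W n) \<noteq> (0::complex)"
proof -
  obtain N where N: "\<And>j. j \<in> {1..k} \<Longrightarrow> apart N j = others k j" using expanding_apart[OF ex] by blast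
  define H where "H = (\<Sum>j\<in>{1..k}. total_share j)"
  note w1 = total_share_ge1 total_share_nonneg total_share_le_sum[folded H_def]
  have H1: "H \<ge> 1" using w1[of 1] k1 by auto
  define M :: real where "M = 3 ^ card inner_edges"
  define C where "C = 320 * M\<^sup>2 * (real m * real k)\<^sup>2"
  \<comment> \<open>A factor 2 for the two terms of the one-step estimate, and another to halve the deviation in each step.\<close>
  define K where "K = 4 * C"
  have "M \<ge> 1" unfolding M_def by simp
  have "1 \<le> real m * real k" using k1 m2 mult_mono[of 1 "real m" 1 "real k"] by auto
  then have C1: "C \<ge> 1"
    unfolding C_def using mult_mono[of 1 "320 * M\<^sup>2" 1 "(real m * real k)\<^sup>2"]
      one_le_power[OF \<open>M \<ge> 1\<close>, of 2] one_le_power[of "real m * real k" 2] by linarith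
  have K1: "K \<ge> 1" unfolding K_def using C1 by simp
  \<comment> \<open>Each requirement on the threshold has the form c * \<sigma> \<le> 1: smallness for the averages, for the quadratic term, for the final partition sum and for the total drift.\<close>
  define c1 c2 c3 c4 where "c1 = 1000 * M\<^sup>2 * (real m * real k * K ^ N)" and "c2 = K ^ (2 * N)"
    and "c3 = 1000 * (3 ^ k)\<^sup>2 * (real k * K ^ N)" and "c4 = real m * H * (1 + 2 * C * K ^ N) / r"
  have c: "0 \<le> c1" "0 \<le> c2" "0 \<le> c3" "0 \<le> c4"
    unfolding c1_def c2_def c3_def c4_def using K1 H1 C1 r by auto
  define \<sigma> where "\<sigma> = 1 / (c1 + c2 + c3 + c4 + 1)"
  have \<sigma>: "\<sigma> > 0" "c1 * \<sigma> \<le> 1" "c2 * \<sigma> \<le> 1" "c3 * \<sigma> \<le> 1" "c4 * \<sigma> \<le> 1"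
    unfolding \<sigma>_def using c by (auto simp: divide_le_eq)
  have s4: "real m * H * (\<sigma> * (1 + 2 * C * K ^ N)) \<le> r"
    using \<sigma>(5) r unfolding c4_def by (simp add: field_simps)
  have *: "partition_sum k x (W n) \<noteq> 0"
    if "\<forall>a\<in>A. \<forall>n. a ^ n \<in> A"
      and "\<forall>a\<in>A. \<forall>z. near a z r \<longrightarrow> stable_activity (x * z)"
      and "\<forall>n. \<forall>X\<subseteq>{1..k}. W (Suc n) X = transfer x (W n) X"
      and "\<forall>X\<subseteq>{1..k}. W 0 X \<noteq> 0"
      and "\<forall>j\<in>{1..k}. p j \<in> A \<and> (\<forall>X\<subseteq>others k j. near (p j) (ratio (W 0) j X) (\<sigma> / 2))"
    for A x and W :: "nat \<Rightarrow> nat set \<Rightarrow> complex" and p n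
  proof -
    have A: "\<And>a n. a \<in> A \<Longrightarrow> a ^ n \<in> A"
      and act: "\<And>a z. a \<in> A \<Longrightarrow> near a z r \<Longrightarrow> stable_activity (x * z)"
      and W: "\<And>n X. X \<subseteq> {1..k} \<Longrightarrow> W (Suc n) X = transfer x (W n) X"
      and nz0: "\<And>X. X \<subseteq> {1..k} \<Longrightarrow> W 0 X \<noteq> 0"
      and p: "\<And>j. j \<in> {1..k} \<Longrightarrow> p j \<in> A" "\<And>j X. j \<in> {1..k} \<Longrightarrow> X \<subseteq> others k j \<Longrightarrow> near (p j) (ratio (W 0) j X) (\<sigma> / 2)"
      using that by blast+
    define s where "s n = \<sigma> * (1 + 2 * C * K ^ N * (1 - 1 / 2 ^ n))" for n :: nat
    define v where "v n d = \<sigma> / 2 ^ n * K ^ d" for n d :: nat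
    define Inv where "Inv n \<longleftrightarrow> (\<forall>X\<subseteq>{1..k}. W n X \<noteq> 0) \<and> (\<forall>d\<le>N. osc k (W n) (apart d) (\<lambda>_. v n d)) \<and>
      (\<exists>p. \<forall>j\<in>{1..k}. p j \<in> A \<and> near (p j) (ratio (W n) j {}) (total_share j * s n))" for n
    have s_le: "real m * H * s n \<le> r" "s n \<ge> 0" for n
    proof -
      have "1 - 1 / 2 ^ n \<le> (1::real)" "(0::real) \<le> 1 - 1 / 2 ^ n" by auto
      then have "2 * C * K ^ N * (1 - 1 / 2 ^ n) \<le> 2 * C * K ^ N" "0 \<le> 2 * C * K ^ N * (1 - 1 / 2 ^ n)"
        using C1 K1 by (auto intro: mult_left_le)
      then have "s n \<le> \<sigma> * (1 + 2 * C * K ^ N)" "s n \<ge> 0" unfolding s_def using \<sigma>(1) by auto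
      then show "real m * H * s n \<le> r" "s n \<ge> 0"
        using s4 mult_left_mono[of "s n" "\<sigma> * (1 + 2 * C * K ^ N)" "real m * H"] H1 by auto
    qed
    have v0: "v n d > 0" for n d unfolding v_def using \<sigma> K1 by auto
    have v_le: "v n N \<le> \<sigma> * K ^ N" "v n d \<le> v n N" if "d \<le> N" for n d
    proof -
      have "\<sigma> / 2 ^ n \<le> \<sigma>" using \<sigma>(1) by (simp add: divide_le_eq)
      then show "v n N \<le> \<sigma> * K ^ N" unfolding v_def using K1 by (intro mult_right_mono) auto
      show "v n d \<le> v n N" unfolding v_def using K1 \<sigma>(1) that by (intro mult_left_mono power_increasing) auto
    qed
    have small: "1000 * M\<^sup>2 * (real m * real k * v n N) \<le> 1" "1000 * (3 ^ k)\<^sup>2 * (real k * v n N) \<le> 1" for n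
      using \<sigma>(2,4) mult_left_mono[OF v_le(1)[of N n], of "1000 * M\<^sup>2 * (real m * real k)"]
        mult_left_mono[OF v_le(1)[of N n], of "1000 * (3 ^ k)\<^sup>2 * real k"]
      unfolding c1_def c3_def by (auto simp: mult_ac)
    have consequences: "osc k (W n) (others k) (\<lambda>_. v n N)"
      "\<And>j c. j \<in> {1..k} \<Longrightarrow> c \<le> m \<Longrightarrow> stable_activity (x * ratio (W n) j {} ^ c)" if "Inv n" for n
    proof -
      show "osc k (W n) (others k) (\<lambda>_. v n N)"
        using \<open>Inv n\<close> osc_apart_all[OF N] unfolding Inv_def by blast
      fix j c assume j: "j \<in> {1..k}" and c: "c \<le> m"
      obtain p where "p \<in> A" "near p (ratio (W n) j {}) (total_share j * s n)"
        using \<open>Inv n\<close> j unfolding Inv_def by blast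
      then have "near (p ^ c) (ratio (W n) j {} ^ c) (real c * (total_share j * s n))" by (intro near_power)
      moreover have "real c * (total_share j * s n) \<le> real m * (H * s n)"
        using c w1[OF j] s_le(2)[of n] H1 by (intro mult_mono) auto
      ultimately have "near (p ^ c) (ratio (W n) j {} ^ c) r"
        using s_le(1)[of n] by (auto elim!: near_mono simp: mult.assoc)
      then show "stable_activity (x * ratio (W n) j {} ^ c)" using act A \<open>p \<in> A\<close> by blast
    qed
    have "Inv n" for n
    proof (induction n)
      case 0
      have "osc k (W 0) (apart d) (\<lambda>_. v 0 d)" if "d \<le> N" for d
        unfolding osc_def
      proof (intro ballI allI impI)
        fix j X X' assume X: "j \<in> {1..k}" "X \<subseteq> others k j" "X' \<subseteq> others k j"
        have "near (ratio (W 0) j X) (ratio (W 0) j X') (\<sigma> / 2 + \<sigma> / 2)"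
          by (rule near_trans[OF near_sym[OF p(2)[OF X(1,2)]] p(2)[OF X(1,3)]])
        then show "near (ratio (W 0) j X) (ratio (W 0) j X') (v 0 d)"
          by (rule near_mono) (use \<sigma> K1 in \<open>auto simp: v_def\<close>)
      qed
      moreover have "near (p j) (ratio (W 0) j {}) (total_share j * s 0)" if "j \<in> {1..k}" for j
        using p(2)[OF that, of "{}"] w1(1)[OF that] \<sigma>(1) mult_right_mono[of 1 "total_share j" \<sigma>]
        by (auto elim!: near_mono simp: s_def)
      ultimately show ?case unfolding Inv_def using nz0 p(1) by blast
    next
      case (Suc n)
      note all = consequences(1)[OF Suc]
      have nz: "W n X \<noteq> 0" if "X \<subseteq> {1..k}" for X using Suc that unfolding Inv_def by blast
      have act': "stable_activity (activity x (\<lambda>j. ratio (W n) j {}) e)" if "e \<in> inner_edges" for e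
      proof -
        have e: "e \<in> hedges D" using that inner_edges_sub by blast
        show ?thesis unfolding activity_def by (rule consequences(2)[OF Suc lab_in[OF e] card_members[OF e]])
      qed
      have nz': "W (Suc n) X \<noteq> 0" if "X \<subseteq> {1..k}" for X
        unfolding W[OF that] using transfer_complex_step(1)[OF nz all all carries_others less_imp_le[OF v0] order_refl act' M_def small(1) C_def that] .
      have osc': "osc k (W (Suc n)) (apart d) (\<lambda>_. v (Suc n) d)" if d: "d \<le> N" for d
      proof (cases d)
        case 0
        then show ?thesis unfolding osc_def using v0[of "Suc n" d] by (auto simp: apart_0 intro!: near_refl)
      next
        case (Suc d')
        have d': "d' \<le> N" using d Suc by simp
        have "osc k (W n) (apart d') (\<lambda>_. v n d')" using \<open>Inv n\<close> d' unfolding Inv_def by blast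
        from transfer_complex_step(2)[OF nz all this carries_apart less_imp_le[OF v0] v_le(2)[OF d'] act' M_def small(1) C_def]
        have "osc k (W (Suc n)) (apart d) (\<lambda>_. C * (v n d' + (v n N)\<^sup>2))"
          using osc_cong[of "W (Suc n)" "transfer x (W n)"] W Suc by blast
        then show ?thesis
        proof (rule osc_mono)
          have "(v n N)\<^sup>2 = \<sigma> / 2 ^ n * (c2 * \<sigma>) * (1 / 2 ^ n)"
            unfolding v_def c2_def by (simp add: power2_eq_square power_mult field_simps power_even_eq)
          also have "\<dots> \<le> \<sigma> / 2 ^ n * 1 * 1"
            using \<sigma> c by (intro mult_mono) auto
          also have "\<dots> \<le> v n d'"
            unfolding v_def using \<sigma>(1) one_le_power[OF K1, of d'] mult_left_mono[of 1 "K ^ d'" "\<sigma> / 2 ^ n"] by simp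
          finally have "C * (v n d' + (v n N)\<^sup>2) \<le> C * (v n d' + v n d')" using C1 by (intro mult_left_mono) auto
          also have "\<dots> = v (Suc n) d" unfolding v_def Suc K_def by (simp add: field_simps)
          finally show "C * (v n d' + (v n N)\<^sup>2) \<le> v (Suc n) d" .
        qed
      qed
      obtain p where p: "\<And>j. j \<in> {1..k} \<Longrightarrow> p j \<in> A \<and> near (p j) (ratio (W n) j {}) (total_share j * s n)"
        using Suc unfolding Inv_def by blast
      have near': "p (Lam D j) ^ share j \<in> A \<and> near (p (Lam D j) ^ share j) (ratio (W (Suc n)) j {}) (total_share j * s (Suc n))"
        if j: "j \<in> {1..k}" for j
      proof -
        have r': "ratio (W (Suc n)) j {} = ratio (transfer x (W n)) j {}" unfolding ratio_def using W j by simp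
        have "near (p (Lam D j) ^ share j) (ratio (W n) (Lam D j) {} ^ share j) (real (share j) * (total_share (Lam D j) * s n))"
          using p[OF Lam_in[OF j]] by (intro near_power) auto
        moreover have "near (ratio (W n) (Lam D j) {} ^ share j) (ratio (W (Suc n)) j {}) (C * v n N)"
          unfolding r' using transfer_complex_step(3)[OF nz all all carries_others less_imp_le[OF v0] order_refl act' M_def small(1) C_def j] .
        ultimately have "near (p (Lam D j) ^ share j) (ratio (W (Suc n)) j {}) (real (share j) * (total_share (Lam D j) * s n) + C * v n N)"
          by (rule near_trans)
        then have "near (p (Lam D j) ^ share j) (ratio (W (Suc n)) j {}) (total_share j * s (Suc n))"
        proof (rule near_mono)
          have "real (share j) * (total_share (Lam D j) * s n) + C * v n N = total_share j * s n + C * v n N"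
            using total_share_Lam[OF nd j] by simp
          also have "\<dots> \<le> total_share j * s n + total_share j * (C * v n N)"
            using w1(1)[OF j] C1 v0[of n N] mult_right_mono[of 1 "total_share j" "C * v n N"] by auto
          also have "\<dots> = total_share j * s (Suc n)" unfolding s_def v_def by (simp add: field_simps)
          finally show "real (share j) * (total_share (Lam D j) * s n) + C * v n N \<le> total_share j * s (Suc n)" .
        qed
        then show ?thesis using A p[OF Lam_in[OF j]] by blast
      qed
      show ?case unfolding Inv_def using nz' osc' near' by (intro conjI allI impI exI[of _ "\<lambda>j. p (Lam D j) ^ share j"] ballI) auto
    qed
    note I = this[of n]
    show ?thesis
    proof (rule partition_sum_nonzero[OF _ consequences(1)[OF I] _ small(2) less_imp_le[OF v0]])
      show "stable_activity (x * ratio (W n) j {})" if "j \<in> {1..k}" for j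
        using consequences(2)[OF I that, of 1] m2 by simp
    qed (use I in \<open>auto simp: Inv_def\<close>)
  qed
  show thesis by (rule that[OF \<sigma>(1)]) (rule *)
qed

end

section \<open>Weights of marked graphs\<close>

text \<open>Marked vertices are kept out of \<open>K\<close>, so that the weights count unmarked vertices only: this makes
  gluing multiplicative over copies, and the weights remain meaningful at activity \<open>0\<close>.\<close>

definition unmarked_parts :: "nat \<Rightarrow> 'v marked_graph \<Rightarrow> nat set \<Rightarrow> 'v set set" where
  "unmarked_parts k G X = {K. K \<subseteq> verts G - mark G ` {1..k} \<and> K \<union> mark G ` X \<in> indep_sets G}"

definition marked_weight :: "nat \<Rightarrow> 'v marked_graph \<Rightarrow> 'a::field \<Rightarrow> nat set \<Rightarrow> 'a" where
  "marked_weight k G x X = (\<Sum>K\<in>unmarked_parts k G X. x ^ card K)"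

lemma marked_graphsD:
  assumes "G \<in> marked_graphs k"
  shows "finite (verts G)" "\<And>e. e \<in># edges G \<Longrightarrow> e \<subseteq> verts G" "\<And>e. e \<in># edges G \<Longrightarrow> card e = 2"
    "mark G ` {1..k} \<subseteq> verts G" "inj_on (mark G) {1..k}"
  using assms unfolding marked_graphs_def by auto

lemma finite_unmarked_parts: "G \<in> marked_graphs k \<Longrightarrow> finite (unmarked_parts k G X)"
  by (rule finite_subset[of _ "Pow (verts G)"]) (auto simp: unmarked_parts_def dest: marked_graphsD(1))

lemma indep_poly_eq_partition_sum:
  assumes G: "G \<in> marked_graphs k"
  shows "poly (indep_poly G) x = partition_sum k x (marked_weight k G x)"
proof -
  note g = marked_graphsD[OF G]
  let ?P = "mark G ` {1..k}"
  have "poly (indep_poly G) x = (\<Sum>I\<in>indep_sets G. x ^ card I)"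
    unfolding indep_poly_def by (simp add: poly_sum poly_monom)
  also have "\<dots> = (\<Sum>(X, K)\<in>(SIGMA X:Pow {1..k}. unmarked_parts k G X). x ^ card X * x ^ card K)"
  proof (rule sum.reindex_bij_witness[where j = "\<lambda>I. ({j \<in> {1..k}. mark G j \<in> I}, I - ?P)" and i = "\<lambda>(X, K). K \<union> mark G ` X"])
    fix I assume I: "I \<in> indep_sets G"
    have un: "(I - ?P) \<union> mark G ` {j \<in> {1..k}. mark G j \<in> I} = I" by auto
    show "(case ({j \<in> {1..k}. mark G j \<in> I}, I - ?P) of (X, K) \<Rightarrow> K \<union> mark G ` X) = I" using un by simp
    show "({j \<in> {1..k}. mark G j \<in> I}, I - ?P) \<in> (SIGMA X:Pow {1..k}. unmarked_parts k G X)"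
      using I un unfolding unmarked_parts_def by (auto simp: indep_sets_def)
    have "finite I" using I g(1) finite_subset unfolding indep_sets_def by blast
    then have "card I = card (I - ?P) + card (mark G ` {j \<in> {1..k}. mark G j \<in> I})"
      by (subst un[symmetric], intro card_Un_disjoint) auto
    also have "card (mark G ` {j \<in> {1..k}. mark G j \<in> I}) = card {j \<in> {1..k}. mark G j \<in> I}"
      by (intro card_image inj_on_subset[OF g(5)]) auto
    finally show "(case ({j \<in> {1..k}. mark G j \<in> I}, I - ?P) of (X, K) \<Rightarrow> x ^ card X * x ^ card K) = x ^ card I"
      by (simp add: power_add)
  next
    fix b assume b: "b \<in> (SIGMA X:Pow {1..k}. unmarked_parts k G X)"
    obtain X K where [simp]: "b = (X, K)" by (cases b)
    have X: "X \<subseteq> {1..k}" and K: "K \<subseteq> verts G - ?P" "K \<union> mark G ` X \<in> indep_sets G"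
      using b unfolding unmarked_parts_def by auto
    show "(case b of (X, K) \<Rightarrow> K \<union> mark G ` X) \<in> indep_sets G" using K by simp
    have "{j \<in> {1..k}. mark G j \<in> K \<union> mark G ` X} = X"
      using X K g(5) unfolding inj_on_def by blast
    moreover have "K \<union> mark G ` X - ?P = K" using X K by blast
    ultimately show "({j \<in> {1..k}. mark G j \<in> (case b of (X, K) \<Rightarrow> K \<union> mark G ` X)}, (case b of (X, K) \<Rightarrow> K \<union> mark G ` X) - ?P) = b"
      by simp
  qed
  also have "\<dots> = partition_sum k x (marked_weight k G x)"
    unfolding partition_sum_def marked_weight_def sum_distrib_left
    by (subst sum.Sigma) (auto simp: finite_unmarked_parts[OF G])
  finally show ?thesis .
qed

lemma marked_weight_iso:
  assumes iso: "marked_graph_iso k G G'" and G: "G \<in> marked_graphs k" and X: "X \<subseteq> {1..k}"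
  shows "marked_weight k G' x X = marked_weight k G x X"
proof -
  note g = marked_graphsD[OF G]
  obtain f where f: "bij_betw f (verts G) (verts G')" "edges G' = image_mset (image f) (edges G)"
    "\<And>j. j \<in> {1..k} \<Longrightarrow> mark G' j = f (mark G j)"
    using iso unfolding marked_graph_iso_def by blast
  have inj: "inj_on f (verts G)" and im: "f ` verts G = verts G'" using f(1) unfolding bij_betw_def by auto
  have indep: "f ` I \<in> indep_sets G' \<longleftrightarrow> I \<in> indep_sets G" if "I \<subseteq> verts G" for I
  proof -
    have "f ` e \<subseteq> f ` I \<longleftrightarrow> e \<subseteq> I" if "e \<in># edges G" for e
      using inj_on_image_subset_iff[OF inj g(2)[OF that] \<open>I \<subseteq> verts G\<close>] .
    moreover have "f ` I \<subseteq> verts G'" using that im by blast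
    ultimately show ?thesis unfolding indep_sets_def f(2) using that by auto
  qed
  have marks: "mark G' ` Y = f ` mark G ` Y" if "Y \<subseteq> {1..k}" for Y
    using f(3) that by (force simp: image_iff)
  have "unmarked_parts k G' X = image f ` unmarked_parts k G X"
  proof (intro equalityI subsetI)
    fix L assume L: "L \<in> unmarked_parts k G' X"
    define K where "K = {v \<in> verts G. f v \<in> L}"
    have LK: "L = f ` K" using L im unfolding K_def unmarked_parts_def by auto
    have "K \<subseteq> verts G - mark G ` {1..k}"
      using L marks[OF order_refl] unfolding K_def unmarked_parts_def by blast
    moreover have "K \<union> mark G ` X \<in> indep_sets G"
    proof -
      have "mark G ` X \<subseteq> verts G" using g(4) X by blast
      then have "K \<union> mark G ` X \<subseteq> verts G" unfolding K_def by blast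
      from indep[OF this] show ?thesis
        using L unfolding LK unmarked_parts_def mem_Collect_eq marks[OF X] image_Un[symmetric] by blast
    qed
    ultimately show "L \<in> image f ` unmarked_parts k G X" unfolding LK unmarked_parts_def by blast
  next
    fix L assume "L \<in> image f ` unmarked_parts k G X"
    then obtain K where K: "K \<subseteq> verts G - mark G ` {1..k}" "K \<union> mark G ` X \<in> indep_sets G" and L: "L = f ` K"
      unfolding unmarked_parts_def by blast
    have "L \<subseteq> verts G' - mark G' ` {1..k}"
      unfolding L marks[OF order_refl] using K(1) inj im g(4) unfolding inj_on_def by blast
    moreover have "L \<union> mark G' ` X \<in> indep_sets G'"
      unfolding L marks[OF X] image_Un[symmetric] using K indep[of "K \<union> mark G ` X"] by (auto simp: indep_sets_def)
    ultimately show "L \<in> unmarked_parts k G' X" unfolding unmarked_parts_def by blast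
  qed
  moreover have "inj_on (image f) (unmarked_parts k G X)"
    using inj by (intro inj_on_image_Pow[THEN inj_on_subset]) (auto simp: unmarked_parts_def)
  moreover have "card (f ` K) = card K" if "K \<in> unmarked_parts k G X" for K
    using that by (intro card_image inj_on_subset[OF inj]) (auto simp: unmarked_parts_def)
  ultimately show ?thesis unfolding marked_weight_def by (simp add: sum.reindex)
qed

context hypergraph_gluing
begin

section \<open>The recursion for weights\<close>

text \<open>The class of \<open>(i, mark G (lab D e))\<close> for every copy \<open>i\<close> in the hyperedge, see \<open>vertex_class_marked\<close>.\<close>

definition glued_vertex :: "'v marked_graph \<Rightarrow> 'e \<Rightarrow> (nat \<times> 'v) set" where
  "glued_vertex G e = members D e \<times> {mark G (lab D e)}"

text \<open>Vertex sets of the glued graph, coordinatised by hyperedges and by unmarked vertices of each copy, whose classes are singletons.\<close>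

definition assemble :: "'v marked_graph \<Rightarrow> 'e set \<Rightarrow> (nat \<Rightarrow> 'v set) \<Rightarrow> (nat \<times> 'v) set set" where
  "assemble G S K = (\<lambda>p. {p}) ` (SIGMA i:{1..m}. K i) \<union> glued_vertex G ` S"

context
  fixes G :: "'v marked_graph"
  assumes G: "G \<in> marked_graphs k"
begin

abbreviation "unmarked \<equiv> verts G - mark G ` {1..k}"
abbreviation "vertex_class i v \<equiv> glue_rel m D G `` {(i, v)}"

lemma glue_rel_iff: "((i, v), (j, w)) \<in> glue_rel m D G \<longleftrightarrow> (i = j \<and> v = w \<and> i \<in> {1..m} \<and> v \<in> verts G) \<or>
     (\<exists>e\<in>hedges D. i \<in> members D e \<and> j \<in> members D e \<and> v = mark G (lab D e) \<and> w = v)"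
  unfolding glue_rel_def by blast

lemma vertex_class_unmarked:
  assumes "i \<in> {1..m}" "v \<in> unmarked"
  shows "vertex_class i v = {(i, v)}"
proof -
  have "((i, v), (j, w)) \<in> glue_rel m D G \<longleftrightarrow> (j, w) = (i, v)" for j w
    unfolding glue_rel_iff using assms lab_in by auto
  then show ?thesis by auto
qed

lemma vertex_class_marked:
  assumes "e \<in> hedges D" "i \<in> members D e"
  shows "vertex_class i (mark G (lab D e)) = glued_vertex G e"
proof -
  have "((i, mark G (lab D e)), (j, w)) \<in> glue_rel m D G \<longleftrightarrow> (j, w) \<in> glued_vertex G e" for j w
  proof
    assume "((i, mark G (lab D e)), (j, w)) \<in> glue_rel m D G"
    then consider "j = i" "w = mark G (lab D e)"
      | e' where "e' \<in> hedges D" "i \<in> members D e'" "j \<in> members D e'" "mark G (lab D e) = mark G (lab D e')" "w = mark G (lab D e)"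
      unfolding glue_rel_iff by blast
    then show "(j, w) \<in> glued_vertex G e"
    proof cases
      case 1
      then show ?thesis using assms unfolding glued_vertex_def by simp
    next
      case 2
      then have "e = e'" using gluing_edge_unique[OF data G assms(1) 2(1) assms(2)] by blast
      then show ?thesis using 2 unfolding glued_vertex_def by simp
    qed
  next
    assume "(j, w) \<in> glued_vertex G e"
    then show "((i, mark G (lab D e)), (j, w)) \<in> glue_rel m D G"
      using assms unfolding glue_rel_iff glued_vertex_def by auto
  qed
  then show ?thesis by auto
qed

lemma inj_glued_vertex: "inj_on (glued_vertex G) (hedges D)"
proof (rule inj_onI)
  fix e e' assume e: "e \<in> hedges D" "e' \<in> hedges D" and eq: "glued_vertex G e = glued_vertex G e'"
  obtain i where "i \<in> members D e" using members_ne[OF e(1)] by blast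
  then have "(i, mark G (lab D e)) \<in> glued_vertex G e" unfolding glued_vertex_def by simp
  then have "(i, mark G (lab D e)) \<in> glued_vertex G e'" unfolding eq .
  then show "e = e'"
    using gluing_edge_unique[OF data G e \<open>i \<in> members D e\<close>] unfolding glued_vertex_def by auto
qed

lemma singleton_not_glued: "v \<in> unmarked \<Longrightarrow> e \<in> hedges D \<Longrightarrow> {(i, v)} \<noteq> glued_vertex G e"
  using lab_in unfolding glued_vertex_def by blast

lemma verts_recursion:
  "verts (graph_recursion m D G) = assemble G (hedges D) (\<lambda>_. unmarked)"
proof -
  have "verts (graph_recursion m D G) = (\<lambda>(i, v). vertex_class i v) ` ({1..m} \<times> verts G)"
    unfolding graph_recursion_def quotient_def by auto
  also have "{1..m} \<times> verts G = ({1..m} \<times> unmarked) \<union> {1..m} \<times> mark G ` {1..k}"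
    using marked_graphsD(4)[OF G] by blast
  also have "(\<lambda>(i, v). vertex_class i v) ` (({1..m} \<times> unmarked) \<union> {1..m} \<times> mark G ` {1..k})
     = (\<lambda>p. {p}) ` ({1..m} \<times> unmarked) \<union> glued_vertex G ` hedges D"
  proof -
    have "(\<lambda>(i, v). vertex_class i v) ` ({1..m} \<times> unmarked) = (\<lambda>p. {p}) ` ({1..m} \<times> unmarked)"
    proof (rule image_cong[OF refl])
      fix p assume p: "p \<in> {1..m} \<times> unmarked"
      then show "(case p of (i, v) \<Rightarrow> vertex_class i v) = {p}"
        using vertex_class_unmarked[of "fst p" "snd p"] by (simp add: mem_Times_iff split_beta)
    qed
    moreover have "(\<lambda>(i, v). vertex_class i v) ` ({1..m} \<times> mark G ` {1..k}) = glued_vertex G ` hedges D"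
    proof (intro equalityI subsetI)
      fix y assume "y \<in> (\<lambda>(i, v). vertex_class i v) ` ({1..m} \<times> mark G ` {1..k})"
      then obtain i j where ij: "i \<in> {1..m}" "j \<in> {1..k}" "y = vertex_class i (mark G j)" by auto
      obtain e where "e \<in> hedges D" "lab D e = j" "i \<in> members D e" using edge_through_exists[OF ij(2,1)] by blast
      then show "y \<in> glued_vertex G ` hedges D" using vertex_class_marked ij(3) by blast
    next
      fix y assume "y \<in> glued_vertex G ` hedges D"
      then obtain e where e: "e \<in> hedges D" "y = glued_vertex G e" by blast
      obtain i where i: "i \<in> members D e" using members_ne[OF e(1)] by blast
      have "(i, mark G (lab D e)) \<in> {1..m} \<times> mark G ` {1..k}" using i e members_sub lab_in by blast
      then show "y \<in> (\<lambda>(i, v). vertex_class i v) ` ({1..m} \<times> mark G ` {1..k})"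
        using vertex_class_marked[OF e(1) i] e(2) by force
    qed
    ultimately show ?thesis by (simp add: image_Un)
  qed
  finally show ?thesis unfolding assemble_def by simp
qed

lemma edges_recursion:
  "f \<in># edges (graph_recursion m D G) \<longleftrightarrow> (\<exists>i\<in>{1..m}. \<exists>e. e \<in># edges G \<and> f = vertex_class i ` e)"
  unfolding graph_recursion_def by (auto simp: set_mset_sum)

lemma mark_recursion: "mark (graph_recursion m D G) j = glued_vertex G (Phi D j)"
  unfolding graph_recursion_def glued_vertex_def by simp

lemma glued_vertex_in_assemble:
  assumes "S \<subseteq> hedges D" "\<And>i. i \<in> {1..m} \<Longrightarrow> K i \<subseteq> unmarked" "e \<in> hedges D"
  shows "(glued_vertex G e \<in> assemble G S K) = (e \<in> S)"
proof -
  have "glued_vertex G e \<notin> (\<lambda>p. {p}) ` (SIGMA i:{1..m}. K i)"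
    using singleton_not_glued[OF _ assms(3)] assms(2) by fastforce
  then show ?thesis unfolding assemble_def using inj_on_image_mem_iff[OF inj_glued_vertex assms(3,1)] by blast
qed

lemma singleton_in_assemble:
  assumes "S \<subseteq> hedges D" "v \<in> unmarked" "i \<in> {1..m}"
  shows "{(i, v)} \<in> assemble G S K \<longleftrightarrow> v \<in> K i"
  unfolding assemble_def using singleton_not_glued[OF assms(2)] assms by blast

lemma vertex_class_in_assemble:
  assumes S: "S \<subseteq> hedges D" and K: "\<And>i. i \<in> {1..m} \<Longrightarrow> K i \<subseteq> unmarked" and i: "i \<in> {1..m}" and v: "v \<in> verts G"
  shows "vertex_class i v \<in> assemble G S K \<longleftrightarrow> v \<in> K i \<union> mark G ` attached i S"
proof (cases "v \<in> mark G ` {1..k}")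
  case False
  then have v': "v \<in> unmarked" using v by blast
  have "v \<notin> mark G ` attached i S" using False attached_sub[OF S] by blast
  then show ?thesis using vertex_class_unmarked[OF i v'] singleton_in_assemble[OF S v' i] by simp
next
  case True
  then obtain j where j: "j \<in> {1..k}" "v = mark G j" by blast
  obtain e where e: "e \<in> hedges D" "lab D e = j" "i \<in> members D e" using edge_through_exists[OF j(1) i] by blast
  have "v \<notin> K i" using True K[OF i] by blast
  moreover have "v \<in> mark G ` attached i S \<longleftrightarrow> j \<in> attached i S"
    unfolding j(2) by (rule inj_on_image_mem_iff[OF marked_graphsD(5)[OF G] j(1) attached_sub[OF S]])
  moreover have "j \<in> attached i S \<longleftrightarrow> e \<in> S"
    unfolding attached_def using e S edge_through_unique by blast
  ultimately show ?thesis
    using vertex_class_marked[OF e(1,3)] glued_vertex_in_assemble[of S K, OF S K e(1)] e(2) j(2) by simp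
qed

text \<open>Every edge of the glued graph comes from one copy, so independence is tested copy by copy.\<close>

lemma indep_assemble:
  assumes S: "S \<subseteq> hedges D" and K: "\<And>i. i \<in> {1..m} \<Longrightarrow> K i \<subseteq> unmarked"
  shows "assemble G S K \<in> indep_sets (graph_recursion m D G)
     \<longleftrightarrow> (\<forall>i\<in>{1..m}. K i \<union> mark G ` attached i S \<in> indep_sets G)"
proof -
  have 1: "assemble G S K \<subseteq> verts (graph_recursion m D G)"
    unfolding verts_recursion assemble_def using S K by blast
  have 2: "K i \<union> mark G ` attached i S \<subseteq> verts G" if "i \<in> {1..m}" for i
    using K[OF that] attached_sub[OF S] marked_graphsD(4)[OF G] by blast
  have "vertex_class i ` e \<subseteq> assemble G S K \<longleftrightarrow> e \<subseteq> K i \<union> mark G ` attached i S"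
    if i: "i \<in> {1..m}" and e: "e \<in># edges G" for i e
  proof -
    have "vertex_class i v \<in> assemble G S K \<longleftrightarrow> v \<in> K i \<union> mark G ` attached i S" if "v \<in> e" for v
      using marked_graphsD(2)[OF G e] that by (intro vertex_class_in_assemble[OF S K i]) auto
    then show ?thesis by auto
  qed
  then have "(\<forall>i\<in>{1..m}. \<forall>e\<in>#edges G. \<not> vertex_class i ` e \<subseteq> assemble G S K)
      \<longleftrightarrow> (\<forall>i\<in>{1..m}. \<forall>e\<in>#edges G. \<not> e \<subseteq> K i \<union> mark G ` attached i S)"
    by (intro ball_cong refl) simp
  moreover have "(\<forall>f\<in>#edges (graph_recursion m D G). \<not> f \<subseteq> assemble G S K)
      \<longleftrightarrow> (\<forall>i\<in>{1..m}. \<forall>e\<in>#edges G. \<not> vertex_class i ` e \<subseteq> assemble G S K)"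
    unfolding Ball_def edges_recursion by blast
  ultimately show ?thesis
    unfolding indep_sets_def mem_Collect_eq using 1 2 by (metis (no_types, lifting))
qed

lemma card_assemble:
  assumes S: "S \<subseteq> hedges D" and K: "\<And>i. i \<in> {1..m} \<Longrightarrow> K i \<subseteq> unmarked"
  shows "card (assemble G S K) = card S + (\<Sum>i\<in>{1..m}. card (K i))"
proof -
  have finK: "finite (K i)" if "i \<in> {1..m}" for i
    using K[OF that] marked_graphsD(1)[OF G] finite_subset by blast
  have "card (assemble G S K) = card ((\<lambda>p. {p}) ` (SIGMA i:{1..m}. K i)) + card (glued_vertex G ` S)"
    unfolding assemble_def
  proof (rule card_Un_disjoint)
    show "(\<lambda>p. {p}) ` (SIGMA i:{1..m}. K i) \<inter> glued_vertex G ` S = {}"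
      using singleton_not_glued K S by fastforce
  qed (use finK finite_subset[OF S finite_hedges] in \<open>auto intro!: finite_SigmaI\<close>)
  also have "card (glued_vertex G ` S) = card S" by (rule card_image[OF inj_on_subset[OF inj_glued_vertex S]])
  also have "card ((\<lambda>p. {p}) ` (SIGMA i:{1..m}. K i)) = (\<Sum>i\<in>{1..m}. card (K i))"
    using finK by (subst card_image) (auto simp: card_SigmaI)
  finally show ?thesis by simp
qed

text \<open>Expanding the product of sums in \<open>transfer\<close> gives a sum over families of vertex sets, one for each
  copy and compatible with the states of the hyperedges; \<open>assemble\<close> identifies these with the unmarked parts in
  the glued graph.\<close>

lemma marked_weight_recursion:
  assumes Y: "Y \<subseteq> {1..k}"
  shows "marked_weight k (graph_recursion m D G) x Y = transfer x (marked_weight k G x) Y"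
proof -
  let ?R = "graph_recursion m D G"
  let ?S = "\<lambda>T. T \<union> Phi D ` Y"
  let ?U = "\<lambda>T i. unmarked_parts k G (attached i (?S T))"
  let ?A = "SIGMA T:Pow inner_edges. PiE {1..m} (?U T)"
  have "transfer x (marked_weight k G x) Y = (\<Sum>T\<in>Pow inner_edges. \<Sum>K\<in>PiE {1..m} (?U T). x ^ card T * (\<Prod>i\<in>{1..m}. x ^ card (K i)))"
    unfolding transfer_def marked_weight_def
    by (subst prod_sum_PiE) (auto simp: finite_unmarked_parts[OF G] sum_distrib_left)
  also have "\<dots> = (\<Sum>(T, K)\<in>?A. x ^ card T * (\<Prod>i\<in>{1..m}. x ^ card (K i)))"
    by (subst sum.Sigma) (auto simp: finite_inner_edges finite_unmarked_parts[OF G] intro!: finite_PiE)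
  also have "\<dots> = (\<Sum>L\<in>unmarked_parts k ?R Y. x ^ card L)"
  proof (rule sum.reindex_bij_witness[where j = "\<lambda>(T, K). assemble G T K"
        and i = "\<lambda>L. ({e \<in> inner_edges. glued_vertex G e \<in> L}, \<lambda>i\<in>{1..m}. {v \<in> unmarked. {(i, v)} \<in> L})"])
    fix a assume a: "a \<in> ?A"
    obtain T K where [simp]: "a = (T, K)" by (cases a)
    have T: "T \<subseteq> inner_edges" and K: "K \<in> PiE {1..m} (?U T)" using a by auto
    have Th: "T \<subseteq> hedges D" and Sh: "?S T \<subseteq> hedges D" using T inner_edges_sub boundary_sub[OF Y T] by auto
    have Ki: "K i \<subseteq> unmarked" "K i \<union> mark G ` attached i (?S T) \<in> indep_sets G" if "i \<in> {1..m}" for i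
      using PiE_mem[OF K that] unfolding unmarked_parts_def by auto
    have "{e \<in> inner_edges. glued_vertex G e \<in> assemble G T K} = T"
      using glued_vertex_in_assemble[of T K, OF Th Ki(1)] inner_edges_sub T by blast
    moreover have "(\<lambda>i\<in>{1..m}. {v \<in> unmarked. {(i, v)} \<in> assemble G T K}) = K"
    proof (rule PiE_ext[of _ "{1..m}" "\<lambda>_. UNIV"])
      fix i assume i: "i \<in> {1..m}"
      show "(\<lambda>i\<in>{1..m}. {v \<in> unmarked. {(i, v)} \<in> assemble G T K}) i = K i"
        using singleton_in_assemble[OF Th _ i] Ki(1)[OF i] i by auto
    qed (use K in auto)
    ultimately show "({e \<in> inner_edges. glued_vertex G e \<in> (case a of (T, K) \<Rightarrow> assemble G T K)},
        \<lambda>i\<in>{1..m}. {v \<in> unmarked. {(i, v)} \<in> (case a of (T, K) \<Rightarrow> assemble G T K)}) = a" by simp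
    have "assemble G T K \<union> mark ?R ` Y = assemble G (?S T) K"
      unfolding assemble_def mark_recursion by (auto simp: image_Un image_image)
    then have "assemble G T K \<union> mark ?R ` Y \<in> indep_sets ?R"
      using indep_assemble[of "?S T" K, OF Sh Ki(1)] Ki(2) by simp
    moreover have "assemble G T K \<subseteq> verts ?R - mark ?R ` {1..k}"
    proof -
      have "glued_vertex G (Phi D j) \<notin> assemble G T K" if "j \<in> {1..k}" for j
        using glued_vertex_in_assemble[of T K, OF Th Ki(1) Phi_in[OF that]] T that unfolding inner_edges_def by blast
      moreover have "assemble G T K \<subseteq> verts ?R"
        unfolding verts_recursion assemble_def using Th Ki(1) by blast
      ultimately show ?thesis unfolding mark_recursion by blast
    qed
    ultimately show "(case a of (T, K) \<Rightarrow> assemble G T K) \<in> unmarked_parts k ?R Y"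
      unfolding unmarked_parts_def by simp
    show "x ^ card (case a of (T, K) \<Rightarrow> assemble G T K) = (case a of (T, K) \<Rightarrow> x ^ card T * (\<Prod>i\<in>{1..m}. x ^ card (K i)))"
      using card_assemble[of T K, OF Th Ki(1)] by (simp add: power_add power_sum)
  next
    fix L assume L: "L \<in> unmarked_parts k ?R Y"
    define T where "T = {e \<in> inner_edges. glued_vertex G e \<in> L}"
    define K where "K = (\<lambda>i\<in>{1..m}. {v \<in> unmarked. {(i, v)} \<in> L})"
    have T: "T \<subseteq> inner_edges" unfolding T_def by blast
    have Ki: "K i \<subseteq> unmarked" if "i \<in> {1..m}" for i using that unfolding K_def by auto
    have Lsub: "L \<subseteq> verts ?R - mark ?R ` {1..k}" and ind: "L \<union> mark ?R ` Y \<in> indep_sets ?R"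
      using L unfolding unmarked_parts_def by auto
    have asm: "assemble G T K = L"
    proof
      show "assemble G T K \<subseteq> L" unfolding assemble_def T_def K_def by auto
      show "L \<subseteq> assemble G T K"
      proof
        fix y assume y: "y \<in> L"
        then have "y \<in> assemble G (hedges D) (\<lambda>_. unmarked)" and nm: "y \<notin> mark ?R ` {1..k}"
          using Lsub unfolding verts_recursion by auto
        then consider i v where "i \<in> {1..m}" "v \<in> unmarked" "y = {(i, v)}" | e where "e \<in> hedges D" "y = glued_vertex G e"
          unfolding assemble_def by blast
        then show "y \<in> assemble G T K"
        proof cases
          case 1
          then show ?thesis using y unfolding assemble_def K_def by auto
        next
          case 2
          then have "e \<in> inner_edges" using nm unfolding inner_edges_def mark_recursion by blast
          then show ?thesis using y 2 unfolding assemble_def T_def by blast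
        qed
      qed
    qed
    have Sh: "?S T \<subseteq> hedges D" using boundary_sub[OF Y T] .
    have "L \<union> mark ?R ` Y = assemble G (?S T) K"
      unfolding asm[symmetric] assemble_def mark_recursion by (auto simp: image_Un image_image)
    then have "K i \<union> mark G ` attached i (?S T) \<in> indep_sets G" if "i \<in> {1..m}" for i
      using ind indep_assemble[of "?S T" K, OF Sh Ki] that by simp
    then have "K i \<in> ?U T i" if "i \<in> {1..m}" for i
      using Ki that unfolding unmarked_parts_def by blast
    moreover have "K i = undefined" if "i \<notin> {1..m}" for i
      using that unfolding K_def by (rule restrict_apply[THEN trans, OF if_not_P])
    ultimately have "K \<in> PiE {1..m} (?U T)" by (rule PiE_I)
    then show "({e \<in> inner_edges. glued_vertex G e \<in> L}, \<lambda>i\<in>{1..m}. {v \<in> unmarked. {(i, v)} \<in> L}) \<in> ?A"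
      unfolding T_def[symmetric] K_def[symmetric] using T by blast
    show "(case ({e \<in> inner_edges. glued_vertex G e \<in> L}, \<lambda>i\<in>{1..m}. {v \<in> unmarked. {(i, v)} \<in> L}) of (T, K) \<Rightarrow> assemble G T K) = L"
      unfolding T_def[symmetric] K_def[symmetric] using asm by simp
  qed
  finally show ?thesis unfolding marked_weight_def by simp
qed

end

end

lemma marked_graphs_iso:
  assumes iso: "marked_graph_iso k G G'" and G: "G \<in> marked_graphs k"
  shows "G' \<in> marked_graphs k"
proof -
  note g = marked_graphsD[OF G]
  obtain f where f: "bij_betw f (verts G) (verts G')" "edges G' = image_mset (image f) (edges G)"
    "\<And>j. j \<in> {1..k} \<Longrightarrow> mark G' j = f (mark G j)"
    using iso unfolding marked_graph_iso_def by blast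
  have inj: "inj_on f (verts G)" and im: "f ` verts G = verts G'" using f(1) unfolding bij_betw_def by auto
  have "e \<subseteq> verts G' \<and> card e = 2" if "e \<in># edges G'" for e
  proof -
    obtain e' where e': "e' \<in># edges G" "e = f ` e'" using \<open>e \<in># edges G'\<close> unfolding f(2) by auto
    then show ?thesis using card_image[OF inj_on_subset[OF inj g(2)[OF e'(1)]]] g(2,3)[OF e'(1)] im by auto
  qed
  moreover have "finite (verts G')" using g(1) im by (metis finite_imageI)
  moreover have "mark G' ` {1..k} \<subseteq> verts G'" using f(3) g(4) im by auto
  moreover have "inj_on (mark G') {1..k}"
  proof (rule inj_onI)
    fix i j assume ij: "i \<in> {1..k}" "j \<in> {1..k}" "mark G' i = mark G' j"
    then have "f (mark G i) = f (mark G j)" using f(3) by simp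
    then have "mark G i = mark G j" by (rule inj_onD[OF inj]) (use g(4) ij in blast)+
    then show "i = j" by (rule inj_onD[OF g(5)]) (use ij in blast)+
  qed
  ultimately show ?thesis unfolding marked_graphs_def by auto
qed

section \<open>Maximally independent graphs\<close>

text \<open>Removing the \<open>k\<close> marked vertices from the largest set \<open>I1\<close> that contains all of them leaves, by the
  cardinality condition, a set of the size of the largest set \<open>I0\<close> that avoids them; by uniqueness \<open>I1\<close> is
  \<open>I0\<close> together with the marks. So \<open>I0\<close> is the largest unmarked part for every \<open>X\<close>, and since the marks are
  independent, the empty set is an unmarked part as well.\<close>

lemma maximally_independent_structure:
  assumes mi: "maximally_independent k G"
  obtains K0 where "\<And>X. X \<subseteq> {1..k} \<Longrightarrow> K0 \<in> unmarked_parts k G X"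
    "\<And>X K. X \<subseteq> {1..k} \<Longrightarrow> K \<in> unmarked_parts k G X \<Longrightarrow> K \<noteq> K0 \<Longrightarrow> card K < card K0"
    "\<And>X. X \<subseteq> {1..k} \<Longrightarrow> {} \<in> unmarked_parts k G X"
proof -
  have G: "G \<in> marked_graphs k"
    and ex: "\<And>x. x \<in> {1..k} \<rightarrow> {0, 1} \<Longrightarrow> \<exists>!I. largest_indep k G x I"
    and cd: "int (card (THE I. largest_indep k G (\<lambda>_. 1) I)) - int (card (THE I. largest_indep k G (\<lambda>_. 0) I)) = int k"
    using mi unfolding maximally_independent_def by auto
  note g = marked_graphsD[OF G]
  let ?P = "mark G ` {1..k}"
  define I0 I1 where "I0 = (THE I. largest_indep k G (\<lambda>_. 0) I)" and "I1 = (THE I. largest_indep k G (\<lambda>_. 1) I)"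
  have ex0: "\<exists>!I. largest_indep k G (\<lambda>_. 0) I" and ex1: "\<exists>!I. largest_indep k G (\<lambda>_. 1) I"
    by (rule ex, simp)+
  have I0: "largest_indep k G (\<lambda>_. 0) I0" unfolding I0_def by (rule theI'[OF ex0])
  have I1: "largest_indep k G (\<lambda>_. 1) I1" unfolding I1_def by (rule theI'[OF ex1])
  have uniq: "J = I0" if "largest_indep k G (\<lambda>_. 0) J" for J using ex0 I0 that by blast
  have sub: "J \<in> indep_sets G" if "J \<subseteq> I" "I \<in> indep_sets G" for I J
    using that unfolding indep_sets_def by blast
  have P1: "?P \<subseteq> I1" and I1i: "I1 \<in> indep_sets G" using I1 unfolding largest_indep_def agrees_def by auto
  have fin: "finite I" if "I \<in> indep_sets G" for I using that g(1) finite_subset unfolding indep_sets_def by blast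
  have "card ?P = k" using card_image[OF g(5)] by simp
  then have "card (I1 - ?P) = card I1 - k" using card_Diff_subset[OF _ P1] by simp
  then have card0: "card (I1 - ?P) = card I0" using cd unfolding I0_def[symmetric] I1_def[symmetric] by linarith
  have "largest_indep k G (\<lambda>_. 0) (I1 - ?P)"
    using I0 sub[OF _ I1i, of "I1 - ?P"] card0 unfolding largest_indep_def agrees_def by auto
  then have I01: "I0 = I1 - ?P" using uniq by blast
  have "I0 \<in> unmarked_parts k G X" if "X \<subseteq> {1..k}" for X
  proof -
    have "I0 \<union> mark G ` X \<subseteq> I1" using P1 that unfolding I01 by blast
    moreover have "I0 \<subseteq> verts G - ?P" using I1i unfolding I01 indep_sets_def by blast
    ultimately show ?thesis unfolding unmarked_parts_def using sub I1i by blast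
  qed
  moreover have "card K < card I0" if "X \<subseteq> {1..k}" "K \<in> unmarked_parts k G X" "K \<noteq> I0" for X K
  proof -
    have K: "K \<in> indep_sets G" "agrees k G K (\<lambda>_. 0)"
      using that(2) sub[of K "K \<union> mark G ` X"] unfolding unmarked_parts_def agrees_def by auto
    then have "card K \<le> card I0" using I0 unfolding largest_indep_def by blast
    moreover have "card K \<noteq> card I0"
    proof
      assume "card K = card I0"
      then have "largest_indep k G (\<lambda>_. 0) K" using K I0 unfolding largest_indep_def by simp
      then show False using uniq that(3) by blast
    qed
    ultimately show ?thesis by simp
  qed
  moreover have "{} \<in> unmarked_parts k G X" if "X \<subseteq> {1..k}" for X
    using P1 that sub[OF _ I1i, of "mark G ` X"] unfolding unmarked_parts_def by auto
  ultimately show thesis using that by blast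
qed

text \<open>All weights are monic polynomials of degree \<open>card K0\<close> with constant term \<open>1\<close>.\<close>

lemma maximally_independent_ratio_limits:
  assumes mi: "maximally_independent k G" and j: "j \<in> {1..k}" and X: "X \<subseteq> {1..k} - {j}"
  shows "((\<lambda>x::complex. ratio (marked_weight k G x) j X) \<longlongrightarrow> 1) at_infinity"
    "((\<lambda>x::complex. ratio (marked_weight k G x) j X) \<longlongrightarrow> 1) (nhds 0)"
proof -
  have G: "G \<in> marked_graphs k" using mi unfolding maximally_independent_def by blast
  obtain K0 where K0: "\<And>X. X \<subseteq> {1..k} \<Longrightarrow> K0 \<in> unmarked_parts k G X"
    "\<And>X K. X \<subseteq> {1..k} \<Longrightarrow> K \<in> unmarked_parts k G X \<Longrightarrow> K \<noteq> K0 \<Longrightarrow> card K < card K0"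
    "\<And>X. X \<subseteq> {1..k} \<Longrightarrow> {} \<in> unmarked_parts k G X"
    using maximally_independent_structure[OF mi] by blast
  have finU: "finite (unmarked_parts k G X)" for X by (rule finite_unmarked_parts[OF G])
  have finK: "finite K" if "K \<in> unmarked_parts k G X" for K X
    using that marked_graphsD(1)[OF G] finite_subset unfolding unmarked_parts_def by blast
  have inf: "((\<lambda>x::complex. marked_weight k G x X / x ^ card K0) \<longlongrightarrow> 1) at_infinity" if X: "X \<subseteq> {1..k}" for X
  proof -
    have "((\<lambda>x::complex. \<Sum>K\<in>unmarked_parts k G X. x ^ card K / x ^ card K0)
        \<longlongrightarrow> (\<Sum>K\<in>unmarked_parts k G X. if K = K0 then 1 else 0)) at_infinity"
    proof (rule tendsto_sum)
      fix K assume K: "K \<in> unmarked_parts k G X"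
      have nz: "\<forall>\<^sub>F x::complex in at_infinity. x \<noteq> 0"
        unfolding eventually_at_infinity by (rule exI[of _ 1]) auto
      show "((\<lambda>x::complex. x ^ card K / x ^ card K0) \<longlongrightarrow> (if K = K0 then 1 else 0)) at_infinity"
      proof (cases "K = K0")
        case True
        have "((\<lambda>x::complex. x ^ card K / x ^ card K0) \<longlongrightarrow> 1) at_infinity \<longleftrightarrow> ((\<lambda>x::complex. 1::complex) \<longlongrightarrow> 1) at_infinity"
          by (rule tendsto_cong, use nz in eventually_elim) (use True in auto)
        then show ?thesis using True by simp
      next
        case False
        define c where "c = card K0 - card K"
        have c: "c > 0" "card K0 = card K + c" unfolding c_def using K0(2)[OF X K False] by auto
        have "((\<lambda>x::complex. inverse x ^ c) \<longlongrightarrow> 0 ^ c) at_infinity"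
          by (intro tendsto_power tendsto_inverse_0)
        moreover have "((\<lambda>x::complex. x ^ card K / x ^ card K0) \<longlongrightarrow> 0) at_infinity \<longleftrightarrow> ((\<lambda>x::complex. inverse x ^ c) \<longlongrightarrow> 0) at_infinity"
          by (rule tendsto_cong, use nz in eventually_elim) (auto simp: c(2) power_add field_simps)
        ultimately show ?thesis using False c(1) by (simp add: zero_power)
      qed
    qed
    then show ?thesis unfolding marked_weight_def sum_divide_distrib using K0(1)[OF X] finU by simp
  qed
  have zero: "((\<lambda>x::complex. marked_weight k G x X) \<longlongrightarrow> 1) (nhds 0)" if X: "X \<subseteq> {1..k}" for X
  proof -
    have "((\<lambda>x::complex. marked_weight k G x X) \<longlongrightarrow> (\<Sum>K\<in>unmarked_parts k G X. 0 ^ card K)) (nhds 0)"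
      unfolding marked_weight_def by (intro tendsto_intros filterlim_ident)
    moreover have "(\<Sum>K\<in>unmarked_parts k G X. (0::complex) ^ card K) = (\<Sum>K\<in>unmarked_parts k G X. if K = {} then 1 else 0)"
      by (rule sum.cong) (auto simp: finK card_gt_0_iff zero_power)
    ultimately show ?thesis using K0(3)[OF X] finU by simp
  qed
  have Xs: "X \<subseteq> {1..k}" "insert j X \<subseteq> {1..k}" using j X by auto
  have "((\<lambda>x::complex. (marked_weight k G x (insert j X) / x ^ card K0) / (marked_weight k G x X / x ^ card K0)) \<longlongrightarrow> 1 / 1) at_infinity"
    by (intro tendsto_divide inf Xs) auto
  moreover have "\<forall>\<^sub>F x::complex in at_infinity. (marked_weight k G x (insert j X) / x ^ card K0) / (marked_weight k G x X / x ^ card K0) = ratio (marked_weight k G x) j X"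
    unfolding eventually_at_infinity ratio_def by (rule exI[of _ 1]) auto
  ultimately show "((\<lambda>x::complex. ratio (marked_weight k G x) j X) \<longlongrightarrow> 1) at_infinity"
    using tendsto_cong by fastforce
  show "((\<lambda>x::complex. ratio (marked_weight k G x) j X) \<longlongrightarrow> 1) (nhds 0)"
    unfolding ratio_def using tendsto_divide[OF zero[OF Xs(2)] zero[OF Xs(1)]] by simp
qed

lemma maximally_independent_weight_pos:
  assumes "maximally_independent k G" "X \<subseteq> {1..k}" "x > (0::real)"
  shows "marked_weight k G x X > 0"
proof -
  have G: "G \<in> marked_graphs k" using assms unfolding maximally_independent_def by blast
  obtain K0 where "\<And>X. X \<subseteq> {1..k} \<Longrightarrow> K0 \<in> unmarked_parts k G X"
    using maximally_independent_structure[OF assms(1)] by blast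
  then show ?thesis unfolding marked_weight_def using assms finite_unmarked_parts[OF G]
    by (intro sum_pos) auto
qed

lemma marked_weight_of_real:
  "marked_weight k G (complex_of_real x) X = complex_of_real (marked_weight k G x X)"
  unfolding marked_weight_def by simp

lemma tendsto_marked_weight:
  "((\<lambda>x::complex. marked_weight k G x X) \<longlongrightarrow> marked_weight k G a X) (nhds a)"
  unfolding marked_weight_def by (intro tendsto_intros filterlim_ident)

section \<open>Neighbourhoods without zeros\<close>

text \<open>The hypotheses of \<open>complex_stability\<close> for activities eventually in \<open>F\<close>. Convergence of the ratios
  replaces inequalities for each activity, so that it suffices to examine the limit.\<close>

definition settled :: "nat \<Rightarrow> real \<Rightarrow> complex filter \<Rightarrow> complex set \<Rightarrow> (complex \<Rightarrow> nat set \<Rightarrow> complex) \<Rightarrow> bool" where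
  "settled k \<sigma> F A w \<longleftrightarrow>
     (\<forall>a\<in>A. \<forall>n. a ^ n \<in> A) \<and>
     (\<forall>\<^sub>F x in F. \<forall>a\<in>A. \<forall>z. near a z (1 / 2) \<longrightarrow> stable_activity (x * z)) \<and>
     (\<forall>\<^sub>F x in F. \<forall>X\<in>Pow {1..k}. w x X \<noteq> 0) \<and>
     (\<forall>j\<in>{1..k}. \<exists>p\<in>A - {0}. \<forall>X\<in>Pow (others k j). \<exists>L. near p L \<sigma> \<and> ((\<lambda>x. ratio (w x) j X) \<longlongrightarrow> L) F)"

context hypergraph_gluing
begin

context
  fixes G :: "nat \<Rightarrow> 'v marked_graph"
  assumes nd: "nondegenerate k D" and ex: "expanding k D" and mi: "maximally_independent k (G 0)"
    and iso: "\<And>n. marked_graph_iso k (graph_recursion m D (G n)) (G (Suc n))"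
begin

lemma orbit_in_marked_graphs: "G n \<in> marked_graphs k"
proof (induction n)
  case 0
  then show ?case using mi unfolding maximally_independent_def by blast
next
  case (Suc n)
  then show ?case using marked_graphs_iso[OF iso] graph_recursion_marked_graph[OF data] by blast
qed

lemma marked_weight_Suc:
  assumes "X \<subseteq> {1..k}"
  shows "marked_weight k (G (Suc n)) x X = transfer x (marked_weight k (G n) x) X"
  using marked_weight_iso[OF iso graph_recursion_marked_graph[OF data orbit_in_marked_graphs] assms]
    marked_weight_recursion[OF orbit_in_marked_graphs assms] by metis

abbreviation "zero_free_from n0 x \<equiv> \<forall>n\<ge>n0. poly (indep_poly (G n)) x \<noteq> 0"

text \<open>The sequence of weight vectors started at time \<open>n0\<close> satisfies the hypotheses of \<open>complex_stability\<close> at each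
  activity that is close enough to the limit. The threshold does not depend on \<open>n0\<close>, which is essential
  because \<open>n0\<close> is chosen in response to it.\<close>

lemma eventually_zero_free:
  obtains \<sigma> where "\<sigma> > 0"
    "\<And>F A n0. settled k \<sigma> F A (\<lambda>x. marked_weight k (G n0) x) \<Longrightarrow> \<forall>\<^sub>F x in F. zero_free_from n0 x"
proof -
  obtain \<sigma> where \<sigma>: "\<sigma> > 0" and stab: "\<And>A x W p n.
    \<forall>a\<in>A. \<forall>n. a ^ n \<in> A \<Longrightarrow>
    \<forall>a\<in>A. \<forall>z. near a z (1 / 2) \<longrightarrow> stable_activity (x * z) \<Longrightarrow>
    \<forall>n. \<forall>X\<subseteq>{1..k}. W (Suc n) X = transfer x (W n) X \<Longrightarrow>
    \<forall>X\<subseteq>{1..k}. W 0 X \<noteq> 0 \<Longrightarrow>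
    \<forall>j\<in>{1..k}. p j \<in> A \<and> (\<forall>X\<subseteq>others k j. near (p j) (ratio (W 0) j X) (\<sigma> / 2)) \<Longrightarrow>
    partition_sum k x (W n) \<noteq> (0::complex)"
    by (rule complex_stability[OF nd ex, of "1 / 2"]) (simp, rule that)
  have "\<forall>\<^sub>F x in F. zero_free_from n0 x"
    if settled: "settled k (\<sigma> / 4) F A (\<lambda>x. marked_weight k (G n0) x)" for F A n0
  proof -
    let ?w = "\<lambda>x. marked_weight k (G n0) x"
    have A: "\<forall>a\<in>A. \<forall>n. a ^ n \<in> A"
      and act: "\<forall>\<^sub>F x in F. \<forall>a\<in>A. \<forall>z. near a z (1 / 2) \<longrightarrow> stable_activity (x * z)"
      and nz: "\<forall>\<^sub>F x in F. \<forall>X\<in>Pow {1..k}. ?w x X \<noteq> 0"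
      and pL: "\<forall>j\<in>{1..k}. \<exists>p\<in>A - {0}. \<forall>X\<in>Pow (others k j). \<exists>L. near p L (\<sigma> / 4) \<and> ((\<lambda>x. ratio (?w x) j X) \<longlongrightarrow> L) F"
      using settled unfolding settled_def by blast+
    from bchoice[OF pL[unfolded Bex_def]] obtain p where p: "\<And>j. j \<in> {1..k} \<Longrightarrow> p j \<in> A - {0}"
      "\<And>j X. j \<in> {1..k} \<Longrightarrow> X \<in> Pow (others k j) \<Longrightarrow> \<exists>L. near (p j) L (\<sigma> / 4) \<and> ((\<lambda>x. ratio (?w x) j X) \<longlongrightarrow> L) F"
      by blast
    have "\<forall>\<^sub>F x in F. \<forall>j\<in>{1..k}. \<forall>X\<in>Pow (others k j). near (p j) (ratio (?w x) j X) (\<sigma> / 2)"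
    proof (intro eventually_ball_finite ballI)
      fix j X assume j: "j \<in> {1..k}" and X: "X \<in> Pow (others k j)"
      obtain L where L: "near (p j) L (\<sigma> / 4)" "((\<lambda>x. ratio (?w x) j X) \<longlongrightarrow> L) F" using p(2)[OF j X] by blast
      have "L \<noteq> 0" using near_nonzero[OF L(1)] p(1)[OF j] by simp
      then have "\<forall>\<^sub>F x in F. near L (ratio (?w x) j X) (\<sigma> / 4)"
        using \<sigma> by (intro tendsto_imp_eventually_near[OF L(2)]) auto
      then show "\<forall>\<^sub>F x in F. near (p j) (ratio (?w x) j X) (\<sigma> / 2)"
      proof eventually_elim
        case (elim x)
        show ?case using near_trans[OF L(1) elim] by simp
      qed
    qed auto
    with act nz show "\<forall>\<^sub>F x in F. zero_free_from n0 x"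
    proof eventually_elim
      case (elim x)
      show ?case
      proof (intro allI impI)
        fix n assume "n \<ge> n0"
        then obtain i where i: "n = n0 + i" using le_Suc_ex by blast
        have "partition_sum k x (marked_weight k (G (n0 + i)) x) \<noteq> 0"
        proof (rule stab[OF A elim(1), of "\<lambda>i. marked_weight k (G (n0 + i)) x" p i])
          show "\<forall>n. \<forall>X\<subseteq>{1..k}. marked_weight k (G (n0 + Suc n)) x X = transfer x (marked_weight k (G (n0 + n)) x) X"
            unfolding add_Suc_right by (intro allI impI marked_weight_Suc)
          show "\<forall>j\<in>{1..k}. p j \<in> A \<and> (\<forall>X\<subseteq>others k j. near (p j) (ratio (marked_weight k (G (n0 + 0)) x) j X) (\<sigma> / 2))"
            using elim(3) p(1) by auto
        qed (use elim(2) in auto)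
        then show "poly (indep_poly (G n)) x \<noteq> 0"
          unfolding i indep_poly_eq_partition_sum[OF orbit_in_marked_graphs] .
      qed
    qed
  qed
  then show thesis using that[of "\<sigma> / 4"] \<sigma> by simp
qed

text \<open>At both ends of the positive axis the ratios tend to \<open>1\<close>, and activities are small or large.\<close>

lemma zero_free_limit:
  assumes F: "F = at_infinity \<or> F = nhds 0"
  shows "\<forall>\<^sub>F x in F. zero_free_from 0 x"
proof -
  obtain \<sigma> where \<sigma>: "\<sigma> > 0"
    and Z: "\<And>F A n0. settled k \<sigma> F A (\<lambda>x. marked_weight k (G n0) x) \<Longrightarrow> \<forall>\<^sub>F x in F. zero_free_from n0 x"
    by (rule eventually_zero_free) blast
  have lim: "((\<lambda>x. ratio (marked_weight k (G 0) x) j X) \<longlongrightarrow> 1) F" if "j \<in> {1..k}" "X \<subseteq> others k j" for j X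
    using maximally_independent_ratio_limits[OF mi that] F by auto
  have act: "\<forall>\<^sub>F x in F. \<forall>a\<in>{1}. \<forall>z. near a z (1 / 2) \<longrightarrow> stable_activity (x * z)"
  proof (cases "F = at_infinity")
    case True
    have "\<forall>a\<in>{1}. \<forall>z. near a z (1 / 2) \<longrightarrow> stable_activity (x * z)" if "cmod x \<ge> 4" for x
    proof (intro ballI allI impI stable_activity_large)
      fix a z :: complex assume "a \<in> {1}" "near a z (1 / 2)"
      then have "1 / 2 \<le> cmod z" using near_one_norm by simp
      then show "2 \<le> cmod (x * z)" using that mult_mono[of 4 "cmod x" "1/2" "cmod z"] by (simp add: norm_mult)
    qed
    then show ?thesis unfolding True eventually_at_infinity by blast
  next
    case False
    have "\<forall>a\<in>{1}. \<forall>z. near a z (1 / 2) \<longrightarrow> stable_activity (x * z)" if "dist x 0 < 1 / 4" for x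
    proof (intro ballI allI impI stable_activity_small)
      fix a z :: complex assume "a \<in> {1}" "near a z (1 / 2)"
      then have "cmod z \<le> 2" using near_one_norm by simp
      then show "cmod (x * z) \<le> 1 / 2" using that mult_mono[of "cmod x" "1 / 4" "cmod z" 2] by (simp add: norm_mult)
    qed
    then have "\<forall>\<^sub>F x in nhds 0. \<forall>a\<in>{1}. \<forall>z. near a z (1 / 2) \<longrightarrow> stable_activity (x * z)"
      unfolding eventually_nhds_metric by (intro exI[of _ "1 / 4"]) auto
    then show ?thesis using False F by auto
  qed
  have nz: "\<forall>\<^sub>F x in F. \<forall>X\<in>Pow {1..k}. marked_weight k (G 0) x X \<noteq> 0"
  proof (intro eventually_ball_finite ballI)
    fix X assume X: "X \<in> Pow {1..k}"
    (* a vanishing total_share would make an adjacent ratio zero, but the ratios tend to 1 *)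
    show "\<forall>\<^sub>F x in F. marked_weight k (G 0) x X \<noteq> 0"
    proof (cases "X = {}")
      case True
      have "((\<lambda>x. ratio (marked_weight k (G 0) x) 1 {}) \<longlongrightarrow> 1) F" using lim[of 1 "{}"] k1 by auto
      then have "\<forall>\<^sub>F x in F. ratio (marked_weight k (G 0) x) 1 {} \<noteq> 0" by (rule tendsto_imp_eventually_ne) simp
      then show ?thesis by eventually_elim (auto simp: ratio_def True)
    next
      case False
      then obtain j where j: "j \<in> X" by blast
      have "((\<lambda>x. ratio (marked_weight k (G 0) x) j (X - {j})) \<longlongrightarrow> 1) F" using j X by (intro lim) auto
      then have "\<forall>\<^sub>F x in F. ratio (marked_weight k (G 0) x) j (X - {j}) \<noteq> 0" by (rule tendsto_imp_eventually_ne) simp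
      then show ?thesis by eventually_elim (use j in \<open>auto simp: ratio_def insert_absorb\<close>)
    qed
  qed simp
  show ?thesis
  proof (rule Z[of F "{1}"])
    have "\<exists>p\<in>{1} - {0}. \<forall>X\<in>Pow (others k j). \<exists>L. near p L \<sigma> \<and> ((\<lambda>x. ratio (marked_weight k (G 0) x) j X) \<longlongrightarrow> L) F"
      if "j \<in> {1..k}" for j
      using lim[OF that] near_refl[of \<sigma> "1::complex"] \<sigma> by (intro bexI[of _ 1] ballI exI[of _ 1]) auto
    then show "settled k \<sigma> F {1} (\<lambda>x. marked_weight k (G 0) x)"
      unfolding settled_def using act nz by simp
  qed
qed

text \<open>Loss of memory at \<open>a\<close> settles the ratios at some time \<open>n0\<close>. The finitely many earlier polynomials are
  positive at \<open>a\<close>, and continuity suffices for them.\<close>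

lemma zero_free_near_pos:
  assumes a: "a > (0::real)"
  shows "\<forall>\<^sub>F x in nhds (complex_of_real a). zero_free_from 0 x"
proof -
  let ?F = "nhds (complex_of_real a)"
  obtain \<sigma> where \<sigma>: "\<sigma> > 0"
    and Z: "\<And>F A n0. settled k \<sigma> F A (\<lambda>x. marked_weight k (G n0) x) \<Longrightarrow> \<forall>\<^sub>F x in F. zero_free_from n0 x"
    by (rule eventually_zero_free) blast
  obtain n0 where n0: "osc k (marked_weight k (G n0) a) (others k) (\<lambda>_. \<sigma>)"
    and pos: "\<And>n X. X \<subseteq> {1..k} \<Longrightarrow> marked_weight k (G n) a X > 0"
    using real_interaction_vanishes[OF nd ex a, of "\<lambda>n. marked_weight k (G n) a" \<sigma>]
      maximally_independent_weight_pos[OF mi _ a] marked_weight_Suc \<sigma> by metis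
  let ?A = "complex_of_real ` {0<..}"
  have rat: "ratio (marked_weight k (G n0) a) j X > 0" if "j \<in> {1..k}" "X \<subseteq> others k j" for j X
    unfolding ratio_def using that by (intro divide_pos_pos pos) auto
  have 1: "\<forall>b\<in>?A. \<forall>n. b ^ n \<in> ?A" by (auto simp flip: of_real_power)
  have 2: "\<forall>\<^sub>F x in ?F. \<forall>b\<in>?A. \<forall>z. near b z (1 / 2) \<longrightarrow> stable_activity (x * z)"
  proof -
    have "\<forall>\<^sub>F x in ?F. near (complex_of_real a) x (1 / 2)"
      using tendsto_imp_eventually_near[of "\<lambda>x. x" "complex_of_real a" ?F "1 / 2"] a by (simp add: filterlim_ident)
    then show ?thesis
    proof eventually_elim
      case (elim x)
      show ?case
      proof (intro ballI allI impI)
        fix b z assume "b \<in> ?A" "near b z (1 / 2)"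
        then obtain c where "c > 0" "near (complex_of_real c) z (1 / 2)" by auto
        then show "stable_activity (x * z)"
          using near_mult[OF elim, of "of_real c" z "1 / 2"] a stable_activity_near_pos[of "a * c" "x * z" 1] by simp
      qed
    qed
  qed
  have 3: "\<forall>j\<in>{1..k}. \<exists>p\<in>?A - {0}. \<forall>X\<in>Pow (others k j). \<exists>L.
      near p L \<sigma> \<and> ((\<lambda>x. ratio (marked_weight k (G n0) x) j X) \<longlongrightarrow> L) ?F"
  proof (intro ballI bexI exI conjI)
    fix j assume j: "j \<in> {1..k}"
    show "complex_of_real (ratio (marked_weight k (G n0) a) j {}) \<in> ?A - {0}" using rat[OF j, of "{}"] by auto
    fix X assume "X \<in> Pow (others k j)"
    then have X: "X \<subseteq> others k j" by simp
    show "near (complex_of_real (ratio (marked_weight k (G n0) a) j {})) (complex_of_real (ratio (marked_weight k (G n0) a) j X)) \<sigma>"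
      by (rule near_of_real, rule oscD[OF n0 j]) (use X in auto)
    have Xk: "X \<subseteq> {1..k}" using X by blast
    show "((\<lambda>x. ratio (marked_weight k (G n0) x) j X) \<longlongrightarrow> complex_of_real (ratio (marked_weight k (G n0) a) j X)) ?F"
      unfolding ratio_def of_real_divide marked_weight_of_real[symmetric]
      by (intro tendsto_divide tendsto_marked_weight) (use pos[OF Xk, of n0] in \<open>simp add: marked_weight_of_real\<close>)
  qed
  have 4: "\<forall>\<^sub>F x in ?F. \<forall>X\<in>Pow {1..k}. marked_weight k (G n0) x X \<noteq> 0"
  proof (intro eventually_ball_finite ballI)
    fix X assume X: "X \<in> Pow {1..k}"
    show "\<forall>\<^sub>F x in ?F. marked_weight k (G n0) x X \<noteq> 0"
      using X by (intro tendsto_imp_eventually_ne[OF tendsto_marked_weight]) (use pos[of X n0] in \<open>auto simp: marked_weight_of_real\<close>)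
  qed simp
  have "\<forall>\<^sub>F x in ?F. zero_free_from n0 x"
    by (rule Z[of ?F ?A]) (unfold settled_def, intro conjI 1 2 3 4)
  moreover have "\<forall>\<^sub>F x in ?F. \<forall>n\<in>{..<n0}. poly (indep_poly (G n)) x \<noteq> 0"
  proof (intro eventually_ball_finite ballI)
    fix n
    have "partition_sum k a (marked_weight k (G n) a) > 0"
      unfolding partition_sum_def using a pos by (intro sum_pos) auto
    moreover have "poly (indep_poly (G n)) (complex_of_real a) = complex_of_real (partition_sum k a (marked_weight k (G n) a))"
      unfolding indep_poly_eq_partition_sum[OF orbit_in_marked_graphs] partition_sum_def by (simp add: marked_weight_of_real)
    ultimately have "poly (indep_poly (G n)) (complex_of_real a) \<noteq> 0" by simp
    then show "\<forall>\<^sub>F x in ?F. poly (indep_poly (G n)) x \<noteq> 0"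
      by (intro tendsto_imp_eventually_ne[of _ "poly (indep_poly (G n)) (complex_of_real a)"] tendsto_intros filterlim_ident)
  qed simp
  ultimately show ?thesis
  proof eventually_elim
    case (elim x)
    then show ?case by (metis lessThan_iff not_le)
  qed
qed

lemma zeros_bounded_and_avoid_cone:
  "\<exists>R>0. \<exists>\<theta>>0. \<forall>n. \<forall>z::complex. poly (indep_poly (G n)) z = 0 \<longrightarrow>
     cmod z \<le> R \<and>
     z \<notin> {0} \<union> {complex_of_real r * exp (\<i> * complex_of_real t) | r t. r > 0 \<and> \<bar>t\<bar> < \<theta>}"
proof -
  define U where "U = {x. zero_free_from 0 x}"
  obtain R0 where R0: "\<And>x. cmod x \<ge> R0 \<Longrightarrow> x \<in> U"
    using zero_free_limit[of at_infinity] unfolding eventually_at_infinity U_def by auto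
  define R where "R = max R0 1"
  have R: "R \<ge> 1" "\<And>x. cmod x \<ge> R \<Longrightarrow> x \<in> U" unfolding R_def using R0 by auto
  \<comment> \<open>A compact part of the axis has a zero-free neighbourhood of uniform width, which contains the part of a thin cone in the disc of radius R.\<close>
  have "complex_of_real ` {0..R} \<subseteq> interior U"
  proof
    fix y assume "y \<in> complex_of_real ` {0..R}"
    then obtain a where a: "y = complex_of_real a" "a \<ge> 0" by auto
    have "\<forall>\<^sub>F x in nhds y. x \<in> U"
      using zero_free_limit[of "nhds 0"] zero_free_near_pos[of a] a unfolding U_def by (cases "a = 0") auto
    then show "y \<in> interior U" unfolding eventually_nhds interior_def by blast
  qed
  moreover have "compact (complex_of_real ` {0..R})"
    by (intro compact_continuous_image continuous_intros compact_Icc)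
  ultimately obtain e where e: "e > 0" "(\<Union>x\<in>complex_of_real ` {0..R}. ball x e) \<subseteq> interior U"
    using compact_subset_open_imp_ball_epsilon_subset open_interior by metis
  have near_axis: "z \<in> U" if "a \<in> {0..R}" "dist (complex_of_real a) z < e" for a z
  proof -
    have "z \<in> (\<Union>x\<in>complex_of_real ` {0..R}. ball x e)" using that by auto
    then show ?thesis using e(2) interior_subset by blast
  qed
  define \<theta> where "\<theta> = min (1 / 2) (e / (2 * R))"
  have \<theta>: "\<theta> > 0" "2 * R * \<theta> \<le> e" unfolding \<theta>_def using e(1) R(1) by (auto simp: min_def field_simps)
  have cone: "complex_of_real r * exp (\<i> * complex_of_real t) \<in> U" (is "?z \<in> U") if "r > 0" "\<bar>t\<bar> < \<theta>" for r t
  proof (cases "r \<ge> R")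
    case True
    then show ?thesis using R(2)[of ?z] that by (simp add: norm_mult)
  next
    case False
    have "?z - complex_of_real r = complex_of_real r * (exp (\<i> * complex_of_real t) - 1)" by (simp add: algebra_simps)
    then have "dist (complex_of_real r) ?z = r * cmod (exp (\<i> * complex_of_real t) - 1)"
      using that by (simp add: dist_norm norm_minus_commute[of "complex_of_real r"] norm_mult)
    also have "\<dots> \<le> r * (2 * \<bar>t\<bar>)"
      using that \<theta>_def exp_minus_one_bound(1)[of "\<i> * complex_of_real t" "\<bar>t\<bar>"]
      by (intro mult_left_mono) (auto simp: norm_mult)
    also have "\<dots> < R * (2 * \<theta>)" using that False R(1) by (intro mult_strict_mono[of r R "2 * \<bar>t\<bar>" "2 * \<theta>"]) auto
    also have "\<dots> \<le> e" using \<theta>(2) by (simp add: mult_ac)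
    finally have d: "dist (complex_of_real r) ?z < e" .
    show ?thesis by (rule near_axis[OF _ d]) (use that False in auto)
  qed
  have zero: "0 \<in> U" using near_axis[of 0 0] R(1) e(1) by simp
  have "cmod z \<le> R \<and> z \<notin> {0} \<union> {complex_of_real r * exp (\<i> * complex_of_real t) | r t. r > 0 \<and> \<bar>t\<bar> < \<theta>}"
    if "poly (indep_poly (G n)) z = 0" for n z
  proof -
    have "z \<notin> U" using that unfolding U_def by auto
    then show ?thesis using R(2)[of z] cone zero by force
  qed
  then show ?thesis using R(1) \<theta>(1) by (intro exI[of _ R] conjI exI[of _ \<theta>]) auto
qed

end

end

theorem theorem1p4:
  fixes k m :: nat and D :: "'e gluing" and G :: "nat \<Rightarrow> 'v marked_graph"
  assumes "k \<ge> 2" and "m \<ge> 2"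
    and "gluing_data k m D"
    and "nondegenerate k D" and "expanding k D"
    and "maximally_independent k (G 0)"
    and "\<And>n. marked_graph_iso k (graph_recursion m D (G n)) (G (Suc n))"
  shows "\<exists>R>0. \<exists>\<theta>>0. \<forall>n. \<forall>z::complex. poly (indep_poly (G n)) z = 0 \<longrightarrow>
           cmod z \<le> R \<and>
           z \<notin> {0} \<union> {complex_of_real r * exp (\<i> * complex_of_real t) | r t. r > 0 \<and> \<bar>t\<bar> < \<theta>}"
proof -
  interpret hypergraph_gluing k m D by unfold_locales (rule assms(3))
  show ?thesis by (rule zeros_bounded_and_avoid_cone[OF assms(4-7)])
qed

end
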